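(* For every fixed finite irreducible reversible aperiodic Markov kernel $P$ on at least two states, there exist constants $0<c_-(P)\le c_+(P)<\infty$ such that $$\frac{c_-(P)}n\le\operatorname{Gap}(\widetilde P_n)\le\frac{c_+(P)}n\qquad\text{for all integers } n\ge2.$$
   Context: Let $P$ be an irreducible Markov kernel (stochastic matrix) on a finite set $\Omega$ that is reversible with respect to its stationary law $\pi$, i.e. $\pi_xP(x,y)=\pi_yP(y,x)$. "Gap" always means the right spectral gap, i.e. one minus the second largest eigenvalue (counted with multiplicity) of the reversible kernel. Let $(X_t)_{t\in\mathbb Z}$ be a stationary two-sided Markov chain with kernel $P$ and marginal law $\pi$. For a window length $n\ge1$ put $K_t=\sum_{j=0}^{n-1}e_{X_{t+j}}\in\mathbb Z_+^\Omega$, where $e_x$ is the coordinate vector indexed by $x$. Let $\mu_n$ be the law of $K_0$ and $\mathsf S_n=\operatorname{supp}(\mu_n)$. The projected count kernel $\widetilde P_n$ is the Markov kernel on $\mathsf S_n$ defined by $\mu_n(k)\widetilde P_n(k,\ell)=\mathbb P(K_0=k,K_1=\ell)$; it is reversible with respect to $\mu_n$ and irreducible on $\mathsf S_n$. $\operatorname{Gap}(\widetilde P_n)$ is its right spectral gap on $\mathsf S_n$; if $\mathsf S_n$ is a singleton, $\operatorname{Gap}(\widetilde P_n)=1$ by convention. *)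

theory Defs
  imports
    "HOL-Probability.Probability"
    "Jordan_Normal_Form.Char_Poly"
begin

definition markov_kernel :: "('a::finite \<Rightarrow> 'a \<Rightarrow> real) \<Rightarrow> bool" where
  "markov_kernel P \<longleftrightarrow> (\<forall>x y. 0 \<le> P x y) \<and> (\<forall>x. (\<Sum>y\<in>UNIV. P x y) = 1)"

fun kernel_power :: "('a::finite \<Rightarrow> 'a \<Rightarrow> real) \<Rightarrow> nat \<Rightarrow> 'a \<Rightarrow> 'a \<Rightarrow> real" where
  "kernel_power P 0 x y = (if x = y then 1 else 0)"
| "kernel_power P (Suc m) x y = (\<Sum>z\<in>UNIV. P x z * kernel_power P m z y)"

definition irreducible_kernel :: "('a::finite \<Rightarrow> 'a \<Rightarrow> real) \<Rightarrow> bool" where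
  "irreducible_kernel P \<longleftrightarrow> (\<forall>x y. \<exists>m. kernel_power P m x y > 0)"

definition aperiodic_kernel :: "('a::finite \<Rightarrow> 'a \<Rightarrow> real) \<Rightarrow> bool" where
  "aperiodic_kernel P \<longleftrightarrow> (\<forall>x. Gcd {m. m > 0 \<and> kernel_power P m x x > 0} = 1)"

definition stationary_law :: "('a::finite \<Rightarrow> 'a \<Rightarrow> real) \<Rightarrow> ('a \<Rightarrow> real) \<Rightarrow> bool" where
  "stationary_law P \<pi> \<longleftrightarrow>
     (\<forall>x. 0 \<le> \<pi> x) \<and> (\<Sum>x\<in>UNIV. \<pi> x) = 1 \<and> (\<forall>y. (\<Sum>x\<in>UNIV. \<pi> x * P x y) = \<pi> y)"

definition reversible_kernel :: "('a::finite \<Rightarrow> 'a \<Rightarrow> real) \<Rightarrow> ('a \<Rightarrow> real) \<Rightarrow> bool" where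
  "reversible_kernel P \<pi> \<longleftrightarrow> (\<forall>x y. \<pi> x * P x y = \<pi> y * P y x)"

text \<open>A different enumeration of \<open>S\<close> conjugates the matrix by a permutation, so its
  characteristic polynomial does not depend on the choice.\<close>

definition kernel_matrix :: "'b set \<Rightarrow> ('b \<Rightarrow> 'b \<Rightarrow> real) \<Rightarrow> real Matrix.mat" where
  "kernel_matrix S Q =
     (let xs = (SOME xs. distinct xs \<and> set xs = S)
      in Matrix.mat (card S) (card S) (\<lambda>(i, j). Q (xs ! i) (xs ! j)))"

text \<open>Real eigenvalues in decreasing order, repeated according to multiplicity. A reversible kernel
  is diagonalizable over the reals, so for it this list has length \<open>card S\<close> and algebraic and
  geometric multiplicities agree.\<close>

definition eigenvalues_desc :: "'b set \<Rightarrow> ('b \<Rightarrow> 'b \<Rightarrow> real) \<Rightarrow> real list" where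
  "eigenvalues_desc S Q = rev (sorted_list_of_multiset (proots (char_poly (kernel_matrix S Q))))"

definition spectral_gap :: "'b set \<Rightarrow> ('b \<Rightarrow> 'b \<Rightarrow> real) \<Rightarrow> real" where
  "spectral_gap S Q = (if card S = 1 then 1 else 1 - eigenvalues_desc S Q ! 1)"

text \<open>The last clause is the Markov property given the past \<open>X s, \<dots>, X t\<close>, multiplied out to avoid
  conditioning on null events.\<close>

definition stationary_markov_chain ::
  "'w measure \<Rightarrow> (int \<Rightarrow> 'w \<Rightarrow> 'a::finite) \<Rightarrow> ('a \<Rightarrow> 'a \<Rightarrow> real) \<Rightarrow> ('a \<Rightarrow> real) \<Rightarrow> bool" where
  "stationary_markov_chain M X P \<pi> \<longleftrightarrow>
     prob_space M \<and>
     (\<forall>t. X t \<in> measurable M (count_space UNIV)) \<and>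
     (\<forall>t x. measure M {\<omega> \<in> space M. X t \<omega> = x} = \<pi> x) \<and>
     (\<forall>s t x. s \<le> t \<longrightarrow>
        measure M {\<omega> \<in> space M. \<forall>i\<in>{s..t+1}. X i \<omega> = x i} =
        measure M {\<omega> \<in> space M. \<forall>i\<in>{s..t}. X i \<omega> = x i} * P (x t) (x (t + 1)))"

definition coord_vec :: "'a \<Rightarrow> 'a \<Rightarrow> nat" where
  "coord_vec x = (\<lambda>y. if y = x then 1 else 0)"

definition window_count :: "(int \<Rightarrow> 'w \<Rightarrow> 'a) \<Rightarrow> nat \<Rightarrow> int \<Rightarrow> 'w \<Rightarrow> ('a \<Rightarrow> nat)" where
  "window_count X n t \<omega> = (\<lambda>y. \<Sum>j<n. coord_vec (X (t + int j) \<omega>) y)"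

definition count_law :: "'w measure \<Rightarrow> (int \<Rightarrow> 'w \<Rightarrow> 'a) \<Rightarrow> nat \<Rightarrow> ('a \<Rightarrow> nat) \<Rightarrow> real" where
  "count_law M X n k = measure M {\<omega> \<in> space M. window_count X n 0 \<omega> = k}"

definition count_support :: "'w measure \<Rightarrow> (int \<Rightarrow> 'w \<Rightarrow> 'a) \<Rightarrow> nat \<Rightarrow> ('a \<Rightarrow> nat) set" where
  "count_support M X n = {k. count_law M X n k > 0}"

definition projected_count_kernel ::
  "'w measure \<Rightarrow> (int \<Rightarrow> 'w \<Rightarrow> 'a) \<Rightarrow> nat \<Rightarrow> ('a \<Rightarrow> nat) \<Rightarrow> ('a \<Rightarrow> nat) \<Rightarrow> real" where
  "projected_count_kernel M X n k l =
     measure M {\<omega> \<in> space M. window_count X n 0 \<omega> = k \<and> window_count X n 1 \<omega> = l}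
       / count_law M X n k"

text \<open>Any two such chains have the same finite-dimensional laws, so the definitions above depend on the
  chain only through \<open>P\<close>, \<open>\<pi>\<close> and \<open>n\<close>. A chain always exists: reversibility lets both half-chains
  started at time 0 be driven by independent choices \<open>\<omega> (i, a)\<close> with law \<open>P a\<close>.\<close>

lemma stationary_markov_chain_exists:
  fixes P :: "'a::finite \<Rightarrow> 'a \<Rightarrow> real"
  assumes P: "markov_kernel P" and st: "stationary_law P \<pi>" and rev: "reversible_kernel P \<pi>"
  shows "\<exists>(M :: (int \<times> 'a \<Rightarrow> 'a) measure) X. stationary_markov_chain M X P \<pi>"
proof -
  have P0: "P x y \<ge> 0" and P1: "(\<Sum>y\<in>UNIV. P x y) = 1" for x y
    using P by (auto simp: markov_kernel_def)
  have \<pi>0: "\<pi> x \<ge> 0" and \<pi>1: "(\<Sum>y\<in>UNIV. \<pi> y) = 1" and \<pi>P: "(\<Sum>z\<in>UNIV. \<pi> z * P z x) = \<pi> x" for x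
    using st by (auto simp: stationary_law_def)
  have flip: "\<pi> x * P x y = \<pi> y * P y x" for x y using rev by (auto simp: reversible_kernel_def)
  define q where "q = (\<lambda>j::int \<times> 'a. embed_pmf (if fst j = 0 then \<pi> else P (snd j)))"
  have q: "pmf (q j) y = (if fst j = 0 then \<pi> y else P (snd j) y)" for j y
    unfolding q_def
    by (subst pmf_embed_pmf)
       (auto simp: P0 \<pi>0 nn_integral_count_space_finite sum_ennreal P1 \<pi>1)
  define M where "M = Pi\<^sub>M UNIV (\<lambda>j. measure_pmf (q j))"
  interpret product_prob_space "\<lambda>j. measure_pmf (q j)" UNIV by unfold_locales
  have ps: "prob_space M" unfolding M_def by (rule prob_space_axioms)
  interpret M: prob_space M by (rule ps)
  define F where "F = rec_nat (\<lambda>\<omega>::int \<times> 'a \<Rightarrow> 'a. \<omega> (0, undefined)) (\<lambda>n f \<omega>. \<omega> (int (Suc n), f \<omega>))"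
  define B where "B = rec_nat (\<lambda>\<omega>::int \<times> 'a \<Rightarrow> 'a. \<omega> (0, undefined)) (\<lambda>n f \<omega>. \<omega> (- int (Suc n), f \<omega>))"
  define X where "X = (\<lambda>t::int. if t \<ge> 0 then F (nat t) else B (nat (- t)))"
  have coord: "(\<lambda>\<omega>. \<omega> j) \<in> measurable M (count_space UNIV)" for j
    unfolding M_def
    by (rule measurable_cong_sets[THEN equalityD1, THEN subsetD, OF refl _ measurable_component_singleton]) auto
  have step: "(\<lambda>\<omega>. \<omega> (i, f \<omega>)) \<in> measurable M (count_space UNIV)"
    if "f \<in> measurable M (count_space UNIV)" for f i
    using measurable_compose_countable[OF coord that] .
  have "F n \<in> measurable M (count_space UNIV)" "B n \<in> measurable M (count_space UNIV)" for n
    by (induction n) (simp_all add: F_def B_def coord step del: of_nat_Suc)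
  hence meas: "X t \<in> measurable M (count_space UNIV)" for t
    unfolding X_def by auto
  have X0: "X 0 \<omega> = \<omega> (0, undefined)" for \<omega> by (simp add: X_def F_def)
  have Xpos: "X t \<omega> = \<omega> (t, X (t - 1) \<omega>)" if "t > 0" for t \<omega>
  proof -
    define n where "n = nat (t - 1)"
    have "nat t = Suc n" "t = int (Suc n)" "nat (t - 1) = n" using that by (auto simp: n_def)
    thus ?thesis using that by (simp add: X_def F_def)
  qed
  have Xneg: "X t \<omega> = \<omega> (t, X (t + 1) \<omega>)" if "t < 0" for t \<omega>
  proof -
    define n where "n = nat (- t - 1)"
    have t: "t = - int (Suc n)" using that by (auto simp: n_def)
    show ?thesis
    proof (cases n)
      case 0 thus ?thesis using t by (simp add: X_def F_def B_def)
    next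
      case (Suc m)
      have "nat (- t) = Suc n" "nat (- (t + 1)) = n" using t by auto
      thus ?thesis using t Suc by (simp add: X_def B_def)
    qed
  qed
  define W where "W = (\<lambda>s t (x::int \<Rightarrow> 'a). M.prob {\<omega> \<in> space M. \<forall>i\<in>{s..t}. X i \<omega> = x i})"
  define par where "par = (\<lambda>(x::int \<Rightarrow> 'a) i. if i = 0 then undefined else if i > 0 then x (i - 1) else x (i + 1))"
  have box: "W s t x = (\<Prod>i\<in>{s..t}. pmf (q (i, par x i)) (x i))" if "s \<le> 0" "0 \<le> t" for s t x
  proof -
    have ev: "(\<forall>i\<in>{s..t}. X i \<omega> = x i) \<longleftrightarrow> (\<forall>i\<in>{s..t}. \<omega> (i, par x i) = x i)" (is "?L \<longleftrightarrow> ?R") for \<omega>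
    proof
      assume L: ?L
      show ?R
      proof
        fix i assume i: "i \<in> {s..t}"
        consider "i = 0" | "i > 0" | "i < 0" by linarith
        thus "\<omega> (i, par x i) = x i"
        proof cases
          case 2 with that i L have "X (i - 1) \<omega> = x (i - 1)" by auto
          thus ?thesis using 2 L i Xpos[of i \<omega>] by (auto simp: par_def)
        next
          case 3 with that i L have "X (i + 1) \<omega> = x (i + 1)" by auto
          thus ?thesis using 3 L i Xneg[of i \<omega>] by (auto simp: par_def)
        qed (use L i X0[of \<omega>] in \<open>auto simp: par_def\<close>)
      qed
    next
      assume R: ?R
      have zero: "X 0 \<omega> = x 0" using R[rule_format, of 0] that X0[of \<omega>] by (auto simp: par_def)
      have up: "int n \<le> t \<longrightarrow> X (int n) \<omega> = x (int n)" for n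
      proof (induction n)
        case (Suc n)
        show ?case
        proof
          assume le: "int (Suc n) \<le> t"
          hence "X (int n) \<omega> = x (int n)" using Suc by auto
          thus "X (int (Suc n)) \<omega> = x (int (Suc n))"
            using Xpos[of "int (Suc n)" \<omega>] R[rule_format, of "int (Suc n)"] le that by (simp add: par_def)
        qed
      qed (use zero in simp)
      have dn: "s \<le> - int n \<longrightarrow> X (- int n) \<omega> = x (- int n)" for n
      proof (induction n)
        case (Suc n)
        show ?case
        proof
          assume le: "s \<le> - int (Suc n)"
          hence "X (- int n) \<omega> = x (- int n)" using Suc by auto
          moreover have e: "- int (Suc n) + 1 = - int n" by simp
          moreover have "X (- int (Suc n)) \<omega> = \<omega> (- int (Suc n), X (- int n) \<omega>)"
            using Xneg[of "- int (Suc n)" \<omega>, unfolded e] by simp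
          moreover have "par x (- int (Suc n)) = x (- int n)"
            unfolding par_def e by simp
          ultimately show "X (- int (Suc n)) \<omega> = x (- int (Suc n))"
            using R[rule_format, of "- int (Suc n)"] le that by simp
        qed
      qed (use zero in simp)
      show ?L
      proof
        fix i assume i: "i \<in> {s..t}"
        show "X i \<omega> = x i"
          using up[of "nat i"] dn[of "nat (- i)"] i by (cases "i \<ge> 0") auto
      qed
    qed
    define J where "J = (\<lambda>i. (i, par x i)) ` {s..t}"
    have inj: "inj_on (\<lambda>i. (i, par x i)) {s..t}" by (auto simp: inj_on_def)
    have "W s t x = M.prob {\<omega> \<in> space M. \<forall>j\<in>J. \<omega> j \<in> {x (fst j)}}"
      unfolding W_def ev J_def by simp
    also have "\<dots> = measure M (prod_emb UNIV (\<lambda>j. measure_pmf (q j)) J (Pi\<^sub>E J (\<lambda>j. {x (fst j)})))"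
      by (rule arg_cong[where f = "measure M"])
         (auto simp: prod_emb_def M_def space_PiM Pi_iff restrict_def PiE_iff extensional_def)
    also have "\<dots> = (\<Prod>j\<in>J. pmf (q j) (x (fst j)))"
      unfolding M_def by (subst measure_PiM_emb) (auto simp: J_def measure_pmf_single)
    also have "\<dots> = (\<Prod>i\<in>{s..t}. pmf (q (i, par x i)) (x i))"
      unfolding J_def by (subst prod.reindex[OF inj]) simp
    finally show ?thesis .
  qed
  have up0: "W s (t + 1) x = W s t x * P (x t) (x (t + 1))" if "s \<le> 0" "0 \<le> t" for s t x
  proof -
    have "{s..t+1} = insert (t + 1) {s..t}" using that by auto
    thus ?thesis using that by (simp add: box q par_def)
  qed
  have "W (- int n) 0 x = \<pi> (x (- int n)) * (\<Prod>i\<in>{- int n..<0}. P (x i) (x (i + 1)))" for n x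
  proof (induction n)
    case 0 thus ?case by (simp add: box q)
  next
    case (Suc n)
    let ?s = "- int n"
    have e: "{?s - 1..0} = insert (?s - 1) {?s..0}" "{?s - 1..<0} = insert (?s - 1) {?s..<0}" by auto
    have "W (?s - 1) 0 x = P (x ?s) (x (?s - 1)) * W ?s 0 x"
      by (simp add: box e q par_def)
    also have "\<dots> = \<pi> (x (?s - 1)) * P (x (?s - 1)) (x ?s) * (\<Prod>i\<in>{?s..<0}. P (x i) (x (i + 1)))"
      unfolding Suc using flip[of "x ?s" "x (?s - 1)"] by (simp add: mult.commute)
    also have "\<dots> = \<pi> (x (?s - 1)) * (\<Prod>i\<in>{?s - 1..<0}. P (x i) (x (i + 1)))"
      by (simp add: e)
    finally have "W (?s - 1) 0 x = \<pi> (x (?s - 1)) * (\<Prod>i\<in>{?s - 1..<0}. P (x i) (x (i + 1)))" .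
    moreover have "- int (Suc n) = ?s - 1" by simp
    ultimately show ?case by presburger
  qed
  note dn = this
  have dn0: "W s 0 x = \<pi> (x s) * (\<Prod>i\<in>{s..<0}. P (x i) (x (i + 1)))" if "s \<le> 0" for s x
    using dn[of "nat (- s)" x] that by simp
  have mid: "W s t x = \<pi> (x s) * (\<Prod>i\<in>{s..<t}. P (x i) (x (i + 1)))" if "s \<le> 0" "0 \<le> t" for s t x
    using that(2)
  proof (induction t rule: int_ge_induct)
    case base show ?case using dn0 that by simp
  next
    case (step t)
    have "{s..<t+1} = insert t {s..<t}" using that step by auto
    thus ?case using up0[of s t x] step that by simp
  qed
  have split: "W s t x = (\<Sum>y\<in>UNIV. W s' t' (x(r := y)))"
    if "{s'..t'} = insert r {s..t}" "r \<notin> {s..t}" for s t s' t' r x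
  proof -
    have single: "{\<omega> \<in> space M. X i \<omega> = u} \<in> sets M" for i u
    proof -
      have "X i -` {u} \<inter> space M \<in> sets M" by (rule measurable_sets[OF meas]) simp
      moreover have "X i -` {u} \<inter> space M = {\<omega> \<in> space M. X i \<omega> = u}" by blast
      ultimately show ?thesis by simp
    qed
    have set: "{\<omega> \<in> space M. \<forall>i\<in>{s'..t'}. X i \<omega> = z i} \<in> sets M" for z
      by (rule sets.sets_Collect_finite_All) (use single in auto)
    define E where "E = (\<lambda>y. {\<omega> \<in> space M. \<forall>i\<in>{s'..t'}. X i \<omega> = (x(r := y)) i})"
    have E: "\<omega> \<in> E y \<longleftrightarrow> \<omega> \<in> space M \<and> X r \<omega> = y \<and> (\<forall>i\<in>{s..t}. X i \<omega> = x i)" for \<omega> y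
    proof -
      have "(\<forall>i\<in>{s..t}. X i \<omega> = (x(r := y)) i) \<longleftrightarrow> (\<forall>i\<in>{s..t}. X i \<omega> = x i)"
        by (rule ball_cong[OF refl]) (use that(2) in \<open>metis fun_upd_other\<close>)
      thus ?thesis unfolding E_def that(1) by simp
    qed
    have "{\<omega> \<in> space M. \<forall>i\<in>{s..t}. X i \<omega> = x i} = (\<Union>y\<in>UNIV. E y)"
      by (rule Set.set_eqI) (simp add: E)
    also have "measure M \<dots> = (\<Sum>y\<in>UNIV. measure M (E y))"
    proof (rule M.finite_measure_finite_Union)
      show "E ` UNIV \<subseteq> M.events" using set by (auto simp: E_def simp del: fun_upd_apply)
      show "disjoint_family_on E UNIV"
        unfolding disjoint_family_on_def by (auto simp: E)
    qed simp
    also have "\<dots> = (\<Sum>y\<in>UNIV. W s' t' (x(r := y)))"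
      unfolding W_def E_def ..
    finally show ?thesis by (simp add: W_def)
  qed
  have left: "W s t x = \<pi> (x s) * (\<Prod>i\<in>{s..<t}. P (x i) (x (i + 1)))" if "s \<le> t" "s \<le> 0" for s t x
  proof -
    have "t = t' \<Longrightarrow> ?thesis" if "t' \<le> 0" "s \<le> t'" for t'
    proof -
      have "s \<le> t' \<longrightarrow> (\<forall>x. W s t' x = \<pi> (x s) * (\<Prod>i\<in>{s..<t'}. P (x i) (x (i + 1))))"
        using that(1)
      proof (induction t' rule: int_le_induct)
        case base show ?case using dn0 by simp
      next
        case (step t)
        show ?case
        proof (intro impI allI)
          fix x assume st: "s \<le> t - 1"
          have "W s (t - 1) x = (\<Sum>y\<in>UNIV. W s t (x(t := y)))"
            by (rule split) (use st in auto)
          also have "\<dots> = (\<Sum>y\<in>UNIV. \<pi> (x s) * (\<Prod>i\<in>{s..<t-1}. P (x i) (x (i + 1))) * P (x (t - 1)) y)"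
          proof (rule sum.cong[OF refl])
            fix y
            have e: "{s..<t} = insert (t - 1) {s..<t-1}" using st by auto
            have "(\<Prod>i\<in>{s..<t-1}. P ((x(t := y)) i) ((x(t := y)) (i + 1))) = (\<Prod>i\<in>{s..<t-1}. P (x i) (x (i + 1)))"
              by (rule prod.cong) auto
            thus "W s t (x(t := y)) = \<pi> (x s) * (\<Prod>i\<in>{s..<t-1}. P (x i) (x (i + 1))) * P (x (t - 1)) y"
              using step st by (simp add: e del: fun_upd_apply) (simp)
          qed
          also have "\<dots> = \<pi> (x s) * (\<Prod>i\<in>{s..<t-1}. P (x i) (x (i + 1)))"
            by (simp add: sum_distrib_left[symmetric] P1)
          finally show "W s (t - 1) x = \<pi> (x s) * (\<Prod>i\<in>{s..<t-1}. P (x i) (x (i + 1)))" .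
        qed
      qed
      thus "t = t' \<Longrightarrow> ?thesis" using that by auto
    qed
    thus ?thesis using mid that by (cases "t \<le> 0") auto
  qed
  have all: "W s t x = \<pi> (x s) * (\<Prod>i\<in>{s..<t}. P (x i) (x (i + 1)))" if "s \<le> t" for s t x
  proof (cases "s \<le> 0")
    case False
    hence "0 \<le> s" by simp
    hence "\<forall>x. s \<le> t \<longrightarrow> W s t x = \<pi> (x s) * (\<Prod>i\<in>{s..<t}. P (x i) (x (i + 1)))"
    proof (induction s rule: int_ge_induct)
      case base show ?case using left by simp
    next
      case (step s)
      show ?case
      proof (intro impI allI)
        fix x assume le: "s + 1 \<le> t"
        have "W (s + 1) t x = (\<Sum>y\<in>UNIV. W s t (x(s := y)))"
          by (rule split) (use le in auto)
        also have "\<dots> = (\<Sum>y\<in>UNIV. \<pi> y * P y (x (s + 1)) * (\<Prod>i\<in>{s+1..<t}. P (x i) (x (i + 1))))"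
        proof (rule sum.cong[OF refl])
          fix y
          have e: "{s..<t} = insert s {s+1..<t}" using le by auto
          have "(\<Prod>i\<in>{s+1..<t}. P ((x(s := y)) i) ((x(s := y)) (i + 1))) = (\<Prod>i\<in>{s+1..<t}. P (x i) (x (i + 1)))"
            by (rule prod.cong) auto
          thus "W s t (x(s := y)) = \<pi> y * P y (x (s + 1)) * (\<Prod>i\<in>{s+1..<t}. P (x i) (x (i + 1)))"
            using step le by (simp add: e del: fun_upd_apply) (simp)
        qed
        also have "\<dots> = \<pi> (x (s + 1)) * (\<Prod>i\<in>{s+1..<t}. P (x i) (x (i + 1)))"
          by (simp add: sum_distrib_right[symmetric] \<pi>P)
        finally show "W (s + 1) t x = \<pi> (x (s + 1)) * (\<Prod>i\<in>{s+1..<t}. P (x i) (x (i + 1)))" .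
      qed
    qed
    thus ?thesis using that by simp
  qed (use left that in simp)
  have "stationary_markov_chain M X P \<pi>"
    unfolding stationary_markov_chain_def
  proof (intro conjI allI impI)
    fix t y show "M.prob {\<omega> \<in> space M. X t \<omega> = y} = \<pi> y"
      using all[of t t "\<lambda>_. y"] by (simp add: W_def)
  next
    fix s t :: int and x assume st: "s \<le> t"
    have "{s..<t+1} = insert t {s..<t}" using st by auto
    thus "M.prob {\<omega> \<in> space M. \<forall>i\<in>{s..t+1}. X i \<omega> = x i} =
      M.prob {\<omega> \<in> space M. \<forall>i\<in>{s..t}. X i \<omega> = x i} * P (x t) (x (t + 1))"
      using all[of s t x] all[of s "t + 1" x] st by (simp add: W_def)
  qed (use ps meas in auto)
  thus ?thesis by blast
qed

end

theory Submission
  imports Defs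
begin

text \<open>
For a kernel that is reversible with respect to \<open>\<mu>\<close>, the right spectral gap is the largest \<open>\<gamma>\<close> such that
\<open>\<gamma> Var\<^sub>\<mu>(f)\<close> is at most the Dirichlet form of \<open>f\<close>, for all \<open>f\<close>. For the projected count kernel the
Dirichlet form is \<open>E (f K\<^sub>1 - f K\<^sub>0)\<^sup>2 / 2\<close>, so the claim is that the best constant \<open>A\<close> in
\<open>Var f(K\<^sub>0) \<le> A E (f K\<^sub>1 - f K\<^sub>0)\<^sup>2\<close> is of order \<open>n\<close>. Here \<open>f(K\<^sub>0)\<close> is a function \<open>F\<close> of the word
\<open>X\<^sub>0 \<dots> X\<^sub>n\<^sub>-\<^sub>1\<close> that is invariant under permutations of the letters, and everything is expressed by finite
sums over words.

Upper bound on the gap (\<open>eigenfunction_sum_moments\<close>, \<open>additive_step_energy\<close>). Let \<open>g\<close> be a nonconstant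
eigenfunction of \<open>P\<close>. By irreducibility and aperiodicity its eigenvalue lies strictly between \<open>-1\<close> and
\<open>1\<close>, hence the variance of \<open>g X\<^sub>0 + \<dots> + g X\<^sub>n\<^sub>-\<^sub>1\<close> grows linearly, whereas one step of the window changes
this sum only by \<open>g X\<^sub>n - g X\<^sub>0\<close>.

Lower bound on the gap (\<open>window_poincare\<close>). Shifting the window by \<open>r\<close> letters changes \<open>F\<close> by at most
\<open>r\<^sup>2 E (f K\<^sub>1 - f K\<^sub>0)\<^sup>2\<close> in mean square (\<open>shift_energy\<close>); used alone, with \<open>r\<close> of order \<open>n\<close>, this
loses a factor \<open>n\<close>. Instead the variance is decomposed into the increments of the martingale
\<open>E (F | X\<^sub>0, \<dots>, X\<^sub>j\<^sub>-\<^sub>1)\<close> over blocks of a fixed length \<open>m\<close>. Permutation invariance shows that a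
segment \<open>u\<close> in the middle of the window, from \<open>a\<close> to \<open>c\<close>, can be replaced by a fixed segment with the same
end points at the cost of boundedly many shifts: append a connection back to \<open>a\<close> and the fixed
segment on the right, interchange the two segments, and shift back (\<open>segment_swap_energy\<close>). Up to this cost, \<open>F\<close> depends on a segment of
two blocks only through its last letter, and mixing over the second block makes the conditional
mean given the first block nearly constant (\<open>block_contraction\<close>). So the variance gained over one
block is at most a constant times \<open>E (f K\<^sub>1 - f K\<^sub>0)\<^sup>2\<close> plus a small fraction of the variance gained over two
blocks. Summing over the at most \<open>n\<close> blocks, the small fraction is absorbed. The two ends of the
window are treated by shifting it away from the block in question (\<open>mean_square_start\<close>,
\<open>mean_square_end\<close>).
\<close>

section \<open>Words and their weights\<close>

text \<open>All words of length \<open>k\<close> over the state space.\<close>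

definition words :: "nat \<Rightarrow> 'a::finite list set" where
  "words k = {w. length w = k}"

text \<open>The probability that the chain, started at \<open>x\<close>, continues with the letters of the word.\<close>

fun path_weight :: "('a \<Rightarrow> 'a \<Rightarrow> real) \<Rightarrow> 'a \<Rightarrow> 'a list \<Rightarrow> real" where
  "path_weight P x [] = 1"
| "path_weight P x (y # w) = P x y * path_weight P y w"

text \<open>The probability that the stationary chain reads the word; the empty word has weight 1.\<close>

fun word_weight :: "('a \<Rightarrow> 'a \<Rightarrow> real) \<Rightarrow> ('a \<Rightarrow> real) \<Rightarrow> 'a list \<Rightarrow> real" where
  "word_weight P \<pi> [] = 1"
| "word_weight P \<pi> (x # w) = \<pi> x * path_weight P x w"

lemma finite_words [simp]: "finite (words k :: 'a::finite list set)"
  using finite_lists_length_eq[of "UNIV :: 'a set" k] by (simp add: words_def)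

lemma words_0 [simp]: "words 0 = {[]}"
  by (auto simp: words_def)

lemma in_words_iff [simp]: "w \<in> words k \<longleftrightarrow> length w = k"
  by (simp add: words_def)

lemma sum_words_add:
  fixes \<phi> :: "'a::finite list \<Rightarrow> 'b::comm_monoid_add"
  shows "(\<Sum>w\<in>words (k + l). \<phi> w) = (\<Sum>u\<in>words k. \<Sum>v\<in>words l. \<phi> (u @ v))"
proof -
  have "(\<Sum>u\<in>words k. \<Sum>v\<in>words l. \<phi> (u @ v)) = (\<Sum>(u, v)\<in>words k \<times> words l. \<phi> (u @ v))"
    by (rule sum.cartesian_product)
  also have "\<dots> = (\<Sum>w\<in>words (k + l). \<phi> w)"
    by (rule sum.reindex_bij_witness[where i = "\<lambda>w. (take k w, drop k w)" and j = "\<lambda>(u, v). u @ v"])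
       (auto simp: words_def)
  finally show ?thesis ..
qed

lemma sum_words_1:
  fixes \<phi> :: "'a::finite list \<Rightarrow> 'b::comm_monoid_add"
  shows "(\<Sum>w\<in>words (Suc 0). \<phi> w) = (\<Sum>x\<in>UNIV. \<phi> [x])"
  by (rule sum.reindex_bij_witness[where i = "\<lambda>x. [x]" and j = hd])
     (auto simp: words_def length_Suc_conv)

lemma sum_words_Suc:
  fixes \<phi> :: "'a::finite list \<Rightarrow> 'b::comm_monoid_add"
  shows "(\<Sum>w\<in>words (Suc k). \<phi> w) = (\<Sum>x\<in>UNIV. \<Sum>w\<in>words k. \<phi> (x # w))"
  using sum_words_add[of \<phi> 1 k] by (simp add: sum_words_1)

lemma sum_words_Suc_right:
  fixes \<phi> :: "'a::finite list \<Rightarrow> 'b::comm_monoid_add"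
  shows "(\<Sum>w\<in>words (Suc k). \<phi> w) = (\<Sum>w\<in>words k. \<Sum>x\<in>UNIV. \<phi> (w @ [x]))"
  using sum_words_add[of \<phi> k 1] by (simp add: sum_words_1)

lemma path_weight_append:
  "path_weight P x (u @ v) = path_weight P x u * path_weight P (last (x # u)) v"
  by (induction u arbitrary: x) (auto simp: mult.assoc)

lemma word_weight_append:
  "u \<noteq> [] \<Longrightarrow> word_weight P \<pi> (u @ v) = word_weight P \<pi> u * path_weight P (last u) v"
  by (cases u) (auto simp: path_weight_append mult.assoc)

text \<open>A Markov kernel on a finite set with a stationary law.\<close>

locale stationary_kernel =
  fixes P :: "'a::finite \<Rightarrow> 'a \<Rightarrow> real" and \<pi> :: "'a \<Rightarrow> real"
  assumes markov: "markov_kernel P" and stationary: "stationary_law P \<pi>"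
begin

abbreviation "pw \<equiv> path_weight P"
abbreviation "wt \<equiv> word_weight P \<pi>"

text \<open>The expectation of a function of \<open>L\<close> consecutive letters of the stationary chain.\<close>

definition word_expectation :: "nat \<Rightarrow> ('a list \<Rightarrow> real) \<Rightarrow> real" where
  "word_expectation L \<phi> = (\<Sum>w\<in>words L. wt w * \<phi> w)"

lemma P_nonneg [simp]: "0 \<le> P x y" and P_sum [simp]: "(\<Sum>y\<in>UNIV. P x y) = 1"
  using markov by (auto simp: markov_kernel_def)

lemma pi_nonneg [simp]: "0 \<le> \<pi> x" and pi_sum [simp]: "(\<Sum>x\<in>UNIV. \<pi> x) = 1"
  and pi_P: "(\<Sum>x\<in>UNIV. \<pi> x * P x y) = \<pi> y"
  using stationary by (auto simp: stationary_law_def)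

lemma path_weight_nonneg [simp]: "0 \<le> pw x w"
  by (induction w arbitrary: x) auto

lemma word_weight_nonneg [simp]: "0 \<le> wt w"
  by (cases w) auto

lemma path_weight_sum [simp]: "(\<Sum>w\<in>words k. pw x w) = 1"
  by (induction k arbitrary: x) (simp_all add: sum_words_Suc sum_distrib_left[symmetric])

lemma kernel_power_nonneg [simp]: "0 \<le> kernel_power P k x y"
  by (induction k arbitrary: x) (auto intro!: sum_nonneg)

lemma path_weight_sum_last:
  "(\<Sum>w\<in>words k. pw x w * \<phi> (last (x # w))) = (\<Sum>y\<in>UNIV. kernel_power P k x y * \<phi> y)"
proof (induction k arbitrary: x)
  case 0
  have "(\<Sum>y\<in>UNIV. (if x = y then 1 else 0) * \<phi> y) = (\<Sum>y\<in>UNIV. if x = y then \<phi> y else 0)"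
    by (rule sum.cong) auto
  thus ?case by simp
next
  case (Suc k)
  have "(\<Sum>w\<in>words (Suc k). pw x w * \<phi> (last (x # w)))
      = (\<Sum>z\<in>UNIV. P x z * (\<Sum>w\<in>words k. pw z w * \<phi> (last (z # w))))"
    by (simp add: sum_words_Suc sum_distrib_left mult.assoc del: last.simps) (simp add: last_ConsR)
  also have "\<dots> = (\<Sum>z\<in>UNIV. \<Sum>y\<in>UNIV. P x z * kernel_power P k z y * \<phi> y)"
    unfolding Suc by (simp add: sum_distrib_left mult.assoc)
  also have "\<dots> = (\<Sum>y\<in>UNIV. \<Sum>z\<in>UNIV. P x z * kernel_power P k z y * \<phi> y)"
    by (rule sum.swap)
  finally show ?case by (simp add: sum_distrib_right)
qed

lemma kernel_power_sum [simp]: "(\<Sum>y\<in>UNIV. kernel_power P k x y) = 1"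
  using path_weight_sum_last[where k = k and x = x and \<phi> = "\<lambda>_. 1"] by simp

lemma kernel_power_add:
  "kernel_power P (k + l) x y = (\<Sum>z\<in>UNIV. kernel_power P k x z * kernel_power P l z y)"
proof (induction k arbitrary: x)
  case 0
  have "(\<Sum>z\<in>UNIV. (if x = z then 1 else 0) * kernel_power P l z y)
      = (\<Sum>z\<in>UNIV. if x = z then kernel_power P l z y else 0)"
    by (rule sum.cong) auto
  thus ?case by simp
next
  case (Suc k)
  have "kernel_power P (Suc k + l) x y
      = (\<Sum>w\<in>UNIV. \<Sum>z\<in>UNIV. P x w * (kernel_power P k w z * kernel_power P l z y))"
    by (simp add: Suc sum_distrib_left)
  also have "\<dots> = (\<Sum>z\<in>UNIV. \<Sum>w\<in>UNIV. P x w * (kernel_power P k w z * kernel_power P l z y))"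
    by (rule sum.swap)
  finally show ?case by (simp add: sum_distrib_right mult.assoc)
qed

lemma kernel_power_pos_add:
  assumes "kernel_power P k x z > 0" "kernel_power P l z y > 0"
  shows "kernel_power P (k + l) x y > 0"
  unfolding kernel_power_add
  by (rule sum_pos2[where i = z]) (use assms in auto)

lemma pi_kernel_power: "(\<Sum>x\<in>UNIV. \<pi> x * kernel_power P k x y) = \<pi> y"
proof (induction k arbitrary: y)
  case 0
  have "(\<Sum>x\<in>UNIV. \<pi> x * (if x = y then 1 else 0)) = (\<Sum>x\<in>UNIV. if x = y then \<pi> x else 0)"
    by (rule sum.cong) auto
  thus ?case by simp
next
  case (Suc k)
  have "(\<Sum>x\<in>UNIV. \<pi> x * kernel_power P (Suc k) x y)
      = (\<Sum>x\<in>UNIV. \<Sum>z\<in>UNIV. \<pi> x * P x z * kernel_power P k z y)"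
    by (simp add: sum_distrib_left mult.assoc)
  also have "\<dots> = (\<Sum>z\<in>UNIV. \<Sum>x\<in>UNIV. \<pi> x * P x z * kernel_power P k z y)"
    by (rule sum.swap)
  also have "\<dots> = (\<Sum>z\<in>UNIV. \<pi> z * kernel_power P k z y)"
    by (simp add: sum_distrib_right[symmetric] pi_P)
  finally show ?case using Suc by simp
qed

lemma sum_pi_kernel_power:
  "(\<Sum>x\<in>UNIV. \<pi> x * (\<Sum>y\<in>UNIV. kernel_power P k x y * \<phi> y)) = (\<Sum>y\<in>UNIV. \<pi> y * \<phi> y)"
proof -
  have "(\<Sum>x\<in>UNIV. \<pi> x * (\<Sum>y\<in>UNIV. kernel_power P k x y * \<phi> y))
      = (\<Sum>y\<in>UNIV. \<Sum>x\<in>UNIV. \<pi> x * kernel_power P k x y * \<phi> y)"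
    by (subst sum.swap) (simp add: sum_distrib_left mult.assoc)
  thus ?thesis by (simp add: sum_distrib_right[symmetric] pi_kernel_power)
qed

lemma sum_pi_path_weight: "(\<Sum>x\<in>UNIV. \<pi> x * pw x w) = wt w"
  by (cases w) (auto simp: mult.assoc[symmetric] sum_distrib_right[symmetric] pi_P)

lemma word_weight_prefix_sum: "(\<Sum>z\<in>words r. wt (z @ w)) = wt w"
proof (induction r)
  case (Suc r)
  have "(\<Sum>z\<in>words (Suc r). wt (z @ w)) = (\<Sum>z\<in>words r. \<Sum>x\<in>UNIV. wt (x # (z @ w)))"
    by (simp add: sum_words_Suc) (rule sum.swap)
  also have "\<dots> = (\<Sum>z\<in>words r. wt (z @ w))" by (simp add: sum_pi_path_weight)
  finally show ?case using Suc by simp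
qed simp

lemma word_weight_sum [simp]: "(\<Sum>w\<in>words k. wt w) = 1"
  using word_weight_prefix_sum[where r = k and w = "[]"] by simp

lemma word_weight_suffix_sum: "(\<Sum>z\<in>words r. wt (w @ z)) = wt w"
  by (cases "w = []") (simp_all add: word_weight_append sum_distrib_left[symmetric])

lemma word_expectation_drop:
  "word_expectation (r + L) (\<lambda>w. \<phi> (drop r w)) = word_expectation L \<phi>"
proof -
  have "word_expectation (r + L) (\<lambda>w. \<phi> (drop r w)) = (\<Sum>v\<in>words L. \<Sum>z\<in>words r. wt (z @ v) * \<phi> v)"
    unfolding word_expectation_def sum_words_add by (subst sum.swap) (intro sum.cong, auto)
  thus ?thesis by (simp add: word_expectation_def sum_distrib_right[symmetric] word_weight_prefix_sum)
qed

lemma word_expectation_take: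
  "word_expectation (L + r) (\<lambda>w. \<phi> (take L w)) = word_expectation L \<phi>"
proof -
  have "word_expectation (L + r) (\<lambda>w. \<phi> (take L w)) = (\<Sum>v\<in>words L. \<Sum>z\<in>words r. wt (v @ z) * \<phi> v)"
    unfolding word_expectation_def sum_words_add by (intro sum.cong) auto
  thus ?thesis by (simp add: word_expectation_def sum_distrib_right[symmetric] word_weight_suffix_sum)
qed

lemma word_expectation_mono:
  "(\<And>w. length w = L \<Longrightarrow> \<phi> w \<le> \<psi> w) \<Longrightarrow> word_expectation L \<phi> \<le> word_expectation L \<psi>"
  unfolding word_expectation_def by (intro sum_mono mult_left_mono) auto

lemma word_expectation_cong:
  "(\<And>w. length w = L \<Longrightarrow> \<phi> w = \<psi> w) \<Longrightarrow> word_expectation L \<phi> = word_expectation L \<psi>"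
  unfolding word_expectation_def by (intro sum.cong) auto

lemma word_expectation_nonneg:
  "(\<And>w. length w = L \<Longrightarrow> 0 \<le> \<phi> w) \<Longrightarrow> 0 \<le> word_expectation L \<phi>"
  unfolding word_expectation_def by (intro sum_nonneg mult_nonneg_nonneg) auto

lemma word_expectation_cmult: "word_expectation L (\<lambda>w. c * \<phi> w) = c * word_expectation L \<phi>"
  unfolding word_expectation_def by (simp add: sum_distrib_left mult.left_commute)

lemma word_expectation_sum:
  "word_expectation L (\<lambda>w. \<Sum>i\<in>I. \<phi> i w) = (\<Sum>i\<in>I. word_expectation L (\<phi> i))"
  unfolding word_expectation_def sum_distrib_left by (rule sum.swap)

lemma sum_word_weight_last:
  assumes "j \<ge> 1"
  shows "(\<Sum>A\<in>words j. wt A * \<phi> (last A)) = (\<Sum>x\<in>UNIV. \<pi> x * \<phi> x)"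
proof -
  obtain i where j: "j = i + 1" using assms by (metis add.commute le_Suc_ex)
  have "(\<Sum>A\<in>words j. wt A * \<phi> (last A)) = word_expectation (i + 1) (\<lambda>w. \<phi> (last (drop i w)))"
    unfolding word_expectation_def j by (rule sum.cong) (auto simp: last_drop)
  also have "\<dots> = (\<Sum>x\<in>UNIV. \<pi> x * \<phi> x)"
    unfolding word_expectation_drop[where \<phi> = "\<lambda>w. \<phi> (last w)"] by (simp add: word_expectation_def sum_words_1)
  finally show ?thesis .
qed

section \<open>Moving the window\<close>

text \<open>The mean square change of \<open>F\<close> under one step of the window. For a function of the letter counts this
is twice the Dirichlet form of the projected count kernel.\<close>

definition step_energy :: "nat \<Rightarrow> ('a list \<Rightarrow> real) \<Rightarrow> real" where
  "step_energy n F = word_expectation (n + 1) (\<lambda>w. (F (drop 1 w) - F (take n w))\<^sup>2)"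

lemma step_energy_nonneg: "0 \<le> step_energy n F"
  unfolding step_energy_def by (rule word_expectation_nonneg) simp

text \<open>The change over \<open>r\<close> steps is a sum of \<open>r\<close> one-step changes, which are equal in law by stationarity.\<close>

lemma shift_energy:
  "word_expectation (n + r) (\<lambda>w. (F (drop r w) - F (take n w))\<^sup>2) \<le> real (r\<^sup>2) * step_energy n F"
proof -
  define d where "d i w = F (take n (drop (Suc i) w)) - F (take n (drop i w))" for i w
  have tele: "F (drop r w) - F (take n w) = (\<Sum>i<r. d i w)" if "length w = n + r" for w
    unfolding d_def sum_lessThan_telescope[where f = "\<lambda>i. F (take n (drop i w))"]
    using that by simp
  have one: "word_expectation (n + r) (\<lambda>w. (d i w)\<^sup>2) = step_energy n F" if "i < r" for i
  proof -
    have e: "n + r = i + ((n + 1) + (r - i - 1))" using that by simp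
    define \<phi> where "\<phi> = (\<lambda>u. (F (drop 1 u) - F (take n u))\<^sup>2)"
    have "word_expectation (n + r) (\<lambda>w. (d i w)\<^sup>2)
        = word_expectation (n + r) (\<lambda>w. \<phi> (take (n + 1) (drop i w)))"
      by (rule word_expectation_cong) (simp add: d_def \<phi>_def drop_take)
    also have "\<dots> = word_expectation ((n + 1) + (r - i - 1)) (\<lambda>v. \<phi> (take (n + 1) v))"
      by (subst e) (rule word_expectation_drop)
    also have "\<dots> = word_expectation (n + 1) \<phi>" by (rule word_expectation_take)
    also have "\<dots> = step_energy n F" by (simp only: step_energy_def \<phi>_def)
    finally show ?thesis .
  qed
  have "word_expectation (n + r) (\<lambda>w. (F (drop r w) - F (take n w))\<^sup>2)
      \<le> word_expectation (n + r) (\<lambda>w. real r * (\<Sum>i<r. (d i w)\<^sup>2))"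
  proof (rule word_expectation_mono)
    fix w :: "'a list" assume "length w = n + r"
    thus "(F (drop r w) - F (take n w))\<^sup>2 \<le> real r * (\<Sum>i<r. (d i w)\<^sup>2)"
      using sum_squared_le_sum_of_squares[of "\<lambda>i. d i w" "{..<r}"] by (simp add: tele mult.commute)
  qed
  also have "\<dots> = real r * (\<Sum>i<r. word_expectation (n + r) (\<lambda>w. (d i w)\<^sup>2))"
    by (simp add: word_expectation_cmult word_expectation_sum)
  also have "\<dots> = real (r\<^sup>2) * step_energy n F"
    using one by simp (simp add: power2_eq_square)
  finally show ?thesis .
qed

end

section \<open>Positivity and mixing\<close>

lemma finite_uniform_bound:
  fixes Q :: "'b::finite \<Rightarrow> nat \<Rightarrow> bool"
  assumes "\<And>x. \<exists>N. \<forall>m\<ge>N. Q x m"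
  shows "\<exists>N. \<forall>x. \<forall>m\<ge>N. Q x m"
proof -
  obtain N where N: "\<And>x m. m \<ge> N x \<Longrightarrow> Q x m" using assms by metis
  have "N x \<le> Max (range N)" for x by simp
  thus ?thesis using N by (meson le_trans)
qed

text \<open>The standing assumptions on \<open>P\<close>. Irreducibility makes \<open>\<pi>\<close> strictly positive.\<close>

locale ergodic_kernel = stationary_kernel P \<pi>
  for P :: "'a::finite \<Rightarrow> 'a \<Rightarrow> real" and \<pi> +
  assumes irreducible: "irreducible_kernel P" and aperiodic: "aperiodic_kernel P"
    and reversible: "reversible_kernel P \<pi>"
begin

lemma detailed_balance: "\<pi> x * P x y = \<pi> y * P y x"
  using reversible by (simp add: reversible_kernel_def)

lemma pi_pos [simp]: "0 < \<pi> x"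
proof -
  obtain z where z: "\<pi> z > 0"
    using pi_sum pi_nonneg by (metis less_eq_real_def sum.neutral zero_neq_one)
  obtain m where m: "kernel_power P m z x > 0" using irreducible by (auto simp: irreducible_kernel_def)
  have "0 < (\<Sum>y\<in>UNIV. \<pi> y * kernel_power P m y x)"
    by (rule sum_pos2[where i = z]) (use z m in auto)
  thus ?thesis by (simp add: pi_kernel_power)
qed

text \<open>By reversibility every state can be revisited after two steps, so the period is a divisor
  of two and aperiodicity only has to supply one odd return time.\<close>

lemma kernel_power_eventually_pos: "\<exists>N. \<forall>m\<ge>N. kernel_power P m x y > 0"
proof -
  have two: "kernel_power P 2 x x > 0"
  proof -
    obtain z where z: "P x z > 0"
      using P_sum[of x] P_nonneg by (metis less_eq_real_def sum.neutral zero_neq_one)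
    have "\<pi> z * P z x > 0" using z detailed_balance[of x z] by (metis mult_pos_pos pi_pos)
    hence "P z x > 0" using pi_pos[of z] by (simp add: zero_less_mult_iff)
    hence "0 < (\<Sum>z\<in>UNIV. P x z * P z x)" using z by (intro sum_pos2[where i = z]) auto
    moreover have one: "kernel_power P 1 w v = P w v" for w v
    proof -
      have "(\<Sum>z\<in>UNIV. P w z * (if z = v then 1 else 0)) = (\<Sum>z\<in>UNIV. if z = v then P w z else 0)"
        by (rule sum.cong) auto
      thus ?thesis by simp
    qed
    ultimately show ?thesis
      unfolding one_add_one[symmetric] kernel_power_add one by blast
  qed
  have even: "kernel_power P (2 * i) x x > 0" for i
  proof (induction i)
    case (Suc i)
    have "2 * Suc i = 2 + 2 * i" by simp
    thus ?case using kernel_power_pos_add[OF two Suc] by metis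
  qed simp
  obtain d where d: "odd d" "kernel_power P d x x > 0"
  proof -
    have "\<not> 2 dvd Gcd {m. m > 0 \<and> kernel_power P m x x > 0}"
      using aperiodic by (simp add: aperiodic_kernel_def)
    then obtain d where "d \<in> {m. m > 0 \<and> kernel_power P m x x > 0}" "\<not> 2 dvd d"
      using Gcd_greatest by blast
    thus ?thesis using that by blast
  qed
  obtain k where k: "kernel_power P k x y > 0" using irreducible by (auto simp: irreducible_kernel_def)
  have "kernel_power P m x y > 0" if m: "m \<ge> d + k" for m
  proof (cases "even (m - k)")
    case True
    then obtain i where "m - k = 2 * i" by (elim evenE)
    hence "m = 2 * i + k" using m by simp
    thus ?thesis using kernel_power_pos_add[OF even[of i] k] by simp
  next
    case False
    hence "even (m - k - d)" using m d by auto
    then obtain i where "m - k - d = 2 * i" by (elim evenE)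
    hence "m = 2 * i + d + k" using m by simp
    thus ?thesis using kernel_power_pos_add[OF kernel_power_pos_add[OF even[of i] d(2)] k] by simp
  qed
  thus ?thesis by blast
qed

lemma kernel_power_uniformly_pos:
  "\<exists>N \<delta>. N \<ge> 1 \<and> 0 < \<delta> \<and> \<delta> \<le> 1 \<and> (\<forall>m\<ge>N. \<forall>x y. \<delta> \<le> kernel_power P m x y) \<and> (\<forall>x. \<delta> \<le> \<pi> x)"
proof -
  obtain N0 where N0: "\<forall>xy. \<forall>m\<ge>N0. kernel_power P m (fst xy) (snd xy) > 0"
    using finite_uniform_bound[of "\<lambda>xy m. kernel_power P m (fst xy) (snd xy) > 0"]
      kernel_power_eventually_pos by auto
  define N where "N = Suc N0"
  define \<delta> where "\<delta> = Min (range (\<lambda>xy. kernel_power P N (fst xy) (snd xy)))"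
  have le: "\<delta> \<le> kernel_power P N x y" for x y
    unfolding \<delta>_def by (rule Min_le) (auto intro: image_eqI[where x = "(x, y)"])
  have "\<delta> \<in> range (\<lambda>xy. kernel_power P N (fst xy) (snd xy))"
    unfolding \<delta>_def by (rule Min_in) auto
  hence pos: "\<delta> > 0" using N0 by (auto simp: N_def simp del: kernel_power.simps)
  have all: "\<delta> \<le> kernel_power P (l + N) x y" for l x y
  proof -
    have "\<delta> = (\<Sum>z\<in>UNIV. kernel_power P l x z * \<delta>)" by (simp add: sum_distrib_right[symmetric])
    also have "\<dots> \<le> kernel_power P (l + N) x y"
      unfolding kernel_power_add by (intro sum_mono mult_left_mono le) auto
    finally show ?thesis .
  qed
  have pi: "\<delta> \<le> \<pi> x" for x
  proof -
    have "\<delta> = (\<Sum>z\<in>UNIV. \<pi> z * \<delta>)" by (simp add: sum_distrib_right[symmetric])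
    also have "\<dots> \<le> (\<Sum>z\<in>UNIV. \<pi> z * kernel_power P N z x)"
      by (intro sum_mono mult_left_mono le) auto
    finally show ?thesis by (simp add: pi_kernel_power)
  qed
  have "\<delta> \<le> 1" using pi[of undefined] member_le_sum[of undefined UNIV \<pi>] by simp
  moreover have "\<delta> \<le> kernel_power P m x y" if "m \<ge> N" for m x y
    using all[of "m - N" x y] that by simp
  ultimately show ?thesis using pos pi by (intro exI[of _ N] exI[of _ \<delta>]) (auto simp: N_def)
qed

text \<open>Run the two chains independently: they sit at the same state with probability at least
  \<open>\<delta>\<close>, and otherwise the two values of \<open>\<phi>\<close> differ by at most \<open>R\<close>.\<close>

lemma oscillation_contraction:
  assumes \<delta>: "\<And>x y. \<delta> \<le> kernel_power P N x y" and R: "\<And>x y. \<bar>\<phi> x - \<phi> y\<bar> \<le> R"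
  shows "\<bar>(\<Sum>z\<in>UNIV. kernel_power P N x z * \<phi> z) - (\<Sum>z\<in>UNIV. kernel_power P N y z * \<phi> z)\<bar> \<le> (1 - \<delta>) * R"
proof -
  let ?p = "kernel_power P N x" and ?q = "kernel_power P N y"
  have R0: "0 \<le> R" using R[of x x] by simp
  have "(\<Sum>z\<in>UNIV. ?p z * \<phi> z) = (\<Sum>z\<in>UNIV. \<Sum>w\<in>UNIV. ?p z * ?q w * \<phi> z)"
    by (simp add: sum_distrib_left[symmetric] sum_distrib_right[symmetric])
  moreover have "(\<Sum>w\<in>UNIV. ?q w * \<phi> w) = (\<Sum>z\<in>UNIV. \<Sum>w\<in>UNIV. ?p z * ?q w * \<phi> w)"
    by (subst sum.swap) (simp add: sum_distrib_left[symmetric] sum_distrib_right[symmetric])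
  ultimately have "(\<Sum>z\<in>UNIV. ?p z * \<phi> z) - (\<Sum>z\<in>UNIV. ?q z * \<phi> z)
      = (\<Sum>z\<in>UNIV. \<Sum>w\<in>UNIV. ?p z * ?q w * (\<phi> z - \<phi> w))"
    by (simp add: sum_subtractf right_diff_distrib)
  also have "\<bar>\<dots>\<bar> \<le> (\<Sum>z\<in>UNIV. \<Sum>w\<in>UNIV. ?p z * ?q w * (if z = w then 0 else R))"
  proof (rule order.trans[OF sum_abs], rule sum_mono)
    fix z
    show "\<bar>\<Sum>w\<in>UNIV. ?p z * ?q w * (\<phi> z - \<phi> w)\<bar> \<le> (\<Sum>w\<in>UNIV. ?p z * ?q w * (if z = w then 0 else R))"
      by (rule order.trans[OF sum_abs], rule sum_mono)
         (auto simp: abs_mult intro!: mult_left_mono R)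
  qed
  also have "\<dots> = (\<Sum>z\<in>UNIV. ?p z * R - ?p z * ?q z * R)"
  proof (rule sum.cong[OF refl])
    fix z
    have "(\<Sum>w\<in>UNIV. ?p z * ?q w * (if z = w then 0 else R))
        = (\<Sum>w\<in>UNIV. ?p z * R * ?q w - (if z = w then ?p z * ?q w * R else 0))"
      by (rule sum.cong) auto
    thus "(\<Sum>w\<in>UNIV. ?p z * ?q w * (if z = w then 0 else R)) = ?p z * R - ?p z * ?q z * R"
      by (simp add: sum_subtractf sum_distrib_left[symmetric])
  qed
  also have "\<dots> = R - (\<Sum>z\<in>UNIV. ?p z * ?q z) * R"
    by (simp add: sum_subtractf sum_distrib_right[symmetric])
  also have "\<dots> \<le> R - \<delta> * R"
  proof -
    have "\<delta> = (\<Sum>z\<in>UNIV. \<delta> * ?q z)" by (simp add: sum_distrib_left[symmetric])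
    also have "\<dots> \<le> (\<Sum>z\<in>UNIV. ?p z * ?q z)" by (intro sum_mono mult_right_mono \<delta>) auto
    finally show ?thesis using R0 by (simp add: mult_right_mono)
  qed
  finally show ?thesis by (simp add: left_diff_distrib)
qed

lemma oscillation_iterate:
  assumes \<delta>: "\<And>x y. \<delta> \<le> kernel_power P N x y" and R: "\<And>x y. \<bar>\<phi> x - \<phi> y\<bar> \<le> R"
  shows "\<bar>(\<Sum>z\<in>UNIV. kernel_power P (k * N) x z * \<phi> z) - (\<Sum>z\<in>UNIV. kernel_power P (k * N) y z * \<phi> z)\<bar>
    \<le> (1 - \<delta>) ^ k * R"
proof (induction k arbitrary: x y)
  case 0
  have "(\<Sum>z\<in>UNIV. kernel_power P 0 x z * \<phi> z) = \<phi> x" for x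
    using path_weight_sum_last[where k = 0 and x = x and \<phi> = \<phi>] by simp
  thus ?case using R by simp
next
  case (Suc k)
  have e: "(\<Sum>z\<in>UNIV. kernel_power P (Suc k * N) x z * \<phi> z)
      = (\<Sum>w\<in>UNIV. kernel_power P N x w * (\<Sum>z\<in>UNIV. kernel_power P (k * N) w z * \<phi> z))" for x
    by (simp add: kernel_power_add sum_distrib_left sum_distrib_right mult.assoc) (rule sum.swap)
  show ?case
    unfolding e using oscillation_contraction[OF \<delta> Suc, where x = x and y = y] by (simp add: mult.assoc)
qed

text \<open>Under a measure that gives every point mass at least \<open>\<delta>\<close>, oscillation is controlled by variance.\<close>

lemma oscillation_le_variance:
  fixes \<nu> :: "'a \<Rightarrow> real"
  assumes "0 < \<delta>" "\<And>z. \<delta> \<le> \<nu> z"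
  shows "(\<phi> x - \<phi> y)\<^sup>2 \<le> 2 / \<delta> * (\<Sum>z\<in>UNIV. \<nu> z * (\<phi> z - c)\<^sup>2)"
proof (cases "x = y")
  case False
  have nn: "0 \<le> \<nu> z" for z using assms by (meson less_imp_le order_trans)
  have "\<delta> * (\<phi> x - \<phi> y)\<^sup>2 \<le> \<delta> * (2 * (\<phi> x - c)\<^sup>2 + 2 * (\<phi> y - c)\<^sup>2)"
  proof -
    have "0 \<le> ((\<phi> x - c) + (\<phi> y - c))\<^sup>2" by simp
    hence "(\<phi> x - \<phi> y)\<^sup>2 \<le> 2 * (\<phi> x - c)\<^sup>2 + 2 * (\<phi> y - c)\<^sup>2" by (simp add: power2_eq_square algebra_simps)
    thus ?thesis using assms(1) by simp
  qed
  also have "\<dots> = 2 * (\<delta> * (\<phi> x - c)\<^sup>2 + \<delta> * (\<phi> y - c)\<^sup>2)" by (simp add: algebra_simps)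
  also have "\<dots> \<le> 2 * (\<nu> x * (\<phi> x - c)\<^sup>2 + \<nu> y * (\<phi> y - c)\<^sup>2)"
    by (intro mult_left_mono add_mono mult_right_mono assms) auto
  also have "\<dots> = 2 * (\<Sum>z\<in>{x, y}. \<nu> z * (\<phi> z - c)\<^sup>2)" using False by simp
  also have "\<dots> \<le> 2 * (\<Sum>z\<in>UNIV. \<nu> z * (\<phi> z - c)\<^sup>2)"
    by (intro mult_left_mono sum_mono2) (auto simp: nn)
  finally show ?thesis using assms(1) by (simp add: field_simps)
next
  case True
  have "0 \<le> \<nu> z" for z using assms by (meson less_imp_le order_trans)
  thus ?thesis using True assms(1) by (auto intro!: sum_nonneg divide_nonneg_pos mult_nonneg_nonneg)
qed

text \<open>The two laws \<open>P\<^sup>2\<^sup>m(a, \<cdot>)\<close> and \<open>\<pi>\<close> against which the oscillation after \<open>m\<close> steps is measured are the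
ones of the last letter of a double block and of a letter of the stationary chain.\<close>

lemma mixing:
  assumes "\<epsilon> > 0"
  obtains m where "m \<ge> 1" "\<And>k x y. k \<ge> m \<Longrightarrow> 0 < kernel_power P k x y"
    and "\<And>\<phi> x y a c. ((\<Sum>z\<in>UNIV. kernel_power P m x z * \<phi> z) - (\<Sum>z\<in>UNIV. kernel_power P m y z * \<phi> z))\<^sup>2
      \<le> \<epsilon> * (\<Sum>z\<in>UNIV. kernel_power P (2 * m) a z * (\<phi> z - c)\<^sup>2)"
    and "\<And>\<phi> x y c. ((\<Sum>z\<in>UNIV. kernel_power P m x z * \<phi> z) - (\<Sum>z\<in>UNIV. kernel_power P m y z * \<phi> z))\<^sup>2
      \<le> \<epsilon> * (\<Sum>z\<in>UNIV. \<pi> z * (\<phi> z - c)\<^sup>2)"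
proof -
  obtain N \<delta> where N: "N \<ge> 1" and \<delta>: "0 < \<delta>" "\<delta> \<le> 1"
    and P\<delta>: "\<And>m x y. m \<ge> N \<Longrightarrow> \<delta> \<le> kernel_power P m x y" and \<pi>\<delta>: "\<And>x. \<delta> \<le> \<pi> x"
    using kernel_power_uniformly_pos by metis
  have "(\<lambda>k. ((1 - \<delta>)\<^sup>2) ^ k) \<longlonglongrightarrow> 0"
    by (rule LIMSEQ_realpow_zero) (use \<delta> in \<open>auto simp: power_less_one_iff\<close>)
  hence "eventually (\<lambda>k. ((1 - \<delta>)\<^sup>2) ^ k < \<epsilon> * \<delta> / 2) sequentially"
    using assms \<delta> by (intro order_tendstoD(2)) auto
  then obtain k0 where k0: "\<And>k. k \<ge> k0 \<Longrightarrow> ((1 - \<delta>)\<^sup>2) ^ k < \<epsilon> * \<delta> / 2"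
    by (auto simp: eventually_sequentially)
  \<comment> \<open>At least one factor \<open>N\<close>, so that \<open>m\<close>-step probabilities are bounded below.\<close>
  define k where "k = Suc k0"
  define m where "m = k * N"
  have mN: "m \<ge> N" by (simp add: m_def k_def)
  have main: "((\<Sum>z\<in>UNIV. kernel_power P m x z * \<phi> z) - (\<Sum>z\<in>UNIV. kernel_power P m y z * \<phi> z))\<^sup>2
      \<le> \<epsilon> * (\<Sum>z\<in>UNIV. \<nu> z * (\<phi> z - c)\<^sup>2)"
    if \<nu>: "\<And>z. \<delta> \<le> \<nu> z" for \<nu> \<phi> x y and c :: real
  proof -
    define S where "S = (\<Sum>z\<in>UNIV. \<nu> z * (\<phi> z - c)\<^sup>2)"
    have S0: "0 \<le> S" unfolding S_def
      using \<nu> \<delta>(1) by (intro sum_nonneg mult_nonneg_nonneg) (auto intro: order_trans less_imp_le)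
    have "\<bar>\<phi> x - \<phi> y\<bar> \<le> sqrt (2 / \<delta> * S)" for x y
      using real_sqrt_le_mono[OF oscillation_le_variance[OF \<delta>(1) \<nu>,
        where \<phi> = \<phi> and x = x and y = y and c = c]] by (simp add: S_def)
    from oscillation_iterate[OF P\<delta>[OF order_refl] this, where k = k and x = x and y = y]
    have "\<bar>(\<Sum>z\<in>UNIV. kernel_power P m x z * \<phi> z) - (\<Sum>z\<in>UNIV. kernel_power P m y z * \<phi> z)\<bar>
        \<le> (1 - \<delta>) ^ k * sqrt (2 / \<delta> * S)" by (simp add: m_def)
    from power_mono[OF this, of 2]
    have "((\<Sum>z\<in>UNIV. kernel_power P m x z * \<phi> z) - (\<Sum>z\<in>UNIV. kernel_power P m y z * \<phi> z))\<^sup>2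
        \<le> ((1 - \<delta>)\<^sup>2) ^ k * (2 / \<delta> * S)"
      using S0 \<delta>(1) power_mult[of "1 - \<delta>" 2 k] power_mult[of "1 - \<delta>" k 2]
      by (simp add: power_mult_distrib mult.commute)
    also have "\<dots> \<le> (\<epsilon> * \<delta> / 2) * (2 / \<delta> * S)"
      using k0[of k] S0 \<delta>(1) by (intro mult_right_mono) (auto simp: k_def)
    also have "\<dots> = \<epsilon> * S" using \<delta> by simp
    finally show ?thesis by (simp add: S_def)
  qed
  show ?thesis
  proof (rule that[of m])
    show "m \<ge> 1" using mN N by simp
    show "0 < kernel_power P k x y" if "k \<ge> m" for k x y
      using P\<delta>[of k x y] \<delta>(1) mN that by linarith
    show "((\<Sum>z\<in>UNIV. kernel_power P m x z * \<phi> z) - (\<Sum>z\<in>UNIV. kernel_power P m y z * \<phi> z))\<^sup>2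
      \<le> \<epsilon> * (\<Sum>z\<in>UNIV. kernel_power P (2 * m) a z * (\<phi> z - c)\<^sup>2)" for \<phi> x y a c
      by (rule main) (rule P\<delta>, use mN in simp)
    show "((\<Sum>z\<in>UNIV. kernel_power P m x z * \<phi> z) - (\<Sum>z\<in>UNIV. kernel_power P m y z * \<phi> z))\<^sup>2
      \<le> \<epsilon> * (\<Sum>z\<in>UNIV. \<pi> z * (\<phi> z - c)\<^sup>2)" for \<phi> x y c
      by (rule main) (rule \<pi>\<delta>)
  qed
qed

text \<open>For any two states a word of length \<open>k\<close> leading from the first to the second, with a common
lower bound \<open>p\<close> on the weights.\<close>

lemma connecting_words:
  assumes "\<And>x y. 0 < kernel_power P k x y"
  obtains u and p :: real where "0 < p" "\<And>x y. length (u x y) = k"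
    "\<And>x y. last (x # u x y) = y" "\<And>x y. p \<le> pw x (u x y)"
proof -
  have "\<exists>w. length w = k \<and> last (x # w) = y \<and> 0 < pw x w" for x y
  proof (rule ccontr)
    assume none: "\<not> ?thesis"
    have "kernel_power P k x y = (\<Sum>z\<in>UNIV. kernel_power P k x z * (if z = y then 1 else 0))"
    proof -
      have "(\<Sum>z\<in>UNIV. kernel_power P k x z * (if z = y then 1 else 0))
          = (\<Sum>z\<in>UNIV. if z = y then kernel_power P k x z else 0)" by (rule sum.cong) auto
      thus ?thesis by simp
    qed
    also have "\<dots> = (\<Sum>w\<in>words k. pw x w * (if last (x # w) = y then 1 else 0))"
      by (rule path_weight_sum_last[symmetric])
    also have "\<dots> = 0"
    proof (rule sum.neutral, rule ballI)
      fix w :: "'a list" assume "w \<in> words k"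
      hence "last (x # w) = y \<Longrightarrow> pw x w = 0"
        using none path_weight_nonneg[of x w] by (auto simp: not_less intro: antisym)
      thus "pw x w * (if last (x # w) = y then 1 else 0) = 0" by simp
    qed
    finally show False using assms[of x y] by simp
  qed
  then obtain u where u: "\<And>x y. length (u x y) = k" "\<And>x y. last (x # u x y) = y"
    "\<And>x y. 0 < pw x (u x y)" by metis
  define p where "p = Min (range (\<lambda>xy. pw (fst xy) (u (fst xy) (snd xy))))"
  have "p \<in> range (\<lambda>xy. pw (fst xy) (u (fst xy) (snd xy)))" unfolding p_def by (rule Min_in) auto
  hence "0 < p" using u(3) by auto
  moreover have "p \<le> pw x (u x y)" for x y
    unfolding p_def by (rule Min_le) (auto intro: image_eqI[where x = "(x, y)"])
  ultimately show ?thesis using that u by blast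
qed

end

section \<open>Weighted averages\<close>

lemma weighted_square_expand:
  fixes p x :: "'b \<Rightarrow> real"
  assumes "(\<Sum>i\<in>I. p i) = 1"
  shows "(\<Sum>i\<in>I. p i * (x i - c)\<^sup>2) = (\<Sum>i\<in>I. p i * (x i)\<^sup>2) - 2 * c * (\<Sum>i\<in>I. p i * x i) + c\<^sup>2"
proof -
  have "(\<Sum>i\<in>I. p i * (x i - c)\<^sup>2) = (\<Sum>i\<in>I. p i * (x i)\<^sup>2 - 2 * c * (p i * x i) + c\<^sup>2 * p i)"
    by (rule sum.cong) (auto simp: power2_eq_square algebra_simps)
  thus ?thesis using assms by (simp add: sum.distrib sum_subtractf sum_distrib_left[symmetric])
qed

lemma weighted_variance:
  fixes p x :: "'b \<Rightarrow> real"
  assumes "(\<Sum>i\<in>I. p i) = 1"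
  shows "(\<Sum>i\<in>I. p i * (x i - (\<Sum>i\<in>I. p i * x i))\<^sup>2) = (\<Sum>i\<in>I. p i * (x i)\<^sup>2) - (\<Sum>i\<in>I. p i * x i)\<^sup>2"
  unfolding weighted_square_expand[OF assms] by (simp add: power2_eq_square)

lemma weighted_variance_le:
  fixes p x :: "'b \<Rightarrow> real"
  assumes "(\<Sum>i\<in>I. p i) = 1"
  shows "(\<Sum>i\<in>I. p i * (x i - (\<Sum>i\<in>I. p i * x i))\<^sup>2) \<le> (\<Sum>i\<in>I. p i * (x i - c)\<^sup>2)"
proof -
  have "0 \<le> ((\<Sum>i\<in>I. p i * x i) - c)\<^sup>2" by simp
  thus ?thesis unfolding weighted_square_expand[OF assms] by (simp add: power2_eq_square algebra_simps)
qed

lemma weighted_jensen: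
  fixes p x :: "'b \<Rightarrow> real"
  assumes "(\<Sum>i\<in>I. p i) = 1" "\<And>i. i \<in> I \<Longrightarrow> 0 \<le> p i"
  shows "(\<Sum>i\<in>I. p i * x i)\<^sup>2 \<le> (\<Sum>i\<in>I. p i * (x i)\<^sup>2)"
proof -
  have "0 \<le> (\<Sum>i\<in>I. p i * (x i - (\<Sum>i\<in>I. p i * x i))\<^sup>2)"
    using assms(2) by (intro sum_nonneg) auto
  thus ?thesis unfolding weighted_variance[OF assms(1)] by simp
qed

lemma square_add_le: "((x::real) + y)\<^sup>2 \<le> 2 * x\<^sup>2 + 2 * y\<^sup>2"
proof -
  have "0 \<le> (x - y)\<^sup>2" by simp
  thus ?thesis by (simp add: power2_eq_square algebra_simps)
qed

lemma square_diff_le: "((x::real) - y)\<^sup>2 \<le> 2 * (x - z)\<^sup>2 + 2 * (z - y)\<^sup>2"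
  using square_add_le[of "x - z" "z - y"] by simp

lemma weighted_sum_linear:
  fixes p x y :: "'b \<Rightarrow> real"
  shows "(\<Sum>i\<in>I. p i * (c * x i + d * y i)) = c * (\<Sum>i\<in>I. p i * x i) + d * (\<Sum>i\<in>I. p i * y i)"
  by (simp add: sum.distrib sum_distrib_left distrib_left mult.left_commute)

context stationary_kernel
begin

section \<open>Martingale decomposition\<close>

text \<open>The conditional mean of \<open>F\<close>, a function of \<open>n\<close> letters, given that the first \<open>j\<close> letters form the
nonempty word \<open>A\<close>, and its second moment. The conditional law of the remaining letters depends on
\<open>last A\<close> only, so these notions are used for \<open>1 \<le> j \<le> n\<close>.\<close>

definition cond_mean :: "nat \<Rightarrow> ('a list \<Rightarrow> real) \<Rightarrow> nat \<Rightarrow> 'a list \<Rightarrow> real" where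
  "cond_mean n F j A = (\<Sum>B\<in>words (n - j). pw (last A) B * F (A @ B))"

definition mean_square :: "nat \<Rightarrow> ('a list \<Rightarrow> real) \<Rightarrow> nat \<Rightarrow> real" where
  "mean_square n F j = (\<Sum>A\<in>words j. wt A * (cond_mean n F j A)\<^sup>2)"

lemma cond_mean_full: "length A = n \<Longrightarrow> cond_mean n F n A = F A"
  by (simp add: cond_mean_def)

lemma mean_square_full: "mean_square n F n = word_expectation n (\<lambda>w. (F w)\<^sup>2)"
  unfolding mean_square_def word_expectation_def
  by (rule sum.cong) (auto simp: cond_mean_full)

lemma cond_mean_tower:
  assumes "A \<noteq> []" "j + k \<le> n"
  shows "cond_mean n F j A = (\<Sum>u\<in>words k. pw (last A) u * cond_mean n F (j + k) (A @ u))"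
proof -
  have e: "n - j = k + (n - (j + k))" using assms by simp
  have l: "last (A @ u) = last (last A # u)" for u using assms(1) by auto
  show ?thesis
    unfolding cond_mean_def e sum_words_add path_weight_append l
    by (simp add: sum_distrib_left mult.assoc)
qed

lemma mean_square_increment:
  assumes "1 \<le> j" "j + k \<le> n"
  shows "mean_square n F (j + k) - mean_square n F j =
    (\<Sum>A\<in>words j. wt A * (\<Sum>u\<in>words k. pw (last A) u * (cond_mean n F (j + k) (A @ u) - cond_mean n F j A)\<^sup>2))"
proof -
  have "mean_square n F (j + k)
      = (\<Sum>A\<in>words j. wt A * (\<Sum>u\<in>words k. pw (last A) u * (cond_mean n F (j + k) (A @ u))\<^sup>2))"
    unfolding mean_square_def sum_words_add
  proof (rule sum.cong[OF refl])
    fix A :: "'a list" assume "A \<in> words j"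
    hence "A \<noteq> []" using assms(1) by auto
    thus "(\<Sum>v\<in>words k. wt (A @ v) * (cond_mean n F (j + k) (A @ v))\<^sup>2)
        = wt A * (\<Sum>u\<in>words k. pw (last A) u * (cond_mean n F (j + k) (A @ u))\<^sup>2)"
      by (simp add: word_weight_append sum_distrib_left mult.assoc)
  qed
  moreover have "(\<Sum>u\<in>words k. pw (last A) u * (cond_mean n F (j + k) (A @ u) - cond_mean n F j A)\<^sup>2)
      = (\<Sum>u\<in>words k. pw (last A) u * (cond_mean n F (j + k) (A @ u))\<^sup>2) - (cond_mean n F j A)\<^sup>2"
    if "A \<in> words j" for A
  proof -
    have "A \<noteq> []" using that assms(1) by auto
    from cond_mean_tower[OF this assms(2)] show ?thesis
      using weighted_variance[of "pw (last A)" "words k" "\<lambda>u. cond_mean n F (j + k) (A @ u)"] by simp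
  qed
  ultimately show ?thesis
    by (simp add: mean_square_def right_diff_distrib sum_subtractf)
qed

lemma mean_square_mono:
  assumes "1 \<le> j" "j \<le> k" "k \<le> n"
  shows "mean_square n F j \<le> mean_square n F k"
proof -
  have "0 \<le> mean_square n F (j + (k - j)) - mean_square n F j"
    by (subst mean_square_increment) (use assms in \<open>auto intro!: sum_nonneg mult_nonneg_nonneg\<close>)
  thus ?thesis using assms by simp
qed

text \<open>If the part of the window beyond \<open>A\<close> is short, shifting the window backwards by that length
  makes the function independent of it.\<close>

lemma mean_square_end:
  assumes "1 \<le> j" "j \<le> n"
  shows "mean_square n F n - mean_square n F j \<le> real ((n - j)\<^sup>2) * step_energy n F"
proof -
  define r where "r = n - j"
  have n: "n = j + r" using assms by (simp add: r_def)
  have "mean_square n F (j + r) - mean_square n F j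
      = (\<Sum>A\<in>words j. wt A * (\<Sum>u\<in>words r. pw (last A) u * (F (A @ u) - cond_mean n F j A)\<^sup>2))"
  proof -
    have "cond_mean n F (j + r) (A @ u) = F (A @ u)" if "A \<in> words j" "u \<in> words r" for A u
      using that cond_mean_full[of "A @ u" n F] by (simp add: n)
    moreover have "j + r \<le> n" by (simp add: n)
    ultimately show ?thesis by (simp add: mean_square_increment[OF assms(1)])
  qed
  also have "\<dots> = (\<Sum>A\<in>words j. \<Sum>z\<in>words r. wt (z @ A) *
      (\<Sum>u\<in>words r. pw (last A) u * (F (A @ u) - cond_mean n F j A)\<^sup>2))"
    by (simp add: sum_distrib_right[symmetric] word_weight_prefix_sum)
  also have "\<dots> \<le> (\<Sum>A\<in>words j. \<Sum>z\<in>words r. wt (z @ A) *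
      (\<Sum>u\<in>words r. pw (last A) u * (F (A @ u) - F (z @ A))\<^sup>2))"
  proof (rule sum_mono, rule sum_mono, rule mult_left_mono)
    fix A z :: "'a list" assume A: "A \<in> words j"
    hence "A \<noteq> []" using assms(1) by auto
    hence "cond_mean n F j A = (\<Sum>u\<in>words r. pw (last A) u * F (A @ u))"
      by (simp add: cond_mean_def r_def)
    thus "(\<Sum>u\<in>words r. pw (last A) u * (F (A @ u) - cond_mean n F j A)\<^sup>2)
        \<le> (\<Sum>u\<in>words r. pw (last A) u * (F (A @ u) - F (z @ A))\<^sup>2)"
      using weighted_variance_le[of "pw (last A)" "words r" "\<lambda>u. F (A @ u)"] by simp
  qed simp
  also have "\<dots> = word_expectation (r + (j + r)) (\<lambda>w. (F (drop r w) - F (take n w))\<^sup>2)"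
  proof -
    have "wt (z @ A) * (\<Sum>u\<in>words r. pw (last A) u * (F (A @ u) - F (z @ A))\<^sup>2)
        = (\<Sum>u\<in>words r. wt (z @ A @ u) * (F (drop r (z @ A @ u)) - F (take n (z @ A @ u)))\<^sup>2)"
      if *: "z \<in> words r" "A \<in> words j" for z A
    proof -
      have "A \<noteq> []" using * assms(1) by auto
      hence "wt (z @ A @ u) = wt (z @ A) * pw (last A) u" for u
        using word_weight_append[of "z @ A" P \<pi> u] by simp
      moreover have "drop r (z @ A @ u) = A @ u" "take n (z @ A @ u) = z @ A" for u
        using * by (auto simp: n)
      ultimately show ?thesis by (simp add: sum_distrib_left mult.assoc)
    qed
    note inner = this
    show ?thesis
      unfolding word_expectation_def sum_words_add
      by (subst sum.swap, rule sum.cong[OF refl], rule sum.cong[OF refl], rule inner)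
  qed
  also have "\<dots> \<le> real (r\<^sup>2) * step_energy n F"
  proof -
    have "r + (j + r) = n + r" by (simp add: n)
    thus ?thesis using shift_energy by metis
  qed
  finally show ?thesis by (simp only: n[symmetric] r_def[symmetric])
qed

text \<open>Replacing \<open>\<psi>\<close> by a function \<open>\<gamma>\<close> of the last letter alone, mixing over the second half of the
  block makes the conditional mean given the first half almost constant.\<close>

lemma block_contraction:
  fixes \<psi> :: "'a list \<Rightarrow> real" and \<gamma> :: "'a \<Rightarrow> real"
  assumes mix: "\<And>x y c. ((\<Sum>z\<in>UNIV. kernel_power P m x z * \<gamma> z) - (\<Sum>z\<in>UNIV. kernel_power P m y z * \<gamma> z))\<^sup>2
      \<le> \<epsilon> * (\<Sum>z\<in>UNIV. kernel_power P (2 * m) a z * (\<gamma> z - c)\<^sup>2)"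
    and \<epsilon>: "0 \<le> \<epsilon>"
  defines "\<psi>0 \<equiv> \<Sum>u\<in>words (2 * m). pw a u * \<psi> u"
  shows "(\<Sum>u\<in>words m. pw a u * ((\<Sum>v\<in>words m. pw (last (a # u)) v * \<psi> (u @ v)) - \<psi>0)\<^sup>2)
    \<le> (2 + 4 * \<epsilon>) * (\<Sum>u\<in>words (2 * m). pw a u * (\<psi> u - \<gamma> (last (a # u)))\<^sup>2)
      + 4 * \<epsilon> * (\<Sum>u\<in>words (2 * m). pw a u * (\<psi> u - \<psi>0)\<^sup>2)"
proof -
  define D where "D = (\<lambda>u. \<psi> u - \<gamma> (last (a # u)))"
  define D1 where "D1 = (\<lambda>u. \<Sum>v\<in>words m. pw (last (a # u)) v * D (u @ v))"
  define G1 where "G1 = (\<lambda>u. \<Sum>z\<in>UNIV. kernel_power P m (last (a # u)) z * \<gamma> z)"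
  define D0 where "D0 = (\<Sum>u\<in>words m. pw a u * D1 u)"
  define G0 where "G0 = (\<Sum>u\<in>words m. pw a u * G1 u)"
  define K where "K = (\<Sum>z\<in>UNIV. kernel_power P (2 * m) a z * (\<gamma> z - \<psi>0)\<^sup>2)"
  define SD where "SD = (\<Sum>u\<in>words (2 * m). pw a u * (D u)\<^sup>2)"
  have two: "2 * m = m + m" by simp
  have l: "last (a # u @ v) = last (last (a # u) # v)" for u v by auto
  have split: "(\<Sum>u\<in>words (2 * m). pw a u * \<phi> u)
      = (\<Sum>u\<in>words m. pw a u * (\<Sum>v\<in>words m. pw (last (a # u)) v * \<phi> (u @ v)))" for \<phi>
    unfolding two sum_words_add path_weight_append by (simp add: sum_distrib_left mult.assoc)
  have \<psi>1: "(\<Sum>v\<in>words m. pw (last (a # u)) v * \<psi> (u @ v)) = D1 u + G1 u" for u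
  proof -
    have "(\<Sum>v\<in>words m. pw (last (a # u)) v * \<psi> (u @ v))
        = D1 u + (\<Sum>v\<in>words m. pw (last (a # u)) v * \<gamma> (last (last (a # u) # v)))"
      unfolding D1_def D_def sum.distrib[symmetric] l
      by (rule sum.cong) (simp_all add: right_diff_distrib)
    thus ?thesis unfolding path_weight_sum_last G1_def .
  qed
  have \<psi>0: "\<psi>0 = D0 + G0"
    unfolding \<psi>0_def split \<psi>1 D0_def G0_def by (simp add: sum.distrib distrib_left)
  have sD: "(\<Sum>u\<in>words m. pw a u * (D1 u - D0)\<^sup>2) \<le> SD"
  proof -
    have "(\<Sum>u\<in>words m. pw a u * (D1 u - D0)\<^sup>2) \<le> (\<Sum>u\<in>words m. pw a u * (D1 u)\<^sup>2)"
      using weighted_variance_le[of "pw a" "words m" D1 0] by (simp add: D0_def)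
    also have "\<dots> \<le> (\<Sum>u\<in>words m. pw a u * (\<Sum>v\<in>words m. pw (last (a # u)) v * (D (u @ v))\<^sup>2))"
      unfolding D1_def by (intro sum_mono mult_left_mono weighted_jensen) auto
    also have "\<dots> = SD" unfolding SD_def split ..
    finally show ?thesis .
  qed
  have sG: "(\<Sum>u\<in>words m. pw a u * (G1 u - G0)\<^sup>2) \<le> \<epsilon> * K"
  proof -
    have "(G1 u - G0)\<^sup>2 \<le> \<epsilon> * K" for u
    proof -
      have "G1 u - G0 = (\<Sum>v\<in>words m. pw a v * (G1 u - G1 v))"
        unfolding G0_def by (simp add: right_diff_distrib sum_subtractf sum_distrib_right[symmetric])
      hence "(G1 u - G0)\<^sup>2 \<le> (\<Sum>v\<in>words m. pw a v * (G1 u - G1 v)\<^sup>2)"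
        using weighted_jensen[of "pw a" "words m" "\<lambda>v. G1 u - G1 v"] by simp
      also have "\<dots> \<le> (\<Sum>v\<in>words m. pw a v * (\<epsilon> * K))"
        unfolding G1_def K_def by (intro sum_mono mult_left_mono mix) auto
      finally show ?thesis by (simp add: sum_distrib_right[symmetric])
    qed
    hence "(\<Sum>u\<in>words m. pw a u * (G1 u - G0)\<^sup>2) \<le> (\<Sum>u\<in>words m. pw a u * (\<epsilon> * K))"
      by (intro sum_mono mult_left_mono) auto
    thus ?thesis by (simp add: sum_distrib_right[symmetric])
  qed
  have K: "K \<le> 2 * SD + 2 * (\<Sum>u\<in>words (2 * m). pw a u * (\<psi> u - \<psi>0)\<^sup>2)"
  proof -
    have "K = (\<Sum>u\<in>words (2 * m). pw a u * (\<gamma> (last (a # u)) - \<psi>0)\<^sup>2)"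
      unfolding K_def by (rule path_weight_sum_last[where \<phi> = "\<lambda>z. (\<gamma> z - \<psi>0)\<^sup>2", symmetric])
    also have "\<dots> \<le> (\<Sum>u\<in>words (2 * m). pw a u * (2 * (D u)\<^sup>2 + 2 * (\<psi> u - \<psi>0)\<^sup>2))"
    proof (intro sum_mono mult_left_mono)
      fix u
      show "(\<gamma> (last (a # u)) - \<psi>0)\<^sup>2 \<le> 2 * (D u)\<^sup>2 + 2 * (\<psi> u - \<psi>0)\<^sup>2"
        using square_diff_le[of "\<gamma> (last (a # u))" \<psi>0 "\<psi> u"] by (simp only: D_def power2_commute)
    qed simp
    also have "\<dots> = 2 * SD + 2 * (\<Sum>u\<in>words (2 * m). pw a u * (\<psi> u - \<psi>0)\<^sup>2)"
      by (simp add: SD_def distrib_left sum.distrib sum_distrib_left mult.left_commute)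
    finally show ?thesis .
  qed
  have "(\<Sum>u\<in>words m. pw a u * (D1 u + G1 u - \<psi>0)\<^sup>2)
      \<le> (\<Sum>u\<in>words m. pw a u * (2 * (D1 u - D0)\<^sup>2 + 2 * (G1 u - G0)\<^sup>2))"
  proof (intro sum_mono mult_left_mono)
    fix u
    show "(D1 u + G1 u - \<psi>0)\<^sup>2 \<le> 2 * (D1 u - D0)\<^sup>2 + 2 * (G1 u - G0)\<^sup>2"
      using square_add_le[of "D1 u - D0" "G1 u - G0"] by (simp add: \<psi>0 algebra_simps)
  qed simp
  also have "\<dots> = 2 * (\<Sum>u\<in>words m. pw a u * (D1 u - D0)\<^sup>2) + 2 * (\<Sum>u\<in>words m. pw a u * (G1 u - G0)\<^sup>2)"
    by (simp add: distrib_left sum.distrib sum_distrib_left mult.left_commute)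
  also have "\<dots> \<le> 2 * SD + 2 * (\<epsilon> * (2 * SD + 2 * (\<Sum>u\<in>words (2 * m). pw a u * (\<psi> u - \<psi>0)\<^sup>2)))"
    using sD sG mult_left_mono[OF K \<epsilon>] by linarith
  also have "\<dots> = (2 + 4 * \<epsilon>) * SD + 4 * \<epsilon> * (\<Sum>u\<in>words (2 * m). pw a u * (\<psi> u - \<psi>0)\<^sup>2)"
    by (simp add: algebra_simps)
  finally show ?thesis unfolding \<psi>1 by (simp only: SD_def D_def)
qed

text \<open>The segment \<open>u\<close> from \<open>a\<close> to \<open>c\<close> may be exchanged with the fixed segment \<open>U a c\<close>: append to the
window a connection \<open>U e a\<close> from its last letter \<open>e\<close> back to \<open>a\<close>, followed by the segment that is not
already present. The two longer words have the same weight, and they remain permutations of each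
other when the same prefix of \<open>A\<close> is dropped. So both windows are boundedly many shifts away from
windows on which \<open>F\<close> takes the same value.\<close>

lemma segment_swap_energy:
  assumes sym: "\<And>v w. mset v = mset w \<Longrightarrow> F v = F w"
    and U: "\<And>x y. length (U x y) = k" "\<And>x y. last (x # U x y) = y" "\<And>x y. p \<le> pw x (U x y)"
    and p: "0 < p" and k: "1 \<le> k" and j: "2 * k \<le> j"
  shows "(\<Sum>A\<in>words j. \<Sum>u\<in>words k. \<Sum>B\<in>words r. wt (A @ u @ B) *
      (F (A @ u @ B) - F (A @ U (last A) (last u) @ B))\<^sup>2)
    \<le> 4 / p\<^sup>2 * (real ((2 * k)\<^sup>2) * step_energy (j + k + r) F)"
proof -
  define n where "n = j + k + r"
  define T :: "('a list \<times> 'a list \<times> 'a list) set" where "T = words j \<times> words k \<times> words r"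
  define \<Delta> where "\<Delta> w = (F (drop (2 * k) w) - F (take n w))\<^sup>2" for w
  define E where "E = word_expectation (n + 2 * k) \<Delta>"
  have E: "E \<le> real ((2 * k)\<^sup>2) * step_energy n F"
    unfolding E_def \<Delta>_def by (rule shift_energy)
  define f1 where "f1 = (\<lambda>(A, u, B). A @ u @ B @ U (last (A @ u @ B)) (last A) @ U (last A) (last u))"
  define f2 where "f2 = (\<lambda>(A, u, B). A @ U (last A) (last u) @ B @ U (last (A @ u @ B)) (last A) @ u)"
  have fin: "finite T" by (simp add: T_def)
  have wt1: "wt (A @ u @ B) * p\<^sup>2 \<le> wt (f1 (A, u, B))"
    and wt2: "wt (f2 (A, u, B)) = wt (f1 (A, u, B))" if "(A, u, B) \<in> T" for A u B
  proof -
    have len: "length A = j" "length u = k" "length B = r" using that by (auto simp: T_def)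
    have ne: "A \<noteq> []" "u \<noteq> []" "\<And>x y. U x y \<noteq> []"
      using len k j U(1) by (metis list.size(3) mult_is_0 not_one_le_zero le_0_eq zero_neq_numeral)+
    have lU: "last (U x y) = y" for x y using U(2)[of x y] ne(3) by simp
    let ?a = "last A" and ?c = "last u" and ?e = "last (A @ u @ B)"
    have e: "last (last u # B) = ?e" using ne by auto
    have w1: "wt (f1 (A, u, B)) = wt A * pw ?a u * pw ?c B * pw ?e (U ?e ?a) * pw ?a (U ?a ?c)"
      using ne by (simp add: f1_def word_weight_append path_weight_append lU mult.assoc)
    have w2: "wt (f2 (A, u, B)) = wt A * pw ?a (U ?a ?c) * pw ?c B * pw ?e (U ?e ?a) * pw ?a u"
      using ne by (simp add: f2_def word_weight_append path_weight_append lU mult.assoc)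
    show "wt (f2 (A, u, B)) = wt (f1 (A, u, B))" unfolding w1 w2 by (simp add: ac_simps)
    have "wt (A @ u @ B) * (p * p) \<le> wt (A @ u @ B) * (pw ?e (U ?e ?a) * pw ?a (U ?a ?c))"
      using p by (intro mult_left_mono mult_mono U(3)) auto
    also have "\<dots> = wt (f1 (A, u, B))"
      unfolding w1 using ne by (simp add: word_weight_append path_weight_append mult.assoc)
    finally show "wt (A @ u @ B) * p\<^sup>2 \<le> wt (f1 (A, u, B))" by (simp add: power2_eq_square)
  qed
  have inj1: "inj_on f1 T" and inj2: "inj_on f2 T"
    by (auto simp: inj_on_def T_def f1_def f2_def U(1))
  have img: "f1 ` T \<subseteq> words (n + 2 * k)" "f2 ` T \<subseteq> words (n + 2 * k)"
    by (auto simp: T_def f1_def f2_def n_def U(1))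
  have bound: "(\<Sum>t\<in>T. wt (f t) * \<Delta> (f t)) \<le> E" if "inj_on f T" "f ` T \<subseteq> words (n + 2 * k)" for f
  proof -
    have "(\<Sum>t\<in>T. wt (f t) * \<Delta> (f t)) = (\<Sum>w\<in>f ` T. wt w * \<Delta> w)"
      using that(1) by (simp add: sum.reindex)
    also have "\<dots> \<le> E" unfolding E_def word_expectation_def
      by (rule sum_mono2) (use that(2) in \<open>auto simp: \<Delta>_def\<close>)
    finally show ?thesis .
  qed
  have "(\<Sum>A\<in>words j. \<Sum>u\<in>words k. \<Sum>B\<in>words r. wt (A @ u @ B) *
      (F (A @ u @ B) - F (A @ U (last A) (last u) @ B))\<^sup>2)
    = (\<Sum>(A, u, B)\<in>T. wt (A @ u @ B) * (F (A @ u @ B) - F (A @ U (last A) (last u) @ B))\<^sup>2)"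
    unfolding T_def by (simp add: sum.cartesian_product)
  also have "\<dots> \<le> (\<Sum>t\<in>T. 2 / p\<^sup>2 * (wt (f1 t) * \<Delta> (f1 t)) + 2 / p\<^sup>2 * (wt (f2 t) * \<Delta> (f2 t)))"
  proof (rule sum_mono, clarify)
    fix A u B assume t: "(A, u, B) \<in> T"
    have len: "length A = j" "length u = k" "length B = r" using t by (auto simp: T_def)
    have take1: "take n (f1 (A, u, B)) = A @ u @ B" and take2: "take n (f2 (A, u, B)) = A @ U (last A) (last u) @ B"
      using len U(1) by (auto simp: f1_def f2_def n_def)
    have "mset (drop (2 * k) (f1 (A, u, B))) = mset (drop (2 * k) (f2 (A, u, B)))"
      using len j by (simp add: f1_def f2_def)
    hence z: "F (drop (2 * k) (f1 (A, u, B))) = F (drop (2 * k) (f2 (A, u, B)))" by (rule sym)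
    have "(F (A @ u @ B) - F (A @ U (last A) (last u) @ B))\<^sup>2 \<le> 2 * \<Delta> (f1 (A, u, B)) + 2 * \<Delta> (f2 (A, u, B))"
      using square_diff_le[of "F (A @ u @ B)" "F (A @ U (last A) (last u) @ B)" "F (drop (2 * k) (f1 (A, u, B)))"]
      unfolding \<Delta>_def take1 take2 z by (simp only: power2_commute)
    hence "wt (A @ u @ B) * (F (A @ u @ B) - F (A @ U (last A) (last u) @ B))\<^sup>2
        \<le> wt (A @ u @ B) * (2 * \<Delta> (f1 (A, u, B)) + 2 * \<Delta> (f2 (A, u, B)))"
      by (intro mult_left_mono) auto
    also have "\<dots> \<le> (wt (f1 (A, u, B)) / p\<^sup>2) * (2 * \<Delta> (f1 (A, u, B)) + 2 * \<Delta> (f2 (A, u, B)))"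
      using wt1[OF t] p by (intro mult_right_mono) (auto simp: field_simps \<Delta>_def)
    also have "\<dots> = 2 / p\<^sup>2 * (wt (f1 (A, u, B)) * \<Delta> (f1 (A, u, B)))
        + 2 / p\<^sup>2 * (wt (f2 (A, u, B)) * \<Delta> (f2 (A, u, B)))"
      unfolding wt2[OF t] by (simp add: add_divide_distrib algebra_simps)
    finally show "wt (A @ u @ B) * (F (A @ u @ B) - F (A @ U (last A) (last u) @ B))\<^sup>2
        \<le> 2 / p\<^sup>2 * (wt (f1 (A, u, B)) * \<Delta> (f1 (A, u, B)))
        + 2 / p\<^sup>2 * (wt (f2 (A, u, B)) * \<Delta> (f2 (A, u, B)))" .
  qed
  also have "\<dots> = 2 / p\<^sup>2 * (\<Sum>t\<in>T. wt (f1 t) * \<Delta> (f1 t)) + 2 / p\<^sup>2 * (\<Sum>t\<in>T. wt (f2 t) * \<Delta> (f2 t))"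
    by (simp add: sum.distrib sum_distrib_left)
  also have "\<dots> \<le> 2 / p\<^sup>2 * E + 2 / p\<^sup>2 * E"
    by (intro add_mono mult_left_mono bound inj1 inj2 img) auto
  also have "\<dots> = 4 / p\<^sup>2 * E" by simp
  also have "\<dots> \<le> 4 / p\<^sup>2 * (real ((2 * k)\<^sup>2) * step_energy n F)"
    by (intro mult_left_mono E) auto
  finally show ?thesis by (simp add: n_def)
qed

text \<open>One step of the recursion: the increment of the martingale over one block, in terms of the
increment over two blocks.\<close>

lemma mean_square_block:
  assumes sym: "\<And>v w. mset v = mset w \<Longrightarrow> F v = F w"
    and mix: "\<And>\<gamma> x y a c. ((\<Sum>z\<in>UNIV. kernel_power P m x z * \<gamma> z) - (\<Sum>z\<in>UNIV. kernel_power P m y z * \<gamma> z))\<^sup>2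
      \<le> \<epsilon> * (\<Sum>z\<in>UNIV. kernel_power P (2 * m) a z * (\<gamma> z - c)\<^sup>2)"
    and \<epsilon>: "0 \<le> \<epsilon>"
    and U: "\<And>x y. length (U x y) = 2 * m" "\<And>x y. last (x # U x y) = y" "\<And>x y. p \<le> pw x (U x y)"
    and p: "0 < p" and m: "1 \<le> m" and j: "4 * m \<le> j" and jn: "j + 2 * m \<le> n"
  shows "mean_square n F (j + m) - mean_square n F j
    \<le> (2 + 4 * \<epsilon>) * (4 / p\<^sup>2 * (real ((4 * m)\<^sup>2) * step_energy n F))
      + 4 * \<epsilon> * (mean_square n F (j + 2 * m) - mean_square n F j)"
proof -
  define r where "r = n - (j + 2 * m)"
  have n: "n = j + 2 * m + r" using jn by (simp add: r_def)
  define \<psi> where "\<psi> A u = cond_mean n F (j + 2 * m) (A @ u)" for A u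
  define \<gamma> where "\<gamma> A c = (\<Sum>B\<in>words r. pw c B * F (A @ U (last A) c @ B))" for A c
  have A: "A \<noteq> []" if "A \<in> words j" for A :: "'a list" using that j m by auto
  have u: "u \<noteq> []" if "u \<in> words (2 * m)" for u :: "'a list" using that m by auto
  have \<psi>0: "(\<Sum>u\<in>words (2 * m). pw (last A) u * \<psi> A u) = cond_mean n F j A" if "A \<in> words j" for A
    unfolding \<psi>_def using cond_mean_tower[OF A[OF that] jn] by simp
  have \<psi>1: "(\<Sum>v\<in>words m. pw (last (last A # u)) v * \<psi> A (u @ v)) = cond_mean n F (j + m) (A @ u)"
    if "A \<in> words j" for A u
  proof -
    have e: "last (A @ u) = last (last A # u)" "j + m + m = j + 2 * m" using A[OF that] by auto
    show ?thesis unfolding \<psi>_def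
      using cond_mean_tower[of "A @ u" "j + m" m n F] A[OF that] jn unfolding e by simp
  qed
  have D: "(\<Sum>u\<in>words (2 * m). pw (last A) u * (\<psi> A u - \<gamma> A (last (last A # u)))\<^sup>2)
      \<le> (\<Sum>u\<in>words (2 * m). pw (last A) u * (\<Sum>B\<in>words r. pw (last u) B *
          (F (A @ u @ B) - F (A @ U (last A) (last u) @ B))\<^sup>2))" for A
  proof (intro sum_mono mult_left_mono)
    fix u :: "'a list" assume u': "u \<in> words (2 * m)"
    have "\<psi> A u - \<gamma> A (last (last A # u))
        = (\<Sum>B\<in>words r. pw (last u) B * (F (A @ u @ B) - F (A @ U (last A) (last u) @ B)))"
      unfolding \<psi>_def \<gamma>_def cond_mean_def using u[OF u']
      by (simp add: r_def right_diff_distrib sum_subtractf)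
    thus "(\<psi> A u - \<gamma> A (last (last A # u)))\<^sup>2 \<le> (\<Sum>B\<in>words r. pw (last u) B *
          (F (A @ u @ B) - F (A @ U (last A) (last u) @ B))\<^sup>2)"
      using weighted_jensen[of "pw (last u)" "words r" "\<lambda>B. F (A @ u @ B) - F (A @ U (last A) (last u) @ B)"]
      by simp
  qed simp
  have "mean_square n F (j + m) - mean_square n F j
      = (\<Sum>A\<in>words j. wt A * (\<Sum>u\<in>words m. pw (last A) u * (cond_mean n F (j + m) (A @ u) - cond_mean n F j A)\<^sup>2))"
    by (rule mean_square_increment) (use j m jn in auto)
  also have "\<dots> \<le> (\<Sum>A\<in>words j. wt A *
      ((2 + 4 * \<epsilon>) * (\<Sum>u\<in>words (2 * m). pw (last A) u * (\<Sum>B\<in>words r. pw (last u) B *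
          (F (A @ u @ B) - F (A @ U (last A) (last u) @ B))\<^sup>2))
      + 4 * \<epsilon> * (\<Sum>u\<in>words (2 * m). pw (last A) u * (\<psi> A u - cond_mean n F j A)\<^sup>2)))"
  proof (intro sum_mono mult_left_mono)
    fix A :: "'a list" assume A': "A \<in> words j"
    have "(\<Sum>u\<in>words m. pw (last A) u * (cond_mean n F (j + m) (A @ u) - cond_mean n F j A)\<^sup>2)
        \<le> (2 + 4 * \<epsilon>) * (\<Sum>u\<in>words (2 * m). pw (last A) u * (\<psi> A u - \<gamma> A (last (last A # u)))\<^sup>2)
        + 4 * \<epsilon> * (\<Sum>u\<in>words (2 * m). pw (last A) u * (\<psi> A u - cond_mean n F j A)\<^sup>2)"
      using block_contraction[where a = "last A" and \<psi> = "\<psi> A" and \<gamma> = "\<gamma> A", OF mix \<epsilon>]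
      unfolding \<psi>0[OF A'] \<psi>1[OF A'] .
    moreover have "(2 + 4 * \<epsilon>) * (\<Sum>u\<in>words (2 * m). pw (last A) u * (\<psi> A u - \<gamma> A (last (last A # u)))\<^sup>2)
        \<le> (2 + 4 * \<epsilon>) * (\<Sum>u\<in>words (2 * m). pw (last A) u * (\<Sum>B\<in>words r. pw (last u) B *
          (F (A @ u @ B) - F (A @ U (last A) (last u) @ B))\<^sup>2))"
      using \<epsilon> by (intro mult_left_mono D) auto
    ultimately show "(\<Sum>u\<in>words m. pw (last A) u * (cond_mean n F (j + m) (A @ u) - cond_mean n F j A)\<^sup>2)
        \<le> (2 + 4 * \<epsilon>) * (\<Sum>u\<in>words (2 * m). pw (last A) u * (\<Sum>B\<in>words r. pw (last u) B *
          (F (A @ u @ B) - F (A @ U (last A) (last u) @ B))\<^sup>2))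
      + 4 * \<epsilon> * (\<Sum>u\<in>words (2 * m). pw (last A) u * (\<psi> A u - cond_mean n F j A)\<^sup>2)" by linarith
  qed simp
  also have "\<dots> = (2 + 4 * \<epsilon>) * (\<Sum>A\<in>words j. wt A * (\<Sum>u\<in>words (2 * m). pw (last A) u *
        (\<Sum>B\<in>words r. pw (last u) B * (F (A @ u @ B) - F (A @ U (last A) (last u) @ B))\<^sup>2)))
      + 4 * \<epsilon> * (\<Sum>A\<in>words j. wt A * (\<Sum>u\<in>words (2 * m). pw (last A) u * (\<psi> A u - cond_mean n F j A)\<^sup>2))"
    by (rule weighted_sum_linear)
  also have "(\<Sum>A\<in>words j. wt A * (\<Sum>u\<in>words (2 * m). pw (last A) u * (\<psi> A u - cond_mean n F j A)\<^sup>2))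
      = mean_square n F (j + 2 * m) - mean_square n F j"
    unfolding \<psi>_def by (rule mean_square_increment[symmetric]) (use j m jn in auto)
  also have "(\<Sum>A\<in>words j. wt A * (\<Sum>u\<in>words (2 * m). pw (last A) u *
        (\<Sum>B\<in>words r. pw (last u) B * (F (A @ u @ B) - F (A @ U (last A) (last u) @ B))\<^sup>2)))
      = (\<Sum>A\<in>words j. \<Sum>u\<in>words (2 * m). \<Sum>B\<in>words r. wt (A @ u @ B) *
        (F (A @ u @ B) - F (A @ U (last A) (last u) @ B))\<^sup>2)"
    unfolding sum_distrib_left
    by (intro sum.cong refl) (use A u in \<open>auto simp: word_weight_append path_weight_append\<close>)
  finally have "mean_square n F (j + m) - mean_square n F j
    \<le> (2 + 4 * \<epsilon>) * (\<Sum>A\<in>words j. \<Sum>u\<in>words (2 * m). \<Sum>B\<in>words r. wt (A @ u @ B) *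
        (F (A @ u @ B) - F (A @ U (last A) (last u) @ B))\<^sup>2)
      + 4 * \<epsilon> * (mean_square n F (j + 2 * m) - mean_square n F j)" .
  moreover have "(2 + 4 * \<epsilon>) * (\<Sum>A\<in>words j. \<Sum>u\<in>words (2 * m). \<Sum>B\<in>words r. wt (A @ u @ B) *
        (F (A @ u @ B) - F (A @ U (last A) (last u) @ B))\<^sup>2)
      \<le> (2 + 4 * \<epsilon>) * (4 / p\<^sup>2 * (real ((4 * m)\<^sup>2) * step_energy n F))"
    using segment_swap_energy[OF sym U p, where j = j and r = r] j m n \<epsilon>
    by (intro mult_left_mono) auto
  ultimately show ?thesis by linarith
qed

end

context stationary_kernel
begin

text \<open>At the beginning of the window, shifting the whole window beyond the first \<open>j + m\<close> letters makes
  the conditional mean given the first \<open>j\<close> letters almost constant.\<close>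

lemma mean_square_start:
  fixes F :: "'a list \<Rightarrow> real" and n :: nat
  assumes mix: "\<And>\<gamma> x y c. ((\<Sum>z\<in>UNIV. kernel_power P m x z * \<gamma> z) - (\<Sum>z\<in>UNIV. kernel_power P m y z * \<gamma> z))\<^sup>2
      \<le> \<epsilon> * (\<Sum>z\<in>UNIV. \<pi> z * (\<gamma> z - c)\<^sup>2)"
    and \<epsilon>: "0 \<le> \<epsilon>" and j: "1 \<le> j" "j \<le> n"
  defines "\<mu> \<equiv> word_expectation n F"
  shows "mean_square n F j - \<mu>\<^sup>2
    \<le> 2 * (real ((j + m)\<^sup>2) * step_energy n F) + 2 * \<epsilon> * (mean_square n F n - \<mu>\<^sup>2)"
proof -
  define T where "T = j + m"
  define \<kappa> where "\<kappa> x = (\<Sum>w\<in>words n. pw x w * F w)" for x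
  define \<rho> where "\<rho> x = (\<Sum>z\<in>UNIV. kernel_power P m x z * \<kappa> z)" for x
  have ne: "A \<noteq> []" if "A \<in> words j" for A :: "'a list" using that j by auto
  have \<mu>\<kappa>: "\<mu> = (\<Sum>x\<in>UNIV. \<pi> x * \<kappa> x)"
  proof -
    have "(\<Sum>x\<in>UNIV. \<pi> x * \<kappa> x) = (\<Sum>w\<in>words n. \<Sum>x\<in>UNIV. \<pi> x * pw x w * F w)"
      unfolding \<kappa>_def sum_distrib_left by (subst sum.swap) (simp add: mult.assoc)
    thus ?thesis by (simp add: \<mu>_def word_expectation_def sum_distrib_right[symmetric] sum_pi_path_weight)
  qed
  hence \<mu>\<rho>: "\<mu> = (\<Sum>x\<in>UNIV. \<pi> x * \<rho> x)" unfolding \<rho>_def sum_pi_kernel_power .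
  have \<mu>c: "\<mu> = (\<Sum>A\<in>words j. wt A * cond_mean n F j A)"
  proof -
    have "\<mu> = (\<Sum>A\<in>words j. \<Sum>B\<in>words (n - j). wt (A @ B) * F (A @ B))"
      unfolding \<mu>_def word_expectation_def using sum_words_add[of "\<lambda>w. wt w * F w" j "n - j"] j by simp
    also have "\<dots> = (\<Sum>A\<in>words j. wt A * cond_mean n F j A)"
      unfolding cond_mean_def sum_distrib_left
      by (intro sum.cong refl) (use ne in \<open>auto simp: word_weight_append\<close>)
    finally show ?thesis .
  qed
  have var: "mean_square n F j - \<mu>\<^sup>2 = (\<Sum>A\<in>words j. wt A * (cond_mean n F j A - \<mu>)\<^sup>2)"
    unfolding \<mu>c mean_square_def by (rule weighted_variance[symmetric]) simp
  have shift: "(\<Sum>A\<in>words j. wt A * (cond_mean n F j A - \<rho> (last A))\<^sup>2) \<le> real (T\<^sup>2) * step_energy n F"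
  proof -
    have eq: "cond_mean n F j A - \<rho> (last A)
        = (\<Sum>C\<in>words (n + m). pw (last A) C * (F (take n (A @ C)) - F (drop T (A @ C))))"
      if A: "A \<in> words j" for A
    proof -
      have "n + m = (n - j) + T" using j by (simp add: T_def)
      hence "(\<Sum>C\<in>words (n + m). pw (last A) C * F (take n (A @ C)))
          = (\<Sum>C\<in>words (n - j). \<Sum>D\<in>words T. pw (last A) C * pw (last (last A # C)) D * F (take n (A @ C @ D)))"
        by (simp only: sum_words_add path_weight_append)
      also have "\<dots> = (\<Sum>C\<in>words (n - j). \<Sum>D\<in>words T. pw (last A) C * F (A @ C) * pw (last (last A # C)) D)"
        using A j by (intro sum.cong refl) auto
      also have "\<dots> = cond_mean n F j A"
        unfolding cond_mean_def by (simp only: sum_distrib_left[symmetric] path_weight_sum mult_1_right)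
      finally have 1: "(\<Sum>C\<in>words (n + m). pw (last A) C * F (take n (A @ C))) = cond_mean n F j A" .
      have "(\<Sum>C\<in>words (n + m). pw (last A) C * F (drop T (A @ C)))
          = (\<Sum>C\<in>words m. \<Sum>D\<in>words n. pw (last A) C * pw (last (last A # C)) D * F (drop T (A @ C @ D)))"
        by (simp only: add.commute[of n m] sum_words_add path_weight_append append.assoc)
      also have "\<dots> = (\<Sum>C\<in>words m. pw (last A) C * \<kappa> (last (last A # C)))"
        unfolding \<kappa>_def sum_distrib_left using A by (intro sum.cong refl) (auto simp: T_def)
      also have "\<dots> = \<rho> (last A)" unfolding \<rho>_def by (rule path_weight_sum_last)
      finally have 2: "(\<Sum>C\<in>words (n + m). pw (last A) C * F (drop T (A @ C))) = \<rho> (last A)" .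
      show ?thesis unfolding right_diff_distrib sum_subtractf 1 2 ..
    qed
    have "(\<Sum>A\<in>words j. wt A * (cond_mean n F j A - \<rho> (last A))\<^sup>2)
        \<le> (\<Sum>A\<in>words j. wt A * (\<Sum>C\<in>words (n + m). pw (last A) C * (F (take n (A @ C)) - F (drop T (A @ C)))\<^sup>2))"
      by (intro sum_mono mult_left_mono) (simp_all only: eq weighted_jensen path_weight_sum path_weight_nonneg word_weight_nonneg)
    also have "\<dots> = (\<Sum>A\<in>words j. \<Sum>C\<in>words (n + m). wt (A @ C) * (F (drop T (A @ C)) - F (take n (A @ C)))\<^sup>2)"
      unfolding sum_distrib_left using ne
      by (intro sum.cong refl) (simp add: word_weight_append power2_commute)
    also have "\<dots> = word_expectation (j + (n + m)) (\<lambda>w. (F (drop T w) - F (take n w))\<^sup>2)"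
      unfolding word_expectation_def sum_words_add[of _ j "n + m"] ..
    also have "j + (n + m) = n + T" by (simp add: T_def)
    also have "word_expectation (n + T) (\<lambda>w. (F (drop T w) - F (take n w))\<^sup>2) \<le> real (T\<^sup>2) * step_energy n F"
      by (rule shift_energy)
    finally show ?thesis .
  qed
  have V: "(\<Sum>z\<in>UNIV. \<pi> z * (\<kappa> z - \<mu>)\<^sup>2) \<le> mean_square n F n - \<mu>\<^sup>2"
  proof -
    have "(\<Sum>z\<in>UNIV. \<pi> z * (\<kappa> z - \<mu>)\<^sup>2) = (\<Sum>z\<in>UNIV. \<pi> z * (\<kappa> z)\<^sup>2) - \<mu>\<^sup>2"
      unfolding \<mu>\<kappa> by (rule weighted_variance) simp
    also have "(\<Sum>z\<in>UNIV. \<pi> z * (\<kappa> z)\<^sup>2) \<le> (\<Sum>z\<in>UNIV. \<pi> z * (\<Sum>w\<in>words n. pw z w * (F w)\<^sup>2))"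
      unfolding \<kappa>_def by (intro sum_mono mult_left_mono weighted_jensen) auto
    also have "\<dots> = (\<Sum>w\<in>words n. \<Sum>z\<in>UNIV. \<pi> z * pw z w * (F w)\<^sup>2)"
      unfolding sum_distrib_left by (subst sum.swap) (simp add: mult.assoc)
    also have "\<dots> = mean_square n F n"
      by (simp add: mean_square_full word_expectation_def sum_distrib_right[symmetric] sum_pi_path_weight)
    finally show ?thesis by simp
  qed
  have far: "(\<rho> x - \<mu>)\<^sup>2 \<le> \<epsilon> * (mean_square n F n - \<mu>\<^sup>2)" for x
  proof -
    have "\<rho> x - \<mu> = (\<Sum>y\<in>UNIV. \<pi> y * (\<rho> x - \<rho> y))"
      unfolding \<mu>\<rho> by (simp add: right_diff_distrib sum_subtractf sum_distrib_right[symmetric])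
    hence "(\<rho> x - \<mu>)\<^sup>2 \<le> (\<Sum>y\<in>UNIV. \<pi> y * (\<rho> x - \<rho> y)\<^sup>2)"
      using weighted_jensen[of \<pi> UNIV "\<lambda>y. \<rho> x - \<rho> y"] by simp
    also have "\<dots> \<le> (\<Sum>y\<in>UNIV. \<pi> y * (\<epsilon> * (\<Sum>z\<in>UNIV. \<pi> z * (\<kappa> z - \<mu>)\<^sup>2)))"
      unfolding \<rho>_def by (intro sum_mono mult_left_mono mix) auto
    also have "\<dots> = \<epsilon> * (\<Sum>z\<in>UNIV. \<pi> z * (\<kappa> z - \<mu>)\<^sup>2)"
      by (simp add: sum_distrib_right[symmetric])
    also have "\<dots> \<le> \<epsilon> * (mean_square n F n - \<mu>\<^sup>2)" by (intro mult_left_mono V \<epsilon>)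
    finally show ?thesis .
  qed
  have "mean_square n F j - \<mu>\<^sup>2
      \<le> (\<Sum>A\<in>words j. wt A * (2 * (cond_mean n F j A - \<rho> (last A))\<^sup>2 + 2 * (\<epsilon> * (mean_square n F n - \<mu>\<^sup>2))))"
    unfolding var
  proof (intro sum_mono mult_left_mono)
    fix A :: "'a list"
    show "(cond_mean n F j A - \<mu>)\<^sup>2
        \<le> 2 * (cond_mean n F j A - \<rho> (last A))\<^sup>2 + 2 * (\<epsilon> * (mean_square n F n - \<mu>\<^sup>2))"
      using square_diff_le[of "cond_mean n F j A" \<mu> "\<rho> (last A)"] far[of "last A"] by linarith
  qed simp
  also have "\<dots> = 2 * (\<Sum>A\<in>words j. wt A * (cond_mean n F j A - \<rho> (last A))\<^sup>2)
      + 2 * (\<epsilon> * (mean_square n F n - \<mu>\<^sup>2))"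
    using weighted_sum_linear[of wt 2 "\<lambda>A. (cond_mean n F j A - \<rho> (last A))\<^sup>2" "2 * (\<epsilon> * (mean_square n F n - \<mu>\<^sup>2))" "\<lambda>_. 1" "words j"]
    by simp
  finally show ?thesis using shift by (simp add: T_def)
qed

end

section \<open>The Poincare inequality for the window\<close>

text \<open>The recursion produced by the block estimates: the term with factor one eighth spans two
  blocks and is absorbed after summation over all blocks.\<close>

lemma absorbed_telescoping:
  fixes b :: "nat \<Rightarrow> real"
  assumes step: "\<And>i. b i - b (Suc i) \<le> K + (1 / 8) * (b i - b (Suc (Suc i)))"
    and nonneg: "\<And>i. 0 \<le> b i" and mono: "\<And>i. b (Suc i) \<le> b i" and zero: "b N = 0"
  shows "b 0 \<le> 4 / 3 * (real N * K)"
proof -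
  have "(\<Sum>i<N. b i - b (Suc i)) \<le> (\<Sum>i<N. K + (1 / 8) * (b i - b (Suc (Suc i))))"
    by (rule sum_mono) (rule step)
  moreover have "(\<Sum>i<N. b i - b (Suc i)) = b 0 - b N"
    by (induction N) simp_all
  moreover have "(\<Sum>i<N. b i - b (Suc (Suc i))) = b 0 + b 1 - b N - b (Suc N)"
    by (induction N) simp_all
  moreover have "(\<Sum>i<N. K + (1 / 8) * (b i - b (Suc (Suc i))))
      = real N * K + (1 / 8) * (\<Sum>i<N. b i - b (Suc (Suc i)))"
    by (simp only: sum.distrib sum_constant card_lessThan sum_distrib_left[symmetric])
  ultimately have "b 0 \<le> real N * K + (1 / 8) * (b 0 + b 1 - b (Suc N))"
    by (simp only: zero diff_0_right)
  thus ?thesis using nonneg[of "Suc N"] mono[of 0] unfolding One_nat_def by argo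
qed

context ergodic_kernel
begin

text \<open>The Poincare inequality for permutation-invariant functions of a window of length \<open>n\<close>, with a
constant of order \<open>n\<close>.\<close>

theorem window_poincare:
  "\<exists>C>0. \<forall>n F. 1 \<le> n \<longrightarrow> (\<forall>v w. mset v = mset w \<longrightarrow> F v = F w) \<longrightarrow>
    word_expectation n (\<lambda>w. (F w)\<^sup>2) - (word_expectation n F)\<^sup>2 \<le> C * real n * step_energy n F"
proof -
  \<comment> \<open>The factor \<open>4 * \<epsilon>\<close> in \<open>mean_square_block\<close> becomes \<open>1 / 8\<close>, as in \<open>absorbed_telescoping\<close>.\<close>
  define \<epsilon> :: real where "\<epsilon> = 1 / 32"
  have \<epsilon>: "0 < \<epsilon>" "0 \<le> \<epsilon>" by (auto simp: \<epsilon>_def)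
  obtain m where m: "m \<ge> 1" and pos: "\<And>k x y. k \<ge> m \<Longrightarrow> 0 < kernel_power P k x y"
    and mix: "\<And>\<phi> x y a c. ((\<Sum>z\<in>UNIV. kernel_power P m x z * \<phi> z) - (\<Sum>z\<in>UNIV. kernel_power P m y z * \<phi> z))\<^sup>2
      \<le> \<epsilon> * (\<Sum>z\<in>UNIV. kernel_power P (2 * m) a z * (\<phi> z - c)\<^sup>2)"
    and mix\<pi>: "\<And>\<phi> x y c. ((\<Sum>z\<in>UNIV. kernel_power P m x z * \<phi> z) - (\<Sum>z\<in>UNIV. kernel_power P m y z * \<phi> z))\<^sup>2
      \<le> \<epsilon> * (\<Sum>z\<in>UNIV. \<pi> z * (\<phi> z - c)\<^sup>2)"
    using mixing[OF \<epsilon>(1)] by blast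
  have "2 * m \<ge> m" by simp
  obtain U and p :: real where p: "0 < p" and U: "\<And>x y. length (U x y) = 2 * m"
    "\<And>x y. last (x # U x y) = y" "\<And>x y. p \<le> pw x (U x y)"
    by (rule connecting_words[OF pos[OF \<open>2 * m \<ge> m\<close>]]) (rule that)
  define K where "K = 3 * (4 / p\<^sup>2 * real ((4 * m)\<^sup>2)) + real ((2 * m)\<^sup>2)"
  have K0: "0 \<le> K" unfolding K_def by simp
  define C where "C = 4 * K + 2 * (2 * real ((5 * m)\<^sup>2))"
  have m2: "real ((5 * m)\<^sup>2) > 0" using m by simp
  have main: "word_expectation n (\<lambda>w. (F w)\<^sup>2) - (word_expectation n F)\<^sup>2 \<le> C * real n * step_energy n F"
    if n: "1 \<le> n" and sym: "\<And>v w. mset v = mset w \<Longrightarrow> F v = F w" for n and F :: "'a list \<Rightarrow> real"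
  proof -
    define E where "E = step_energy n F"
    have E0: "0 \<le> E" unfolding E_def by (rule step_energy_nonneg)
    define S where "S = mean_square n F"
    define V where "V = S n - (word_expectation n F)\<^sup>2"
    have V0: "0 \<le> V" unfolding V_def S_def mean_square_full
      using weighted_jensen[of wt "words n" F] by (simp add: word_expectation_def)
    \<comment> \<open>The block boundaries; a first stretch of length \<open>4 * m\<close> is required by \<open>mean_square_block\<close>.\<close>
    define t where "t i = min (4 * m + i * m) n" for i
    define b where "b i = S n - S (t i)" for i
    have t1: "1 \<le> t i" "t i \<le> n" for i using m n by (auto simp: t_def)
    have t_mono: "t i \<le> t (Suc i)" for i unfolding t_def by auto
    have "b 0 \<le> 4 / 3 * (real n * (K * E))"
    proof (rule absorbed_telescoping)
      show "0 \<le> b i" for i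
        unfolding b_def S_def using mean_square_mono[OF t1(1) t1(2) order_refl] by simp
      show "b (Suc i) \<le> b i" for i
        unfolding b_def S_def using mean_square_mono[OF t1(1) t_mono t1(2)] by simp
      have "n \<le> n * m" using m by simp
      hence "t n = n" unfolding t_def by linarith
      thus "b n = 0" by (simp add: b_def)
      fix i
      show "b i - b (Suc i) \<le> K * E + (1 / 8) * (b i - b (Suc (Suc i)))"
      proof (cases "4 * m + i * m + 2 * m \<le> n")
        case True
        define j where "j = 4 * m + i * m"
        have t: "t i = j" "t (Suc i) = j + m" "t (Suc (Suc i)) = j + 2 * m"
          using True by (auto simp: t_def j_def)
        have "S (j + m) - S j \<le> (2 + 4 * \<epsilon>) * (4 / p\<^sup>2 * (real ((4 * m)\<^sup>2) * E)) + 4 * \<epsilon> * (S (j + 2 * m) - S j)"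
          unfolding S_def E_def
          by (rule mean_square_block[OF sym mix \<epsilon>(2) U p m]) (use True in \<open>auto simp: j_def\<close>)
        also have "(2 + 4 * \<epsilon>) * (4 / p\<^sup>2 * (real ((4 * m)\<^sup>2) * E)) \<le> K * E"
        proof -
          have "(2 + 4 * \<epsilon>) * (4 / p\<^sup>2 * real ((4 * m)\<^sup>2)) \<le> K"
            unfolding K_def \<epsilon>_def by (intro add_increasing2 mult_right_mono) auto
          from mult_right_mono[OF this E0] show ?thesis by (simp only: mult.assoc)
        qed
        finally show ?thesis unfolding b_def t by (simp add: \<epsilon>_def)
      next
        case False
        \<comment> \<open>Fewer than two full blocks are left, so all the remaining variance is small.\<close>
        have bi: "b i \<le> K * E"
        proof -
          have "n - t i \<le> 2 * m" using False by (auto simp: t_def)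
          hence "(n - t i)\<^sup>2 \<le> (2 * m)\<^sup>2" by (rule power_mono) simp
          hence "real ((n - t i)\<^sup>2) \<le> real ((2 * m)\<^sup>2)" by (rule of_nat_mono)
          hence "real ((n - t i)\<^sup>2) * E \<le> K * E"
            unfolding K_def by (intro mult_right_mono E0 add_increasing) auto
          thus ?thesis unfolding b_def S_def using mean_square_end[OF t1(1)[of i] t1(2)[of i], of F]
            unfolding E_def by linarith
        qed
        have "0 \<le> b (Suc i)" "b (Suc (Suc i)) \<le> b i"
          unfolding b_def S_def using mean_square_mono[OF t1(1) t1(2) order_refl]
            mean_square_mono[OF t1(1) order_trans[OF t_mono t_mono] t1(2)] by auto
        thus ?thesis using bi by argo
      qed
    qed
    moreover have "S (t 0) - (word_expectation n F)\<^sup>2 \<le> 2 * (real ((5 * m)\<^sup>2) * E) + 1 / 16 * V"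
    proof -
      have "S (t 0) - (word_expectation n F)\<^sup>2 \<le> 2 * (real ((t 0 + m)\<^sup>2) * E) + 2 * \<epsilon> * V"
        unfolding S_def V_def E_def by (rule mean_square_start[OF mix\<pi> \<epsilon>(2) t1])
      moreover have "real ((t 0 + m)\<^sup>2) * E \<le> real ((5 * m)\<^sup>2) * E"
      proof (intro mult_right_mono E0 of_nat_mono power_mono)
        show "t 0 + m \<le> 5 * m" by (simp add: t_def)
      qed simp
      ultimately show ?thesis by (simp add: \<epsilon>_def)
    qed
    ultimately have "V \<le> 4 / 3 * (real n * (K * E)) + 2 * (real ((5 * m)\<^sup>2) * E) + 1 / 16 * V"
      unfolding V_def b_def by simp
    moreover have X0: "0 \<le> real n * (K * E)" using K0 E0 by simp
    moreover have Y0: "0 \<le> real ((5 * m)\<^sup>2) * E" using E0 by simp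
    ultimately have "V \<le> 2 * (real n * (K * E)) + 2 * (2 * (real ((5 * m)\<^sup>2) * E))"
      by linarith
    also have "\<dots> \<le> 4 * (real n * (K * E)) + 2 * (2 * (real n * (real ((5 * m)\<^sup>2) * E)))"
    proof -
      have "1 * (real ((5 * m)\<^sup>2) * E) \<le> real n * (real ((5 * m)\<^sup>2) * E)"
        using n E0 by (intro mult_right_mono mult_nonneg_nonneg) auto
      moreover have "0 \<le> real n * (K * E)" using K0 E0 by simp
      ultimately show ?thesis by linarith
    qed
    also have "\<dots> = C * real n * E" by (simp add: C_def algebra_simps)
    finally show ?thesis unfolding V_def S_def mean_square_full E_def .
  qed
  have "0 < C" unfolding C_def using m2 K0 by linarith
  thus ?thesis using main by blast
qed

end

section \<open>Diagonalisation of symmetric real matrices\<close>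

text \<open>The symbol \<open>\<bullet>\<close> denotes the scalar product of vectors of variable dimension below.\<close>

unbundle no inner_syntax

lemma mult_mat_vec_index:
  assumes "A \<in> carrier_mat n n" "v \<in> carrier_vec n" "i < n"
  shows "(A *\<^sub>v v) $ i = (\<Sum>j<n. A $$ (i, j) * v $ j)"
  using assms by (auto simp: scalar_prod_def atLeast0LessThan intro!: sum.cong)

text \<open>A complex eigenvalue exists; by symmetry it is real, so the real or the imaginary part of its
  eigenvector is a real eigenvector.\<close>

lemma symmetric_mat_eigenvector:
  fixes A :: "real Matrix.mat"
  assumes A: "A \<in> carrier_mat n n" and sym: "transpose_mat A = A" and n: "n \<noteq> 0"
  obtains v e where "v \<in> carrier_vec n" "v \<bullet> v = 1" "A *\<^sub>v v = e \<cdot>\<^sub>v v"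
proof -
  define B where "B = map_mat complex_of_real A"
  have B: "B \<in> carrier_mat n n" using A by (simp add: B_def)
  obtain as where as: "char_poly B = (\<Prod>a\<leftarrow>as. [:- a, 1:])" "length as = n"
    using char_poly_factorized[OF B] by blast
  then obtain z where "z \<in> set as" using n by (cases as) auto
  hence "poly (char_poly B) z = 0" unfolding as(1) by (auto simp: poly_prod_list prod_list_zero_iff)
  hence "eigenvalue B z" using eigenvalue_root_char_poly[OF B] by simp
  then obtain w where w: "w \<in> carrier_vec n" "w \<noteq> 0\<^sub>v n" "B *\<^sub>v w = z \<cdot>\<^sub>v w"
    using B unfolding eigenvalue_def eigenvector_def by auto
  define x where "x = vec n (\<lambda>i. Re (w $ i))"
  define y where "y = vec n (\<lambda>i. Im (w $ i))"
  have xy: "x \<in> carrier_vec n" "y \<in> carrier_vec n" by (auto simp: x_def y_def)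
  have ev: "(\<Sum>j<n. complex_of_real (A $$ (i, j)) * w $ j) = z * w $ i" if "i < n" for i
  proof -
    have "(B *\<^sub>v w) $ i = z * w $ i" using that w by simp
    moreover have "(B *\<^sub>v w) $ i = (\<Sum>j<n. complex_of_real (A $$ (i, j)) * w $ j)"
      unfolding mult_mat_vec_index[OF B w(1) that] using A that by (intro sum.cong) (auto simp: B_def)
    ultimately show ?thesis by simp
  qed
  have Ax: "A *\<^sub>v x = Re z \<cdot>\<^sub>v x - Im z \<cdot>\<^sub>v y"
  proof (rule eq_vecI)
    fix i assume "i < dim_vec (Re z \<cdot>\<^sub>v x - Im z \<cdot>\<^sub>v y)"
    hence i: "i < n" by (simp add: y_def)
    have "(A *\<^sub>v x) $ i = (\<Sum>j<n. A $$ (i, j) * Re (w $ j))"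
      unfolding mult_mat_vec_index[OF A xy(1) i] by (simp add: x_def)
    also have "\<dots> = Re (z * w $ i)" unfolding ev[OF i, symmetric] by simp
    finally show "(A *\<^sub>v x) $ i = (Re z \<cdot>\<^sub>v x - Im z \<cdot>\<^sub>v y) $ i" using i by (simp add: x_def y_def)
  qed (use A in \<open>simp add: y_def\<close>)
  have Ay: "A *\<^sub>v y = Re z \<cdot>\<^sub>v y + Im z \<cdot>\<^sub>v x"
  proof (rule eq_vecI)
    fix i assume "i < dim_vec (Re z \<cdot>\<^sub>v y + Im z \<cdot>\<^sub>v x)"
    hence i: "i < n" by (simp add: x_def)
    have "(A *\<^sub>v y) $ i = (\<Sum>j<n. A $$ (i, j) * Im (w $ j))"
      unfolding mult_mat_vec_index[OF A xy(2) i] by (simp add: y_def)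
    also have "\<dots> = Im (z * w $ i)" unfolding ev[OF i, symmetric] by simp
    finally show "(A *\<^sub>v y) $ i = (Re z \<cdot>\<^sub>v y + Im z \<cdot>\<^sub>v x) $ i" using i by (simp add: x_def y_def)
  qed (use A in \<open>simp add: x_def\<close>)
  have "(A *\<^sub>v x) \<bullet> y = x \<bullet> (A *\<^sub>v y)"
    using transpose_vec_mult_scalar[OF A xy(2) xy(1)] sym by simp
  hence "Re z * (x \<bullet> y) - Im z * (y \<bullet> y) = Re z * (x \<bullet> y) + Im z * (x \<bullet> x)"
    unfolding Ax Ay using xy
    by (simp add: minus_scalar_prod_distrib[of _ n] scalar_prod_add_distrib[of _ n])
  hence "Im z * (x \<bullet> x + y \<bullet> y) = 0" by (simp add: algebra_simps)
  moreover have sq: "u \<bullet> u > 0" if "u \<in> carrier_vec n" "u \<noteq> 0\<^sub>v n" for u :: "real Matrix.vec"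
  proof -
    have "\<not> (\<forall>i<n. u $ i = 0)" using that eq_vecI[of u "0\<^sub>v n"] by auto
    then obtain i where i: "i < n" "u $ i \<noteq> 0" by blast
    have "0 < (\<Sum>i\<in>{0..<n}. u $ i * u $ i)"
      by (rule sum_pos2[where i = i]) (use i in \<open>auto simp: zero_less_mult_iff\<close>)
    thus ?thesis using that by (simp add: scalar_prod_def)
  qed
  moreover have nz: "x \<noteq> 0\<^sub>v n \<or> y \<noteq> 0\<^sub>v n"
  proof (rule ccontr)
    assume "\<not> ?thesis"
    hence 0: "x = 0\<^sub>v n" "y = 0\<^sub>v n" by auto
    have "w = 0\<^sub>v n"
    proof (rule eq_vecI)
      fix i assume "i < dim_vec (0\<^sub>v n :: complex Matrix.vec)"
      hence i: "i < n" by simp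
      have "Re (w $ i) = 0" "Im (w $ i) = 0"
        using i arg_cong[OF 0(1), of "\<lambda>v. v $ i"] arg_cong[OF 0(2), of "\<lambda>v. v $ i"]
        by (auto simp: x_def y_def)
      thus "w $ i = 0\<^sub>v n $ i" using i by (simp add: complex_eq_iff)
    qed (use w in simp)
    thus False using w by simp
  qed
  moreover have "0 \<le> x \<bullet> x" "0 \<le> y \<bullet> y" by (auto simp: scalar_prod_def intro!: sum_nonneg)
  ultimately have "Im z = 0" using sq[OF xy(1)] sq[OF xy(2)]
    by (metis add_nonneg_pos add_pos_nonneg less_irrefl mult_eq_0_iff)
  hence ev2: "A *\<^sub>v x = Re z \<cdot>\<^sub>v x" "A *\<^sub>v y = Re z \<cdot>\<^sub>v y"
    unfolding Ax Ay using xy by (auto intro!: eq_vecI)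
  then obtain u where u: "u \<in> carrier_vec n" "u \<noteq> 0\<^sub>v n" "A *\<^sub>v u = Re z \<cdot>\<^sub>v u"
    using nz xy by blast
  define c where "c = 1 / sqrt (u \<bullet> u)"
  show ?thesis
  proof (rule that[of "c \<cdot>\<^sub>v u" "Re z"])
    show "c \<cdot>\<^sub>v u \<in> carrier_vec n" using u by simp
    have "c * c * (u \<bullet> u) = 1" using sq[OF u(1,2)] by (simp add: c_def)
    thus "(c \<cdot>\<^sub>v u) \<bullet> (c \<cdot>\<^sub>v u) = 1" using u by (simp add: mult.assoc)
    show "A *\<^sub>v (c \<cdot>\<^sub>v u) = Re z \<cdot>\<^sub>v (c \<cdot>\<^sub>v u)"
      using u A by (simp add: mult_mat_vec smult_smult_assoc mult.commute)
  qed
qed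

text \<open>The Householder reflection that maps the first unit vector to a given unit vector.\<close>

lemma householder_reflection:
  fixes u :: "real Matrix.vec"
  assumes u: "u \<in> carrier_vec n" "u \<bullet> u = 1" and n: "n \<noteq> 0"
  obtains H where "H \<in> carrier_mat n n" "transpose_mat H = H" "H * H = 1\<^sub>m n" "col H 0 = u"
proof -
  define w where "w i = u $ i - (if i = 0 then 1 else 0)" for i
  define s where "s = (\<Sum>i<n. w i * w i)"
  \<comment> \<open>If \<open>s = 0\<close>, then \<open>u\<close> is the first unit vector and \<open>H\<close> is the identity.\<close>
  define c where "c = (if s = 0 then 0 else 2 / s)"
  define H where "H = mat n n (\<lambda>(i, j). (if i = j then 1 else 0) - c * w i * w j)"
  have H: "H \<in> carrier_mat n n" by (simp add: H_def)
  have uu: "(\<Sum>i<n. u $ i * u $ i) = 1" using u by (simp add: scalar_prod_def atLeast0LessThan)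
  have s: "s = 2 - 2 * u $ 0"
  proof -
    have "s = (\<Sum>i<n. u $ i * u $ i - 2 * (if i = 0 then u $ i else 0) + (if i = 0 then 1 else 0))"
      unfolding s_def w_def by (rule sum.cong) (auto simp: algebra_simps)
    also have "\<dots> = 1 - 2 * u $ 0 + 1"
      using n by (simp add: sum.distrib sum_subtractf sum_distrib_left[symmetric] uu)
    finally show ?thesis by simp
  qed
  have ccs: "c * (c * s) = 2 * c" by (simp add: c_def)
  have HH: "H * H = 1\<^sub>m n"
  proof (rule eq_matI)
    fix i j assume "i < dim_row (1\<^sub>m n :: real Matrix.mat)" "j < dim_col (1\<^sub>m n :: real Matrix.mat)"
    hence ij: "i < n" "j < n" by auto
    have "(H * H) $$ (i, j) = (\<Sum>k<n. ((if i = k then 1 else 0) - c * w i * w k) * ((if k = j then 1 else 0) - c * w k * w j))"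
      using ij by (simp add: H_def scalar_prod_def atLeast0LessThan)
    also have "\<dots> = (\<Sum>k<n. (if k = i then (if i = j then 1 else 0) - c * w i * w j else 0)
        - (if k = j then c * w i * w j else 0) + c * c * w i * w j * (w k * w k))"
      by (rule sum.cong) (auto simp: algebra_simps)
    also have "\<dots> = (if i = j then 1 else 0) - 2 * c * w i * w j + c * (c * s) * w i * w j"
      using ij by (simp add: sum.distrib sum_subtractf sum_distrib_left[symmetric] s_def)
    also have "\<dots> = 1\<^sub>m n $$ (i, j)" using ij by (simp add: ccs)
    finally show "(H * H) $$ (i, j) = 1\<^sub>m n $$ (i, j)" .
  qed (auto simp: H_def)
  have col: "col H 0 = u"
  proof (rule eq_vecI)
    fix i assume "i < dim_vec u"
    hence i: "i < n" using u by simp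
    have w0: "w 0 = - s / 2" by (simp add: w_def s)
    have "c * w i * w 0 = - w i"
    proof (cases "s = 0")
      case True
      have "w i * w i \<le> s" unfolding s_def by (rule member_le_sum) (use i in auto)
      hence "w i = 0" using True by (metis antisym mult_eq_0_iff zero_le_square)
      thus ?thesis by simp
    next
      case False thus ?thesis by (simp add: c_def w0)
    qed
    thus "col H 0 $ i = u $ i" using i n by (simp add: H_def w_def)
  qed (use u in \<open>simp add: H_def\<close>)
  have "transpose_mat H = H" by (rule eq_matI) (auto simp: H_def)
  thus ?thesis using that H HH col by blast
qed

text \<open>Reflecting the first unit vector to a unit eigenvector splits off a one-by-one block.\<close>

theorem symmetric_mat_diagonalisable:
  fixes A :: "real Matrix.mat"
  assumes "A \<in> carrier_mat n n" "transpose_mat A = A"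
  shows "\<exists>U D. U \<in> carrier_mat n n \<and> D \<in> carrier_mat n n \<and> diagonal_mat D
    \<and> transpose_mat U * U = 1\<^sub>m n \<and> A * U = U * D"
  using assms
proof (induction n arbitrary: A)
  case 0
  show ?case by (intro exI[of _ "1\<^sub>m 0"] exI[of _ A]) (use 0 in \<open>auto simp: diagonal_mat_def\<close>)
next
  case (Suc m)
  let ?n = "Suc m"
  note A = Suc.prems(1)
  obtain v e where v: "v \<in> carrier_vec ?n" "v \<bullet> v = 1" "A *\<^sub>v v = e \<cdot>\<^sub>v v"
    using symmetric_mat_eigenvector[OF A Suc.prems(2)] by blast
  obtain H where H: "H \<in> carrier_mat ?n ?n" "transpose_mat H = H" "H * H = 1\<^sub>m ?n" "col H 0 = v"
    using householder_reflection[OF v(1,2)] by blast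
  define B where "B = H * A * H"
  have B: "B \<in> carrier_mat ?n ?n" using A H by (simp add: B_def)
  have symB: "transpose_mat B = B"
    unfolding B_def using A H Suc.prems(2)
    by (simp add: transpose_mult[of _ ?n ?n _ ?n] assoc_mult_mat[of _ ?n ?n _ ?n _ ?n])
  have colB: "col B 0 = e \<cdot>\<^sub>v unit_vec ?n 0"
  proof -
    have "col B 0 = (H * A) *\<^sub>v col H 0"
      unfolding B_def by (rule col_mult2[of _ ?n ?n _ ?n]) (use A H in auto)
    also have "\<dots> = H *\<^sub>v (A *\<^sub>v v)"
      unfolding H(4) by (rule assoc_mult_mat_vec[of _ ?n ?n _ ?n]) (use A H v in auto)
    also have "\<dots> = e \<cdot>\<^sub>v (H *\<^sub>v v)" using v H by (simp only: v(3) mult_mat_vec[of _ ?n ?n])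
    also have "H *\<^sub>v v = col (H * H) 0"
      unfolding H(4)[symmetric] by (rule col_mult2[of _ ?n ?n _ ?n, symmetric]) (use H in auto)
    also have "\<dots> = unit_vec ?n 0" by (simp add: H(3))
    finally show ?thesis .
  qed
  have B0: "B $$ (i, 0) = (if i = 0 then e else 0)" if "i < ?n" for i
    using arg_cong[OF colB, of "\<lambda>v. v $ i"] that B by simp
  have B0': "B $$ (0, i) = (if i = 0 then e else 0)" if "i < ?n" for i
    using B0[OF that] arg_cong[OF symB, of "\<lambda>M. M $$ (i, 0)"] that B by simp
  define A3 where "A3 = mat m m (\<lambda>(i, j). B $$ (Suc i, Suc j))"
  have A3: "A3 \<in> carrier_mat m m" by (simp add: A3_def)
  have sym3: "transpose_mat A3 = A3"
  proof (rule eq_matI)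
    fix i j assume "i < dim_row A3" "j < dim_col A3"
    thus "transpose_mat A3 $$ (i, j) = A3 $$ (i, j)"
      using arg_cong[OF symB, of "\<lambda>M. M $$ (Suc i, Suc j)"] B by (simp add: A3_def)
  qed (auto simp: A3_def)
  obtain U3 D3 where 3: "U3 \<in> carrier_mat m m" "D3 \<in> carrier_mat m m" "diagonal_mat D3"
    "transpose_mat U3 * U3 = 1\<^sub>m m" "A3 * U3 = U3 * D3"
    using Suc.IH[OF A3 sym3] by blast
  define E where "E = mat 1 1 (\<lambda>_. e)"
  have E: "E \<in> carrier_mat 1 1" by (simp add: E_def)
  have Bblock: "B = four_block_mat E (0\<^sub>m 1 m) (0\<^sub>m m 1) A3"
  proof (rule eq_matI)
    fix i j assume "i < dim_row (four_block_mat E (0\<^sub>m 1 m) (0\<^sub>m m 1) A3)"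
      "j < dim_col (four_block_mat E (0\<^sub>m 1 m) (0\<^sub>m m 1) A3)"
    hence "i < ?n" "j < ?n" by (auto simp: E_def A3_def)
    thus "B $$ (i, j) = four_block_mat E (0\<^sub>m 1 m) (0\<^sub>m m 1) A3 $$ (i, j)"
      using B0[of i] B0'[of j] by (cases i; cases j) (auto simp: E_def A3_def)
  qed (use B in \<open>auto simp: E_def A3_def\<close>)
  define R where "R = four_block_mat (1\<^sub>m 1) (0\<^sub>m 1 m) (0\<^sub>m m 1) U3"
  define D where "D = four_block_mat E (0\<^sub>m 1 m) (0\<^sub>m m 1) D3"
  have R: "R \<in> carrier_mat ?n ?n" unfolding R_def using 3 by auto
  have D: "D \<in> carrier_mat ?n ?n" unfolding D_def using 3 E by auto
  have RR: "transpose_mat R * R = 1\<^sub>m ?n"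
  proof -
    have "transpose_mat R = four_block_mat (1\<^sub>m 1) (0\<^sub>m 1 m) (0\<^sub>m m 1) (transpose_mat U3)"
      unfolding R_def by (subst transpose_four_block_mat) (use 3 in auto)
    moreover have "four_block_mat (1\<^sub>m 1) (0\<^sub>m 1 m) (0\<^sub>m m 1) (transpose_mat U3) * R
        = four_block_mat (1\<^sub>m 1) (0\<^sub>m 1 m) (0\<^sub>m m 1) (1\<^sub>m m)"
      unfolding R_def by (subst mult_four_block_mat[of _ 1 1 _ m _ m _ _ 1 _ m]) (use 3 in auto)
    ultimately show ?thesis by simp
  qed
  have BR: "B * R = R * D"
  proof -
    have "B * R = four_block_mat E (0\<^sub>m 1 m) (0\<^sub>m m 1) (A3 * U3)"
      unfolding Bblock R_def by (subst mult_four_block_mat[of _ 1 1 _ m _ m _ _ 1 _ m]) (use 3 E A3 in auto)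
    moreover have "R * D = four_block_mat E (0\<^sub>m 1 m) (0\<^sub>m m 1) (U3 * D3)"
      unfolding D_def R_def by (subst mult_four_block_mat[of _ 1 1 _ m _ m _ _ 1 _ m]) (use 3 E in auto)
    ultimately show ?thesis using 3 by simp
  qed
  have diag: "diagonal_mat D"
    unfolding diagonal_mat_def
  proof (intro allI impI)
    fix i j assume "i < dim_row D" "j < dim_col D" "i \<noteq> j"
    thus "D $$ (i, j) = 0" using 3(1-3) E by (cases i; cases j) (auto simp: D_def diagonal_mat_def)
  qed
  define U where "U = H * R"
  have U: "U \<in> carrier_mat ?n ?n" using H R by (simp add: U_def)
  have Rt: "transpose_mat R \<in> carrier_mat ?n ?n" using R by simp
  have "transpose_mat U * U = transpose_mat R * H * (H * R)"
    unfolding U_def using H R by (simp add: transpose_mult[of _ ?n ?n _ ?n])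
  also have "\<dots> = transpose_mat R * (H * (H * R))"
    by (rule assoc_mult_mat[of _ ?n ?n _ ?n _ ?n]) (use H R in auto)
  also have "H * (H * R) = H * H * R"
    by (rule assoc_mult_mat[of _ ?n ?n _ ?n _ ?n, symmetric]) (use H R in auto)
  also have "\<dots> = R" using H(3) R by simp
  finally have UU: "transpose_mat U * U = 1\<^sub>m ?n" using RR by simp
  have "H * B = H * (H * (A * H))"
    unfolding B_def using A H by (simp add: assoc_mult_mat[of _ ?n ?n _ ?n _ ?n])
  also have "\<dots> = H * H * (A * H)"
    by (rule assoc_mult_mat[of _ ?n ?n _ ?n _ ?n, symmetric]) (use A H in auto)
  also have "\<dots> = A * H" unfolding H(3) using A H by simp
  finally have HB: "H * B = A * H" .
  have "A * U = A * H * R"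
    unfolding U_def by (rule assoc_mult_mat[of _ ?n ?n _ ?n _ ?n, symmetric]) (use A H R in auto)
  also have "\<dots> = H * (B * R)"
    unfolding HB[symmetric] by (rule assoc_mult_mat[of _ ?n ?n _ ?n _ ?n]) (use B H R in auto)
  also have "\<dots> = U * D"
    unfolding BR U_def by (rule assoc_mult_mat[of _ ?n ?n _ ?n _ ?n, symmetric]) (use D H R in auto)
  finally show ?case using U D diag UU by blast
qed

section \<open>Eigenfunctions of a reversible kernel\<close>

lemma char_poly_diagonal:
  fixes D :: "real Matrix.mat"
  assumes D: "D \<in> carrier_mat n n" "diagonal_mat D"
  shows "proots (char_poly D) = mset (map (\<lambda>i. D $$ (i, i)) [0..<n])"
proof -
  have "upper_triangular D" using D by (auto simp: diagonal_mat_def upper_triangular_def)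
  hence "char_poly D = (\<Prod>a\<leftarrow>diag_mat D. [:- a, 1:])" using char_poly_upper_triangular D(1) by blast
  also have "proots (\<Prod>a\<leftarrow>xs. [:- a, 1:]) = mset xs" for xs :: "real list"
  proof (induction xs)
    case (Cons a xs)
    have "[:- a, 1:] \<noteq> 0" "(\<Prod>a\<leftarrow>xs. [:- a, 1:]) \<noteq> 0" by (auto simp: prod_list_zero_iff)
    hence "[:- a, 1:] * (\<Prod>a\<leftarrow>xs. [:- a, 1:]) \<noteq> 0" by (rule no_zero_divisors)
    thus ?case using Cons by (simp add: proots_mult del: mult_pCons_left)
  qed simp
  finally show ?thesis using D(1) by (simp add: diag_mat_def)
qed

text \<open>An orthonormal basis of eigenfunctions in the weighted space over \<open>S\<close>, enumerated in the
  order of \<open>eigenvalues_desc\<close>; the last clause is completeness.\<close>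

definition eigenbasis :: "'b set \<Rightarrow> ('b \<Rightarrow> real) \<Rightarrow> ('b \<Rightarrow> 'b \<Rightarrow> real) \<Rightarrow> (nat \<Rightarrow> 'b \<Rightarrow> real) \<Rightarrow> bool" where
  "eigenbasis S \<mu> Q \<phi> \<longleftrightarrow>
     (\<forall>i j. i \<le> j \<longrightarrow> j < card S \<longrightarrow> eigenvalues_desc S Q ! j \<le> eigenvalues_desc S Q ! i) \<and>
     (\<forall>i j. i < card S \<longrightarrow> j < card S \<longrightarrow> (\<Sum>k\<in>S. \<mu> k * \<phi> i k * \<phi> j k) = (if i = j then 1 else 0)) \<and>
     (\<forall>i k. i < card S \<longrightarrow> k \<in> S \<longrightarrow> (\<Sum>l\<in>S. Q k l * \<phi> i l) = eigenvalues_desc S Q ! i * \<phi> i k) \<and>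
     (\<forall>f k. k \<in> S \<longrightarrow> (\<Sum>i<card S. (\<Sum>l\<in>S. \<mu> l * f l * \<phi> i l) * \<phi> i k) = f k)"

lemma
  assumes "eigenbasis S \<mu> Q \<phi>"
  shows eigenbasis_desc: "i \<le> j \<Longrightarrow> j < card S \<Longrightarrow> eigenvalues_desc S Q ! j \<le> eigenvalues_desc S Q ! i"
    and eigenbasis_orthonormal: "i < card S \<Longrightarrow> j < card S \<Longrightarrow> (\<Sum>k\<in>S. \<mu> k * \<phi> i k * \<phi> j k) = (if i = j then 1 else 0)"
    and eigenbasis_eigen: "i < card S \<Longrightarrow> k \<in> S \<Longrightarrow> (\<Sum>l\<in>S. Q k l * \<phi> i l) = eigenvalues_desc S Q ! i * \<phi> i k"
    and eigenbasis_complete: "k \<in> S \<Longrightarrow> (\<Sum>i<card S. (\<Sum>l\<in>S. \<mu> l * f l * \<phi> i l) * \<phi> i k) = f k"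
  using assms unfolding eigenbasis_def by blast+

text \<open>The kernel matrix is similar to the symmetric matrix with entries
\<open>sqrt (\<mu> k) * Q k l / sqrt (\<mu> l)\<close>.\<close>

theorem reversible_eigenbasis:
  fixes Q :: "'b \<Rightarrow> 'b \<Rightarrow> real" and \<mu> :: "'b \<Rightarrow> real"
  assumes fin: "finite S" and pos: "\<And>k. k \<in> S \<Longrightarrow> 0 < \<mu> k"
    and sym: "\<And>k l. k \<in> S \<Longrightarrow> l \<in> S \<Longrightarrow> \<mu> k * Q k l = \<mu> l * Q l k"
  shows "\<exists>\<phi>. eigenbasis S \<mu> Q \<phi>"
proof -
  define N where "N = card S"
  define xs where "xs = (SOME xs. distinct xs \<and> set xs = S)"
  have xs: "distinct xs" "set xs = S"
    using someI_ex[OF finite_distinct_list[OF fin, simplified conj_commute]] unfolding xs_def by auto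
  have len: "length xs = N" using xs distinct_card by (fastforce simp: N_def)
  have xS: "xs ! i \<in> S" if "i < N" for i using that xs len nth_mem by metis
  have bij: "bij_betw ((!) xs) {..<N} S" using bij_betw_nth[OF xs(1) _ xs(2)[symmetric]] len by simp
  have sumS: "(\<Sum>k\<in>S. g k) = (\<Sum>i<N. g (xs ! i))" for g :: "'b \<Rightarrow> real"
    using sum.reindex_bij_betw[OF bij, of g] by simp
  define r where "r i = sqrt (\<mu> (xs ! i))" for i
  have r: "r i > 0" "r i * r i = \<mu> (xs ! i)" if "i < N" for i
    using pos[OF xS[OF that]] by (auto simp: r_def)
  define KM where "KM = kernel_matrix S Q"
  have KM: "KM = mat N N (\<lambda>(i, j). Q (xs ! i) (xs ! j))"
    by (simp add: KM_def kernel_matrix_def xs_def[symmetric] N_def Let_def)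
  define A where "A = mat N N (\<lambda>(i, j). r i * Q (xs ! i) (xs ! j) / r j)"
  have A: "A \<in> carrier_mat N N" by (simp add: A_def)
  have symA: "transpose_mat A = A"
  proof (rule eq_matI)
    fix i j assume "i < dim_row A" "j < dim_col A"
    hence ij: "i < N" "j < N" by (auto simp: A_def)
    have "r j * r j * Q (xs ! j) (xs ! i) = r i * r i * Q (xs ! i) (xs ! j)"
      using sym[OF xS[OF ij(1)] xS[OF ij(2)]] r ij by simp
    hence "r j * Q (xs ! j) (xs ! i) / r i = r i * Q (xs ! i) (xs ! j) / r j"
      using r(1)[OF ij(1)] r(1)[OF ij(2)] by (simp add: field_simps)
    thus "transpose_mat A $$ (i, j) = A $$ (i, j)" using ij by (simp add: A_def)
  qed (auto simp: A_def)
  obtain U D where U: "U \<in> carrier_mat N N" and D: "D \<in> carrier_mat N N" "diagonal_mat D"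
    and UU: "transpose_mat U * U = 1\<^sub>m N" and AU: "A * U = U * D"
    using symmetric_mat_diagonalisable[OF A symA] by blast
  have UU': "U * transpose_mat U = 1\<^sub>m N"
    by (rule mat_mult_left_right_inverse[OF _ U UU]) (use U in simp)
  have orth: "(\<Sum>k<N. U $$ (k, i) * U $$ (k, j)) = (if i = j then 1 else 0)" if "i < N" "j < N" for i j
    using arg_cong[OF UU, of "\<lambda>M. M $$ (i, j)"] that U by (simp add: scalar_prod_def atLeast0LessThan)
  have orth': "(\<Sum>k<N. U $$ (i, k) * U $$ (j, k)) = (if i = j then 1 else 0)" if "i < N" "j < N" for i j
    using arg_cong[OF UU', of "\<lambda>M. M $$ (i, j)"] that U by (simp add: scalar_prod_def atLeast0LessThan)
  have eig: "(\<Sum>k<N. r i * Q (xs ! i) (xs ! k) / r k * U $$ (k, j)) = U $$ (i, j) * D $$ (j, j)"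
    if ij: "i < N" "j < N" for i j
  proof -
    have "(A * U) $$ (i, j) = (\<Sum>k<N. r i * Q (xs ! i) (xs ! k) / r k * U $$ (k, j))"
      using ij U by (simp add: A_def scalar_prod_def atLeast0LessThan)
    moreover have "(U * D) $$ (i, j) = (\<Sum>k<N. U $$ (i, k) * D $$ (k, j))"
      using ij U D by (simp add: scalar_prod_def atLeast0LessThan)
    moreover have "\<dots> = (\<Sum>k<N. if k = j then U $$ (i, k) * D $$ (k, j) else 0)"
      by (rule sum.cong) (use ij D in \<open>auto simp: diagonal_mat_def\<close>)
    ultimately show ?thesis using AU ij by simp
  qed
  define V where "V = mat N N (\<lambda>(i, j). U $$ (i, j) / r i)"
  define V' where "V' = mat N N (\<lambda>(i, j). U $$ (j, i) * r j)"
  have V: "V \<in> carrier_mat N N" "V' \<in> carrier_mat N N" by (auto simp: V_def V'_def)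
  have V'V: "V' * V = 1\<^sub>m N"
  proof (rule eq_matI)
    fix i j assume "i < dim_row (1\<^sub>m N :: real Matrix.mat)" "j < dim_col (1\<^sub>m N :: real Matrix.mat)"
    hence ij: "i < N" "j < N" by auto
    have "(V' * V) $$ (i, j) = (\<Sum>k<N. U $$ (k, i) * r k * (U $$ (k, j) / r k))"
      using ij by (simp add: V_def V'_def scalar_prod_def atLeast0LessThan)
    also have "\<dots> = (\<Sum>k<N. U $$ (k, i) * U $$ (k, j))"
      by (rule sum.cong) (use r(1) in \<open>force simp: field_simps\<close>)+
    finally show "(V' * V) $$ (i, j) = 1\<^sub>m N $$ (i, j)" using orth ij by simp
  qed (auto simp: V_def V'_def)
  have VV': "V * V' = 1\<^sub>m N" by (rule mat_mult_left_right_inverse[OF V(2,1) V'V])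
  have KMc: "KM \<in> carrier_mat N N" by (simp add: KM)
  have KV: "KM * V = V * D"
  proof (rule eq_matI)
    fix i j assume "i < dim_row (V * D)" "j < dim_col (V * D)"
    hence ij: "i < N" "j < N" using V D by auto
    have "(KM * V) $$ (i, j) = (\<Sum>k<N. Q (xs ! i) (xs ! k) * (U $$ (k, j) / r k))"
      using ij by (simp add: KM V_def scalar_prod_def atLeast0LessThan)
    also have "\<dots> = (\<Sum>k<N. r i * Q (xs ! i) (xs ! k) / r k * U $$ (k, j)) / r i"
      unfolding sum_divide_distrib by (rule sum.cong) (use r(1)[OF ij(1)] in \<open>auto simp: field_simps\<close>)
    also have "\<dots> = (\<Sum>k<N. if k = j then U $$ (i, k) / r i * D $$ (k, j) else 0)"
      using eig[OF ij] ij by simp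
    also have "\<dots> = (\<Sum>k<N. U $$ (i, k) / r i * D $$ (k, j))"
      by (rule sum.cong) (use ij D in \<open>auto simp: diagonal_mat_def\<close>)
    also have "\<dots> = (V * D) $$ (i, j)"
      using ij D by (simp add: V_def scalar_prod_def atLeast0LessThan)
    finally show "(KM * V) $$ (i, j) = (V * D) $$ (i, j)" .
  qed (use KMc V D in auto)
  have "KM = KM * (V * V')" using KMc by (simp add: VV')
  also have "\<dots> = KM * V * V'" by (rule assoc_mult_mat[symmetric]) (use KMc V in auto)
  finally have "KM = V * D * V'" unfolding KV .
  hence "similar_mat KM D" by (intro similar_matI[of KM D V V' N]) (use KMc D V VV' V'V in auto)
  hence "proots (char_poly KM) = mset (map (\<lambda>i. D $$ (i, i)) [0..<N])"
    using char_poly_similar char_poly_diagonal[OF D] by metis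
  define es where "es = map (\<lambda>i. D $$ (i, i)) [0..<N]"
  define L where "L = eigenvalues_desc S Q"
  have mL: "mset L = mset es"
    unfolding L_def eigenvalues_desc_def KM_def[symmetric] es_def
    using \<open>proots (char_poly KM) = _\<close> by simp
  have lenes: "length es = N" by (simp add: es_def)
  have lenL: "length L = N" using mset_eq_length[OF mL] lenes by simp
  obtain p where p: "p permutes {..<N}" "permute_list p es = L"
    using mset_eq_permutation[OF mL] lenes by metis
  have pN: "p i < N" if "i < N" for i using permutes_in_image[OF p(1), of i] that by simp
  have Lp: "L ! i = D $$ (p i, p i)" if "i < N" for i
    using permute_list_nth[of p es i] p that lenes pN[OF that] by (simp add: es_def)
  have desc: "L ! j \<le> L ! i" if "i \<le> j" "j < N" for i j
  proof -
    define M where "M = sorted_list_of_multiset (proots (char_poly KM))"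
    have M: "L = rev M" "sorted M" by (auto simp: L_def eigenvalues_desc_def M_def KM_def)
    have "M ! (N - Suc j) \<le> M ! (N - Suc i)"
      by (rule sorted_nth_mono[OF M(2)]) (use that lenL M(1) in auto)
    thus ?thesis using that lenL M(1) by (simp add: rev_nth)
  qed
  define idx where "idx = inv_into {..<N} ((!) xs)"
  have idx: "idx (xs ! i) = i" if "i < N" for i
    unfolding idx_def using bij that by (simp add: bij_betw_def inv_into_f_f)
  have ex: "\<exists>i<N. k = xs ! i" if "k \<in> S" for k using that xs len by (metis in_set_conv_nth)
  define \<phi> where "\<phi> i k = U $$ (idx k, p i) / r (idx k)" for i k
  have "eigenbasis S \<mu> Q \<phi>"
    unfolding eigenbasis_def N_def[symmetric] L_def[symmetric]
  proof (intro conjI allI impI)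
    show "L ! j \<le> L ! i" if "i \<le> j" "j < N" for i j using desc that .
    show "(\<Sum>k\<in>S. \<mu> k * \<phi> i k * \<phi> j k) = (if i = j then 1 else 0)" if ij: "i < N" "j < N" for i j
    proof -
      have "(\<Sum>k\<in>S. \<mu> k * \<phi> i k * \<phi> j k) = (\<Sum>k<N. U $$ (k, p i) * U $$ (k, p j))"
        unfolding sumS
      proof (rule sum.cong[OF refl])
        fix k assume "k \<in> {..<N}"
        hence k: "k < N" by simp
        show "\<mu> (xs ! k) * \<phi> i (xs ! k) * \<phi> j (xs ! k) = U $$ (k, p i) * U $$ (k, p j)"
          unfolding \<phi>_def idx[OF k] r(2)[OF k, symmetric] using r(1)[OF k] by simp
      qed
      also have "\<dots> = (if p i = p j then 1 else 0)" using orth pN ij by simp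
      also have "p i = p j \<longleftrightarrow> i = j" using permutes_inj[OF p(1)] by (simp add: inj_eq)
      finally show ?thesis .
    qed
    show "(\<Sum>l\<in>S. Q k l * \<phi> i l) = L ! i * \<phi> i k" if i: "i < N" and k: "k \<in> S" for i k
    proof -
      obtain a where a: "a < N" "k = xs ! a" using ex[OF k] by blast
      have "(\<Sum>l\<in>S. Q k l * \<phi> i l) = (\<Sum>l<N. r a * Q (xs ! a) (xs ! l) / r l * U $$ (l, p i)) / r a"
        unfolding sumS sum_divide_distrib
        by (rule sum.cong) (use r(1)[OF a(1)] idx in \<open>auto simp: \<phi>_def a(2)\<close>)
      also have "\<dots> = L ! i * \<phi> i k"
        unfolding eig[OF a(1) pN[OF i]] Lp[OF i] by (simp add: \<phi>_def a idx)
      finally show ?thesis .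
    qed
    show "(\<Sum>i<N. (\<Sum>l\<in>S. \<mu> l * f l * \<phi> i l) * \<phi> i k) = f k" if k: "k \<in> S" for f k
    proof -
      obtain a where a: "a < N" "k = xs ! a" using ex[OF k] by blast
      have "(\<Sum>i<N. (\<Sum>l\<in>S. \<mu> l * f l * \<phi> i l) * \<phi> i k)
          = (\<Sum>i<N. \<Sum>l<N. r l * f (xs ! l) / r a * (U $$ (a, p i) * U $$ (l, p i)))"
        unfolding sumS sum_distrib_right
      proof (rule sum.cong[OF refl], rule sum.cong[OF refl])
        fix i l assume "l \<in> {..<N}"
        hence l: "l < N" by simp
        show "\<mu> (xs ! l) * f (xs ! l) * \<phi> i (xs ! l) * \<phi> i k
            = r l * f (xs ! l) / r a * (U $$ (a, p i) * U $$ (l, p i))"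
          unfolding \<phi>_def a(2) idx[OF l] idx[OF a(1)] r(2)[OF l, symmetric] using r(1)[OF l] by simp
      qed
      also have "\<dots> = (\<Sum>l<N. \<Sum>i<N. r l * f (xs ! l) / r a * (U $$ (a, p i) * U $$ (l, p i)))"
        by (rule sum.swap)
      also have "\<dots> = (\<Sum>l<N. r l * f (xs ! l) / r a * (\<Sum>i<N. U $$ (a, p i) * U $$ (l, p i)))"
        by (simp only: sum_distrib_left)
      also have "\<dots> = (\<Sum>l<N. if l = a then f (xs ! l) else 0)"
      proof (rule sum.cong[OF refl])
        fix l assume "l \<in> {..<N}"
        hence l: "l < N" by simp
        have "(\<Sum>i<N. U $$ (a, p i) * U $$ (l, p i)) = (\<Sum>i<N. U $$ (a, i) * U $$ (l, i))"
          using sum.reindex_bij_betw[OF permutes_imp_bij[OF p(1)], of "\<lambda>i. U $$ (a, i) * U $$ (l, i)"] .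
        also have "\<dots> = (if a = l then 1 else 0)" by (rule orth'[OF a(1) l])
        finally show "r l * f (xs ! l) / r a * (\<Sum>i<N. U $$ (a, p i) * U $$ (l, p i)) = (if l = a then f (xs ! l) else 0)"
          using r(1)[OF a(1)] by auto
      qed
      also have "\<dots> = f k" using a by simp
      finally show ?thesis .
    qed
  qed
  thus ?thesis by blast
qed

section \<open>The variational characterisation of the gap\<close>

text \<open>Twice the Dirichlet form of \<open>Q\<close>, and the variance, on a finite set.\<close>

definition kernel_energy :: "'b set \<Rightarrow> ('b \<Rightarrow> real) \<Rightarrow> ('b \<Rightarrow> 'b \<Rightarrow> real) \<Rightarrow> ('b \<Rightarrow> real) \<Rightarrow> real" where
  "kernel_energy S \<mu> Q f = (\<Sum>k\<in>S. \<Sum>l\<in>S. \<mu> k * Q k l * (f l - f k)\<^sup>2)"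

definition set_variance :: "'b set \<Rightarrow> ('b \<Rightarrow> real) \<Rightarrow> ('b \<Rightarrow> real) \<Rightarrow> real" where
  "set_variance S \<mu> f = (\<Sum>k\<in>S. \<mu> k * (f k)\<^sup>2) - (\<Sum>k\<in>S. \<mu> k * f k)\<^sup>2"

text \<open>A kernel on the finite set \<open>S\<close>, with row sums one on \<open>S\<close>, that is reversible with respect to a
strictly positive probability \<open>\<mu>\<close>.\<close>

locale reversible_on =
  fixes S :: "'b set" and \<mu> :: "'b \<Rightarrow> real" and Q :: "'b \<Rightarrow> 'b \<Rightarrow> real"
  assumes fin: "finite S" and pos: "\<And>k. k \<in> S \<Longrightarrow> 0 < \<mu> k" and mass: "(\<Sum>k\<in>S. \<mu> k) = 1"
    and sym: "\<And>k l. k \<in> S \<Longrightarrow> l \<in> S \<Longrightarrow> \<mu> k * Q k l = \<mu> l * Q l k"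
    and rows: "\<And>k. k \<in> S \<Longrightarrow> (\<Sum>l\<in>S. Q k l) = 1"
begin

lemma kernel_energy_eq:
  "kernel_energy S \<mu> Q f = 2 * ((\<Sum>k\<in>S. \<mu> k * (f k)\<^sup>2) - (\<Sum>k\<in>S. \<mu> k * f k * (\<Sum>l\<in>S. Q k l * f l)))"
proof -
  have 1: "(\<Sum>k\<in>S. \<Sum>l\<in>S. \<mu> k * Q k l * (f k)\<^sup>2) = (\<Sum>k\<in>S. \<mu> k * (f k)\<^sup>2)"
  proof (rule sum.cong[OF refl])
    fix k assume "k \<in> S"
    have "(\<Sum>l\<in>S. \<mu> k * Q k l * (f k)\<^sup>2) = \<mu> k * (\<Sum>l\<in>S. Q k l) * (f k)\<^sup>2"
      by (simp only: sum_distrib_left sum_distrib_right)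
    thus "(\<Sum>l\<in>S. \<mu> k * Q k l * (f k)\<^sup>2) = \<mu> k * (f k)\<^sup>2" using rows[OF \<open>k \<in> S\<close>] by simp
  qed
  have "(\<Sum>k\<in>S. \<Sum>l\<in>S. \<mu> k * Q k l * (f l)\<^sup>2) = (\<Sum>k\<in>S. \<Sum>l\<in>S. \<mu> l * Q l k * (f l)\<^sup>2)"
    by (intro sum.cong refl) (simp add: sym)
  also have "\<dots> = (\<Sum>k\<in>S. \<Sum>l\<in>S. \<mu> k * Q k l * (f k)\<^sup>2)" by (rule sum.swap)
  finally have 2: "(\<Sum>k\<in>S. \<Sum>l\<in>S. \<mu> k * Q k l * (f l)\<^sup>2) = (\<Sum>k\<in>S. \<mu> k * (f k)\<^sup>2)" using 1 by simp
  have "kernel_energy S \<mu> Q f = (\<Sum>k\<in>S. \<Sum>l\<in>S. \<mu> k * Q k l * (f l)\<^sup>2 + \<mu> k * Q k l * (f k)\<^sup>2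
      - 2 * (\<mu> k * f k * (Q k l * f l)))"
    unfolding kernel_energy_def by (intro sum.cong refl) (simp add: power2_eq_square algebra_simps)
  also have "\<dots> = 2 * (\<Sum>k\<in>S. \<mu> k * (f k)\<^sup>2) - 2 * (\<Sum>k\<in>S. \<mu> k * f k * (\<Sum>l\<in>S. Q k l * f l))"
  proof -
    have "(\<Sum>k\<in>S. \<Sum>l\<in>S. 2 * (\<mu> k * f k * (Q k l * f l))) = 2 * (\<Sum>k\<in>S. \<mu> k * f k * (\<Sum>l\<in>S. Q k l * f l))"
      by (simp only: sum_distrib_left)
    thus ?thesis unfolding sum.distrib sum_subtractf 1 2 by simp
  qed
  finally show ?thesis by simp
qed

lemma kernel_energy_affine: "kernel_energy S \<mu> Q (\<lambda>k. a * f k + b) = a\<^sup>2 * kernel_energy S \<mu> Q f"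
proof -
  have "((a * f l + b) - (a * f k + b))\<^sup>2 = a\<^sup>2 * (f l - f k)\<^sup>2" for k l
    by (simp add: power2_eq_square algebra_simps)
  thus ?thesis unfolding kernel_energy_def by (simp add: sum_distrib_left mult.left_commute)
qed

lemma set_variance_affine: "set_variance S \<mu> (\<lambda>k. a * f k + b) = a\<^sup>2 * set_variance S \<mu> f"
proof -
  have 1: "(\<Sum>k\<in>S. \<mu> k * (a * f k + b)) = a * (\<Sum>k\<in>S. \<mu> k * f k) + b"
  proof -
    have "(\<Sum>k\<in>S. \<mu> k * (a * f k + b)) = (\<Sum>k\<in>S. a * (\<mu> k * f k) + b * \<mu> k)"
      by (intro sum.cong refl) (simp add: algebra_simps)
    thus ?thesis by (simp add: sum.distrib sum_distrib_left[symmetric] mass)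
  qed
  have 2: "(\<Sum>k\<in>S. \<mu> k * (a * f k + b)\<^sup>2)
      = a\<^sup>2 * (\<Sum>k\<in>S. \<mu> k * (f k)\<^sup>2) + 2 * a * b * (\<Sum>k\<in>S. \<mu> k * f k) + b\<^sup>2"
  proof -
    have "(\<Sum>k\<in>S. \<mu> k * (a * f k + b)\<^sup>2)
        = (\<Sum>k\<in>S. a\<^sup>2 * (\<mu> k * (f k)\<^sup>2) + 2 * a * b * (\<mu> k * f k) + b\<^sup>2 * \<mu> k)"
      by (intro sum.cong refl) (simp add: power2_eq_square algebra_simps)
    thus ?thesis by (simp add: sum.distrib sum_distrib_left[symmetric] mass)
  qed
  show ?thesis unfolding set_variance_def 1 2 by (simp add: power2_eq_square algebra_simps)
qed

text \<open>The norm and the energy of a function in terms of its coefficients \<open>y\<close> in an eigenbasis.\<close>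

lemma parseval:
  assumes complete: "\<And>k. k \<in> S \<Longrightarrow> (\<Sum>i<N. y i * \<phi> i k) = f k"
    and y: "\<And>i. y i = (\<Sum>l\<in>S. \<mu> l * f l * \<phi> i l)"
    and eig: "\<And>i k. i < N \<Longrightarrow> k \<in> S \<Longrightarrow> (\<Sum>l\<in>S. Q k l * \<phi> i l) = e i * \<phi> i k"
  shows "(\<Sum>k\<in>S. \<mu> k * (f k)\<^sup>2) = (\<Sum>i<N. (y i)\<^sup>2)"
    and "kernel_energy S \<mu> Q f = 2 * (\<Sum>i<N. (1 - e i) * (y i)\<^sup>2)"
proof -
  show 1: "(\<Sum>k\<in>S. \<mu> k * (f k)\<^sup>2) = (\<Sum>i<N. (y i)\<^sup>2)"
  proof -
    have "(\<Sum>k\<in>S. \<mu> k * (f k)\<^sup>2) = (\<Sum>k\<in>S. \<Sum>i<N. y i * (\<mu> k * f k * \<phi> i k))"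
    proof (rule sum.cong[OF refl])
      fix k assume "k \<in> S"
      hence "\<mu> k * (f k)\<^sup>2 = \<mu> k * f k * (\<Sum>i<N. y i * \<phi> i k)"
        by (simp add: complete power2_eq_square)
      thus "\<mu> k * (f k)\<^sup>2 = (\<Sum>i<N. y i * (\<mu> k * f k * \<phi> i k))"
        by (simp add: sum_distrib_left mult.left_commute)
    qed
    also have "\<dots> = (\<Sum>i<N. y i * (\<Sum>k\<in>S. \<mu> k * f k * \<phi> i k))"
      by (subst sum.swap) (simp only: sum_distrib_left)
    finally show ?thesis by (simp only: y[symmetric] power2_eq_square)
  qed
  have "(\<Sum>k\<in>S. \<mu> k * f k * (\<Sum>l\<in>S. Q k l * f l)) = (\<Sum>k\<in>S. \<Sum>i<N. e i * y i * (\<mu> k * f k * \<phi> i k))"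
  proof (rule sum.cong[OF refl])
    fix k assume k: "k \<in> S"
    have "(\<Sum>l\<in>S. Q k l * f l) = (\<Sum>l\<in>S. \<Sum>i<N. y i * (Q k l * \<phi> i l))"
      by (rule sum.cong[OF refl]) (simp add: complete[symmetric] sum_distrib_left mult.left_commute)
    also have "\<dots> = (\<Sum>i<N. y i * (\<Sum>l\<in>S. Q k l * \<phi> i l))"
      by (subst sum.swap) (simp only: sum_distrib_left)
    also have "\<dots> = (\<Sum>i<N. y i * (e i * \<phi> i k))" using eig k by simp
    finally show "\<mu> k * f k * (\<Sum>l\<in>S. Q k l * f l) = (\<Sum>i<N. e i * y i * (\<mu> k * f k * \<phi> i k))"
      by (simp add: sum_distrib_left ac_simps)
  qed
  also have "\<dots> = (\<Sum>i<N. e i * y i * (\<Sum>k\<in>S. \<mu> k * f k * \<phi> i k))"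
    by (subst sum.swap) (simp only: sum_distrib_left)
  also have "\<dots> = (\<Sum>i<N. e i * (y i)\<^sup>2)" by (simp only: y[symmetric]) (simp add: power2_eq_square mult.assoc)
  finally show "kernel_energy S \<mu> Q f = 2 * (\<Sum>i<N. (1 - e i) * (y i)\<^sup>2)"
    unfolding kernel_energy_eq 1 by (simp add: sum_subtractf left_diff_distrib)
qed

lemma set_variance_le: "set_variance S \<mu> f \<le> (\<Sum>k\<in>S. \<mu> k * (f k)\<^sup>2)"
  by (simp add: set_variance_def)

text \<open>Combine \<open>f\<close> with a constant so as to be orthogonal to the first eigenfunction.\<close>

theorem spectral_gap_upper:
  assumes card: "2 \<le> card S" and \<gamma>: "0 \<le> \<gamma>" and var: "0 < set_variance S \<mu> f"
    and f: "kernel_energy S \<mu> Q f \<le> 2 * \<gamma> * set_variance S \<mu> f"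
  shows "spectral_gap S Q \<le> \<gamma>"
proof (rule ccontr)
  define e where "e i = eigenvalues_desc S Q ! i" for i
  obtain \<phi> where \<phi>: "eigenbasis S \<mu> Q \<phi>"
    using reversible_eigenbasis[of S \<mu> Q] fin pos sym by blast
  note desc = eigenbasis_desc[OF \<phi>, folded e_def] and orth = eigenbasis_orthonormal[OF \<phi>]
    and eig = eigenbasis_eigen[OF \<phi>, folded e_def] and complete = eigenbasis_complete[OF \<phi>]
  assume "\<not> spectral_gap S Q \<le> \<gamma>"
  hence gap: "\<gamma> < 1 - e 1" using card by (simp add: spectral_gap_def e_def)
  define a where "a = (\<Sum>l\<in>S. \<mu> l * f l * \<phi> 0 l)"
  define b where "b = (\<Sum>l\<in>S. \<mu> l * \<phi> 0 l)"
  have key: False if g: "(\<Sum>l\<in>S. \<mu> l * g l * \<phi> 0 l) = 0" and nz: "0 < (\<Sum>k\<in>S. \<mu> k * (g k)\<^sup>2)"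
    and small: "kernel_energy S \<mu> Q g \<le> 2 * \<gamma> * (\<Sum>k\<in>S. \<mu> k * (g k)\<^sup>2)" for g
  proof -
    define y where "y i = (\<Sum>l\<in>S. \<mu> l * g l * \<phi> i l)" for i
    have y0: "y 0 = 0" using g by (simp add: y_def)
    note p = parseval[where N = "card S" and f = g and y = y and \<phi> = \<phi> and e = e, OF complete[where f = g, folded y_def] y_def eig]
    have "(1 - e 1) * (\<Sum>i<card S. (y i)\<^sup>2) \<le> (\<Sum>i<card S. (1 - e i) * (y i)\<^sup>2)"
      unfolding sum_distrib_left
    proof (rule sum_mono)
      fix i assume "i \<in> {..<card S}"
      show "(1 - e 1) * (y i)\<^sup>2 \<le> (1 - e i) * (y i)\<^sup>2"
      proof (cases "i = 0")
        case False
        hence "e i \<le> e 1" using desc[of 1 i] \<open>i \<in> _\<close> by simp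
        thus ?thesis by (intro mult_right_mono) auto
      qed (use y0 in simp)
    qed
    moreover have "\<gamma> * (\<Sum>i<card S. (y i)\<^sup>2) < (1 - e 1) * (\<Sum>i<card S. (y i)\<^sup>2)"
      using nz gap p(1) by (intro mult_strict_right_mono) auto
    ultimately show False using small p by simp
  qed
  show False
  proof (cases "b = 0")
    case True
    show False
    proof (rule key[of "\<lambda>_. 1"])
      show "(\<Sum>l\<in>S. \<mu> l * 1 * \<phi> 0 l) = 0" using True by (simp add: b_def)
      show "0 < (\<Sum>k\<in>S. \<mu> k * 1\<^sup>2)" using mass by simp
      show "kernel_energy S \<mu> Q (\<lambda>_. 1) \<le> 2 * \<gamma> * (\<Sum>k\<in>S. \<mu> k * 1\<^sup>2)"
        using \<gamma> mass by (simp add: kernel_energy_def)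
    qed
  next
    case False
    define g where "g k = b * f k + (- a)" for k
    have v: "set_variance S \<mu> g = b\<^sup>2 * set_variance S \<mu> f" unfolding g_def by (rule set_variance_affine)
    have vpos: "0 < set_variance S \<mu> g" unfolding v using False var by simp
    show False
    proof (rule key[of g])
      have "(\<Sum>l\<in>S. \<mu> l * g l * \<phi> 0 l) = (\<Sum>l\<in>S. b * (\<mu> l * f l * \<phi> 0 l) - a * (\<mu> l * \<phi> 0 l))"
        by (intro sum.cong refl) (simp add: g_def algebra_simps)
      also have "\<dots> = b * a - a * b" unfolding sum_subtractf sum_distrib_left[symmetric] a_def b_def ..
      finally show "(\<Sum>l\<in>S. \<mu> l * g l * \<phi> 0 l) = 0" by simp
      show "0 < (\<Sum>k\<in>S. \<mu> k * (g k)\<^sup>2)" using vpos set_variance_le[of g] by linarith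
      have "kernel_energy S \<mu> Q g = b\<^sup>2 * kernel_energy S \<mu> Q f" unfolding g_def by (rule kernel_energy_affine)
      also have "\<dots> \<le> b\<^sup>2 * (2 * \<gamma> * set_variance S \<mu> f)" by (intro mult_left_mono f) simp
      also have "\<dots> = 2 * \<gamma> * set_variance S \<mu> g" by (simp add: v)
      also have "\<dots> \<le> 2 * \<gamma> * (\<Sum>k\<in>S. \<mu> k * (g k)\<^sup>2)" using \<gamma> by (intro mult_left_mono set_variance_le) auto
      finally show "kernel_energy S \<mu> Q g \<le> 2 * \<gamma> * (\<Sum>k\<in>S. \<mu> k * (g k)\<^sup>2)" .
    qed
  qed
qed

text \<open>If the gap were smaller, some combination of the first two eigenfunctions would have mean
  zero and too small an energy.\<close>

theorem spectral_gap_lower: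
  assumes card: "2 \<le> card S"
    and poincare: "\<And>f. 2 * \<gamma> * set_variance S \<mu> f \<le> kernel_energy S \<mu> Q f"
  shows "\<gamma> \<le> spectral_gap S Q"
proof (rule ccontr)
  define e where "e i = eigenvalues_desc S Q ! i" for i
  obtain \<phi> where \<phi>: "eigenbasis S \<mu> Q \<phi>"
    using reversible_eigenbasis[of S \<mu> Q] fin pos sym by blast
  note desc = eigenbasis_desc[OF \<phi>, folded e_def] and orth = eigenbasis_orthonormal[OF \<phi>]
    and eig = eigenbasis_eigen[OF \<phi>, folded e_def] and complete = eigenbasis_complete[OF \<phi>]
  assume "\<not> \<gamma> \<le> spectral_gap S Q"
  hence "1 - e 1 < \<gamma>" using card by (simp add: spectral_gap_def e_def)
  moreover have "e 1 \<le> e 0" using desc[of 0 1] card by simp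
  ultimately have gap: "1 - e 0 < \<gamma>" "1 - e 1 < \<gamma>" by auto
  define m where "m i = (\<Sum>k\<in>S. \<mu> k * \<phi> i k)" for i
  obtain a b where ab: "a * m 0 + b * m 1 = 0" "a \<noteq> 0 \<or> b \<noteq> 0"
  proof (cases "m 1 = 0")
    case True thus ?thesis using that[of 0 1] by simp
  next
    case False thus ?thesis using that[of "m 1" "- m 0"] by simp
  qed
  define f where "f k = a * \<phi> 0 k + b * \<phi> 1 k" for k
  have c: "0 < card S" "1 < card S" using card by auto
  have mean: "(\<Sum>k\<in>S. \<mu> k * f k) = 0"
  proof -
    have "(\<Sum>k\<in>S. \<mu> k * f k) = (\<Sum>k\<in>S. a * (\<mu> k * \<phi> 0 k) + b * (\<mu> k * \<phi> 1 k))"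
      by (intro sum.cong refl) (simp add: f_def algebra_simps)
    also have "\<dots> = a * m 0 + b * m 1" unfolding sum.distrib sum_distrib_left[symmetric] m_def ..
    finally show ?thesis using ab by simp
  qed
  have quad: "(\<Sum>k\<in>S. \<mu> k * (a * \<phi> 0 k + b * \<phi> 1 k) * (c * \<phi> 0 k + d * \<phi> 1 k)) = a * c + b * d" for c d
  proof -
    have "(\<Sum>k\<in>S. \<mu> k * (a * \<phi> 0 k + b * \<phi> 1 k) * (c * \<phi> 0 k + d * \<phi> 1 k))
        = (\<Sum>k\<in>S. a * c * (\<mu> k * \<phi> 0 k * \<phi> 0 k) + a * d * (\<mu> k * \<phi> 0 k * \<phi> 1 k)
          + b * c * (\<mu> k * \<phi> 1 k * \<phi> 0 k) + b * d * (\<mu> k * \<phi> 1 k * \<phi> 1 k))"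
      by (intro sum.cong refl) (simp add: algebra_simps)
    also have "\<dots> = a * c * 1 + a * d * 0 + b * c * 0 + b * d * 1"
      unfolding sum.distrib sum_distrib_left[symmetric] using orth \<open>0 < card S\<close> \<open>1 < card S\<close> by simp
    finally show ?thesis by simp
  qed
  have n2: "(\<Sum>k\<in>S. \<mu> k * (f k)\<^sup>2) = a * a + b * b"
    using quad[of a b] by (simp add: f_def power2_eq_square mult.assoc)
  have "(\<Sum>k\<in>S. \<mu> k * f k * (\<Sum>l\<in>S. Q k l * f l))
      = (\<Sum>k\<in>S. \<mu> k * (a * \<phi> 0 k + b * \<phi> 1 k) * ((e 0 * a) * \<phi> 0 k + (e 1 * b) * \<phi> 1 k))"
  proof (rule sum.cong[OF refl])
    fix k assume k: "k \<in> S"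
    have "(\<Sum>l\<in>S. Q k l * f l) = (\<Sum>l\<in>S. a * (Q k l * \<phi> 0 l) + b * (Q k l * \<phi> 1 l))"
      by (intro sum.cong refl) (simp add: f_def algebra_simps)
    also have "\<dots> = (e 0 * a) * \<phi> 0 k + (e 1 * b) * \<phi> 1 k"
      unfolding sum.distrib sum_distrib_left[symmetric] eig[OF c(1) k] eig[OF c(2) k] by simp
    finally show "\<mu> k * f k * (\<Sum>l\<in>S. Q k l * f l)
        = \<mu> k * (a * \<phi> 0 k + b * \<phi> 1 k) * ((e 0 * a) * \<phi> 0 k + (e 1 * b) * \<phi> 1 k)"
      by (simp only: f_def)
  qed
  also have "\<dots> = a * (e 0 * a) + b * (e 1 * b)" by (rule quad)
  finally have en: "kernel_energy S \<mu> Q f = 2 * ((1 - e 0) * (a * a) + (1 - e 1) * (b * b))"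
    unfolding kernel_energy_eq n2 by (simp add: algebra_simps)
  have "2 * \<gamma> * (a * a + b * b) \<le> kernel_energy S \<mu> Q f"
    using poincare[of f] by (simp add: set_variance_def mean n2)
  moreover have "(1 - e 0) * (a * a) + (1 - e 1) * (b * b) < \<gamma> * (a * a) + \<gamma> * (b * b)"
  proof -
    have le: "(1 - e 0) * (a * a) \<le> \<gamma> * (a * a)" "(1 - e 1) * (b * b) \<le> \<gamma> * (b * b)"
      using gap by (auto intro!: mult_right_mono)
    have sq: "0 < t * t" if "t \<noteq> 0" for t :: real using that by (simp add: zero_less_mult_iff) linarith
    show ?thesis
    proof (cases "a = 0")
      case True
      hence "0 < b * b" using ab sq by blast
      hence "(1 - e 1) * (b * b) < \<gamma> * (b * b)" using gap by (intro mult_strict_right_mono)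
      thus ?thesis using le by linarith
    next
      case False
      hence "(1 - e 0) * (a * a) < \<gamma> * (a * a)" using gap sq by (intro mult_strict_right_mono)
      thus ?thesis using le by linarith
    qed
  qed
  ultimately show False unfolding en by (simp add: distrib_left)
qed

end

section \<open>The projected count kernel in terms of words\<close>

text \<open>The count vector of a word.\<close>

abbreviation letter_count :: "'a list \<Rightarrow> 'a \<Rightarrow> nat" where
  "letter_count w \<equiv> count (mset w)"

lemma letter_count_window: "letter_count (map f [0..<n]) y = (\<Sum>j<n. coord_vec (f j) y)"
  by (induction n) (auto simp: coord_vec_def)

context stationary_kernel
begin

lemma word_expectation_cong_support:
  "(\<And>w. length w = L \<Longrightarrow> 0 < wt w \<Longrightarrow> \<phi> w = \<psi> w) \<Longrightarrow> word_expectation L \<phi> = word_expectation L \<psi>"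
  unfolding word_expectation_def
proof (rule sum.cong[OF refl])
  fix w :: "'a list" assume *: "\<And>w. length w = L \<Longrightarrow> 0 < wt w \<Longrightarrow> \<phi> w = \<psi> w" "w \<in> words L"
  show "wt w * \<phi> w = wt w * \<psi> w"
    using * word_weight_nonneg[of w] by (cases "wt w = 0") (auto simp: less_le)
qed

text \<open>The law of the letter counts of a window of length \<open>n\<close>, the joint law of the counts of two
consecutive windows, and the support of the former.\<close>

definition count_prob :: "nat \<Rightarrow> ('a \<Rightarrow> nat) \<Rightarrow> real" where
  "count_prob n k = word_expectation n (\<lambda>w. if letter_count w = k then 1 else 0)"

definition count_joint :: "nat \<Rightarrow> ('a \<Rightarrow> nat) \<Rightarrow> ('a \<Rightarrow> nat) \<Rightarrow> real" where
  "count_joint n k l = word_expectation (n + 1)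
     (\<lambda>w. if letter_count (take n w) = k \<and> letter_count (drop 1 w) = l then 1 else 0)"

definition count_set :: "nat \<Rightarrow> ('a \<Rightarrow> nat) set" where
  "count_set n = {k. 0 < count_prob n k}"

lemma finite_count_set [simp]: "finite (count_set n)"
proof (rule finite_subset)
  show "count_set n \<subseteq> letter_count ` words n"
  proof
    fix k assume "k \<in> count_set n"
    hence "count_prob n k \<noteq> 0" by (auto simp: count_set_def)
    then obtain w where "w \<in> words n" "wt w * (if letter_count w = k then 1 else 0) \<noteq> 0"
      unfolding count_prob_def word_expectation_def by (meson sum.neutral)
    thus "k \<in> letter_count ` words n" by (auto split: if_splits)
  qed
qed simp

lemma count_in_count_set:
  assumes "length w = n" "0 < wt w"
  shows "letter_count w \<in> count_set n"
proof -
  have "wt w * (if letter_count w = letter_count w then 1 else 0)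
      \<le> (\<Sum>v\<in>words n. wt v * (if letter_count v = letter_count w then 1 else 0))"
    by (rule member_le_sum) (use assms in auto)
  thus ?thesis using assms by (simp add: count_set_def count_prob_def word_expectation_def)
qed

lemma count_in_count_set_take:
  assumes "length w = n + 1" "0 < wt w"
  shows "letter_count (take n w) \<in> count_set n"
proof (rule count_in_count_set)
  have "wt w \<le> (\<Sum>z\<in>words 1. wt (take n w @ z))"
    using member_le_sum[of "drop n w" "words 1" "\<lambda>z. wt (take n w @ z)"] assms by simp
  thus "0 < wt (take n w)" using assms unfolding word_weight_suffix_sum by simp
qed (use assms in simp)

lemma count_in_count_set_drop:
  assumes "length w = n + 1" "0 < wt w"
  shows "letter_count (drop 1 w) \<in> count_set n"
proof (rule count_in_count_set)
  have "wt w \<le> (\<Sum>z\<in>words 1. wt (z @ drop 1 w))"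
    using member_le_sum[of "take 1 w" "words 1" "\<lambda>z. wt (z @ drop 1 w)"] assms by simp
  thus "0 < wt (drop 1 w)" using assms unfolding word_weight_prefix_sum by simp
qed (use assms in simp)

lemma sum_count_prob:
  "(\<Sum>k\<in>count_set n. count_prob n k * f k) = word_expectation n (\<lambda>w. f (letter_count w))"
proof -
  have "(\<Sum>k\<in>count_set n. count_prob n k * f k)
      = (\<Sum>k\<in>count_set n. word_expectation n (\<lambda>w. f k * (if letter_count w = k then 1 else 0)))"
    by (simp only: word_expectation_cmult count_prob_def mult.commute)
  also have "\<dots> = word_expectation n (\<lambda>w. \<Sum>k\<in>count_set n. f k * (if letter_count w = k then 1 else 0))"
    by (rule word_expectation_sum[symmetric])
  also have "\<dots> = word_expectation n (\<lambda>w. f (letter_count w))"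
  proof (rule word_expectation_cong_support)
    fix w :: "'a list" assume "length w = n" "0 < wt w"
    hence "letter_count w \<in> count_set n" by (rule count_in_count_set)
    moreover have "(\<Sum>k\<in>count_set n. f k * (if letter_count w = k then 1 else 0))
        = (\<Sum>k\<in>count_set n. if k = letter_count w then f k else 0)" by (rule sum.cong) auto
    ultimately show "(\<Sum>k\<in>count_set n. f k * (if letter_count w = k then 1 else 0)) = f (letter_count w)"
      by simp
  qed
  finally show ?thesis .
qed

lemma sum_count_joint_right:
  "(\<Sum>l\<in>count_set n. count_joint n k l * f l)
    = word_expectation (n + 1) (\<lambda>w. if letter_count (take n w) = k then f (letter_count (drop 1 w)) else 0)"
proof -
  have "(\<Sum>l\<in>count_set n. count_joint n k l * f l) = (\<Sum>l\<in>count_set n. word_expectation (n + 1) (\<lambda>w. f l *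
      (if letter_count (take n w) = k \<and> letter_count (drop 1 w) = l then 1 else 0)))"
    by (simp only: word_expectation_cmult count_joint_def mult.commute)
  also have "\<dots> = word_expectation (n + 1) (\<lambda>w. \<Sum>l\<in>count_set n. f l *
      (if letter_count (take n w) = k \<and> letter_count (drop 1 w) = l then 1 else 0))"
    by (rule word_expectation_sum[symmetric])
  also have "\<dots> = word_expectation (n + 1) (\<lambda>w. if letter_count (take n w) = k then f (letter_count (drop 1 w)) else 0)"
  proof (rule word_expectation_cong_support)
    fix w :: "'a list" assume "length w = n + 1" "0 < wt w"
    hence "letter_count (drop 1 w) \<in> count_set n" by (rule count_in_count_set_drop)
    moreover have "(\<Sum>l\<in>count_set n. f l * (if letter_count (take n w) = k \<and> letter_count (drop 1 w) = l then 1 else 0))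
        = (\<Sum>l\<in>count_set n. if l = letter_count (drop 1 w) then (if letter_count (take n w) = k then f l else 0) else 0)"
      by (rule sum.cong) auto
    ultimately show "(\<Sum>l\<in>count_set n. f l * (if letter_count (take n w) = k \<and> letter_count (drop 1 w) = l then 1 else 0))
        = (if letter_count (take n w) = k then f (letter_count (drop 1 w)) else 0)" by simp
  qed
  finally show ?thesis .
qed

lemma sum_count_joint:
  "(\<Sum>k\<in>count_set n. \<Sum>l\<in>count_set n. count_joint n k l * \<phi> k l)
    = word_expectation (n + 1) (\<lambda>w. \<phi> (letter_count (take n w)) (letter_count (drop 1 w)))"
  unfolding sum_count_joint_right word_expectation_sum[symmetric]
proof (rule word_expectation_cong_support)
  fix w :: "'a list" assume "length w = n + 1" "0 < wt w"
  hence "letter_count (take n w) \<in> count_set n" by (rule count_in_count_set_take)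
  moreover have "(\<Sum>k\<in>count_set n. if letter_count (take n w) = k then \<phi> k (letter_count (drop 1 w)) else 0)
      = (\<Sum>k\<in>count_set n. if k = letter_count (take n w) then \<phi> k (letter_count (drop 1 w)) else 0)"
    by (rule sum.cong) auto
  ultimately show "(\<Sum>k\<in>count_set n. if letter_count (take n w) = k then \<phi> k (letter_count (drop 1 w)) else 0)
      = \<phi> (letter_count (take n w)) (letter_count (drop 1 w))" by simp
qed

lemma count_joint_row: "(\<Sum>l\<in>count_set n. count_joint n k l) = count_prob n k"
  using sum_count_joint_right[of n k "\<lambda>_. 1"]
    word_expectation_take[of n 1 "\<lambda>w. if letter_count w = k then 1 else 0"]
  by (simp add: count_prob_def)

text \<open>The law of the window, computed from an arbitrary chain.\<close>

lemma chain_word_law: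
  assumes chain: "stationary_markov_chain M X P \<pi>" and w: "w \<noteq> []"
  shows "measure M {\<omega> \<in> space M. map (\<lambda>i. X (int i) \<omega>) [0..<length w] = w} = wt w"
proof -
  have ev: "map (\<lambda>i. X (int i) \<omega>) [0..<L] = v \<longleftrightarrow> (\<forall>i\<in>{0..int L - 1}. X i \<omega> = v ! nat i)"
    if "length v = L" for v L \<omega>
  proof
    assume *: "map (\<lambda>i. X (int i) \<omega>) [0..<L] = v"
    show "\<forall>i\<in>{0..int L - 1}. X i \<omega> = v ! nat i"
    proof
      fix i assume "i \<in> {0..int L - 1}"
      hence "nat i < L" "int (nat i) = i" by auto
      thus "X i \<omega> = v ! nat i" unfolding *[symmetric] by simp
    qed
  next
    assume *: "\<forall>i\<in>{0..int L - 1}. X i \<omega> = v ! nat i"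
    have "X (int i) \<omega> = v ! i" if "i < L" for i using *[rule_format, of "int i"] that by simp
    thus "map (\<lambda>i. X (int i) \<omega>) [0..<L] = v" using that by (intro nth_equalityI) auto
  qed
  show ?thesis using w
  proof (induction w rule: rev_nonempty_induct)
    case (single x)
    have "(\<forall>i\<in>{0..int 1 - 1}. X i \<omega> = [x] ! nat i) \<longleftrightarrow> X 0 \<omega> = x" for \<omega> by auto
    thus ?case using chain ev[of "[x]" 1] by (simp add: stationary_markov_chain_def)
  next
    case (snoc y v)
    define L where "L = length v"
    have L: "1 \<le> L" using snoc by (simp add: L_def Suc_leI)
    define x where "x i = (v @ [y]) ! nat i" for i
    have "measure M {\<omega> \<in> space M. map (\<lambda>i. X (int i) \<omega>) [0..<length (v @ [y])] = v @ [y]}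
        = measure M {\<omega> \<in> space M. \<forall>i\<in>{0..(int L - 1) + 1}. X i \<omega> = x i}"
    proof -
      have "length (v @ [y]) = L + 1" by (simp add: L_def)
      from ev[OF this] show ?thesis unfolding \<open>length (v @ [y]) = L + 1\<close> x_def by simp
    qed
    also have "\<dots> = measure M {\<omega> \<in> space M. \<forall>i\<in>{0..int L - 1}. X i \<omega> = x i} * P (x (int L - 1)) (x (int L - 1 + 1))"
    proof -
      have "0 \<le> int L - 1" using L by simp
      thus ?thesis using chain unfolding stationary_markov_chain_def by blast
    qed
    also have "{\<omega> \<in> space M. \<forall>i\<in>{0..int L - 1}. X i \<omega> = x i} = {\<omega> \<in> space M. map (\<lambda>i. X (int i) \<omega>) [0..<length v] = v}"
    proof -
      have "x i = v ! nat i" if "i \<in> {0..int L - 1}" for i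
      proof -
        have "nat i < L" using that by auto
        thus ?thesis by (simp add: x_def nth_append L_def)
      qed
      thus ?thesis using ev[of v L] by (simp add: L_def)
    qed
    finally have "measure M {\<omega> \<in> space M. map (\<lambda>i. X (int i) \<omega>) [0..<length (v @ [y])] = v @ [y]}
        = wt v * P (x (int L - 1)) (x (int L - 1 + 1))" unfolding snoc.IH .
    moreover have "x (int L - 1) = last v" "x (int L - 1 + 1) = y"
    proof -
      have "nat (int L - 1) = L - 1" using L by simp
      thus "x (int L - 1) = last v" using L snoc(1) by (simp add: x_def nth_append L_def last_conv_nth)
      show "x (int L - 1 + 1) = y" by (simp add: x_def L_def)
    qed
    ultimately show ?case using snoc.hyps by (simp add: word_weight_append)
  qed
qed

lemma chain_event_prob:
  assumes chain: "stationary_markov_chain M X P \<pi>" and L: "1 \<le> L"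
  shows "measure M {\<omega> \<in> space M. R (map (\<lambda>i. X (int i) \<omega>) [0..<L])}
    = word_expectation L (\<lambda>w. if R w then 1 else 0)"
proof -
  interpret prob_space M using chain by (simp add: stationary_markov_chain_def)
  define A where "A w = {\<omega> \<in> space M. map (\<lambda>i. X (int i) \<omega>) [0..<L] = w}" for w
  have meas: "A w \<in> sets M" if "length w = L" for w
  proof -
    have X: "X t \<in> measurable M (count_space UNIV)" for t
      using chain by (simp add: stationary_markov_chain_def)
    have "{\<omega> \<in> space M. X t \<omega> = u} \<in> sets M" for t u
    proof -
      have "X t -` {u} \<inter> space M \<in> sets M" by (rule measurable_sets[OF X]) simp
      moreover have "X t -` {u} \<inter> space M = {\<omega> \<in> space M. X t \<omega> = u}" by blast
      ultimately show ?thesis by simp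
    qed
    hence "{\<omega> \<in> space M. \<forall>i\<in>{..<L}. X (int i) \<omega> = w ! i} \<in> sets M"
      by (intro sets.sets_Collect_finite_All) auto
    also have "{\<omega> \<in> space M. \<forall>i\<in>{..<L}. X (int i) \<omega> = w ! i} = A w"
      unfolding A_def using that by (auto simp: list_eq_iff_nth_eq)
    finally show ?thesis .
  qed
  have "{\<omega> \<in> space M. R (map (\<lambda>i. X (int i) \<omega>) [0..<L])} = (\<Union>w\<in>{w \<in> words L. R w}. A w)"
    by (auto simp: A_def)
  also have "measure M \<dots> = (\<Sum>w\<in>{w \<in> words L. R w}. measure M (A w))"
  proof (rule finite_measure_finite_Union)
    show "finite {w \<in> words L. R w}" by (rule finite_subset[of _ "words L"]) auto
  qed (use meas in \<open>auto simp: disjoint_family_on_def A_def\<close>)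
  also have "\<dots> = (\<Sum>w\<in>{w \<in> words L. R w}. wt w)"
  proof (rule sum.cong[OF refl])
    fix w assume "w \<in> {w \<in> words L. R w}"
    hence "w \<noteq> []" "length w = L" using L by auto
    thus "measure M (A w) = wt w" using chain_word_law[OF chain \<open>w \<noteq> []\<close>] by (simp add: A_def)
  qed
  also have "\<dots> = (\<Sum>w\<in>words L. if R w then wt w else 0)"
    by (rule sum.inter_filter) simp
  also have "\<dots> = word_expectation L (\<lambda>w. if R w then 1 else 0)"
    unfolding word_expectation_def by (rule sum.cong) auto
  finally show ?thesis .
qed

lemma
  assumes chain: "stationary_markov_chain M X P \<pi>" and n: "1 \<le> n"
  shows count_support_words: "count_support M X n = count_set n"
    and projected_count_kernel_words: "projected_count_kernel M X n = (\<lambda>k l. count_joint n k l / count_prob n k)"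
proof -
  have w0: "window_count X n 0 \<omega> = letter_count (map (\<lambda>i. X (int i) \<omega>) [0..<n])" for \<omega>
    by (rule ext) (simp only: window_count_def letter_count_window add_0)
  have w1: "window_count X n 1 \<omega> = letter_count (drop 1 (map (\<lambda>i. X (int i) \<omega>) [0..<n + 1]))" for \<omega>
  proof -
    have "drop 1 (map (\<lambda>i. X (int i) \<omega>) [0..<n + 1]) = map (\<lambda>i. X (1 + int i) \<omega>) [0..<n]"
      by (rule nth_equalityI) (auto simp del: upt_Suc)
    thus ?thesis by (intro ext) (simp only: window_count_def letter_count_window)
  qed
  have t: "take n (map (\<lambda>i. X (int i) \<omega>) [0..<n + 1]) = map (\<lambda>i. X (int i) \<omega>) [0..<n]" for \<omega>
    by (rule nth_equalityI) auto
  have law: "count_law M X n = count_prob n"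
  proof
    fix k
    show "count_law M X n k = count_prob n k"
      unfolding count_law_def w0 count_prob_def
      using chain_event_prob[OF chain n, of "\<lambda>w. letter_count w = k"] .
  qed
  show "count_support M X n = count_set n" by (simp add: count_support_def count_set_def law)
  have joint: "measure M {\<omega> \<in> space M. window_count X n 0 \<omega> = k \<and> window_count X n 1 \<omega> = l} = count_joint n k l" for k l
  proof -
    have "1 \<le> n + 1" by simp
    from chain_event_prob[OF chain this, of "\<lambda>w. letter_count (take n w) = k \<and> letter_count (drop 1 w) = l"]
    show ?thesis unfolding w0 w1 t count_joint_def .
  qed
  show "projected_count_kernel M X n = (\<lambda>k l. count_joint n k l / count_prob n k)"
    by (intro ext) (simp only: projected_count_kernel_def joint law)
qed

end

context ergodic_kernel
begin

lemma word_weight_rev: "wt (rev w) = wt w"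
proof (induction w)
  case (Cons x w)
  show ?case
  proof (cases w)
    case (Cons y v)
    have "wt (rev (x # w)) = wt (rev w) * P y x"
      using word_weight_append[of "rev w" P \<pi> "[x]"] Cons by simp
    also have "\<dots> = (\<pi> y * P y x) * pw y v" using Cons.IH Cons by simp
    also have "\<dots> = wt (x # w)" unfolding detailed_balance[of y x] using Cons by simp
    finally show ?thesis .
  qed simp
qed simp

lemma word_expectation_rev: "word_expectation L (\<lambda>w. \<phi> (rev w)) = word_expectation L \<phi>"
  unfolding word_expectation_def
  by (rule sum.reindex_bij_witness[where i = rev and j = rev]) (auto simp: word_weight_rev)

lemma count_joint_sym: "count_joint n k l = count_joint n l k"
proof -
  have "count_joint n k l = word_expectation (n + 1) (\<lambda>w.
      if letter_count (take n (rev w)) = k \<and> letter_count (drop 1 (rev w)) = l then 1 else 0)"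
    unfolding count_joint_def by (rule word_expectation_rev[symmetric])
  also have "\<dots> = count_joint n l k"
    unfolding count_joint_def
  proof (rule word_expectation_cong)
    fix w :: "'a list" assume "length w = n + 1"
    hence "take n (rev w) = rev (drop 1 w)" "drop 1 (rev w) = rev (take n w)"
      by (simp_all add: take_rev drop_rev)
    thus "(if letter_count (take n (rev w)) = k \<and> letter_count (drop 1 (rev w)) = l then 1 else 0 :: real)
        = (if letter_count (take n w) = l \<and> letter_count (drop 1 w) = k then 1 else 0)" by auto
  qed
  finally show ?thesis .
qed

lemma count_kernel_reversible:
  "reversible_on (count_set n) (count_prob n) (\<lambda>k l. count_joint n k l / count_prob n k)"
proof
  show "finite (count_set n)" by simp
  show "0 < count_prob n k" if "k \<in> count_set n" for k using that by (simp add: count_set_def)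
  show "(\<Sum>k\<in>count_set n. count_prob n k) = 1"
    using sum_count_prob[of n "\<lambda>_. 1"] by (simp add: word_expectation_def)
  show "count_prob n k * (count_joint n k l / count_prob n k) = count_prob n l * (count_joint n l k / count_prob n l)"
    if "k \<in> count_set n" "l \<in> count_set n" for k l
    using that count_joint_sym[of n k l] by (simp add: count_set_def)
  show "(\<Sum>l\<in>count_set n. count_joint n k l / count_prob n k) = 1" if "k \<in> count_set n" for k
    using that unfolding sum_divide_distrib[symmetric] count_joint_row by (simp add: count_set_def)
qed

lemma count_kernel_energy:
  "kernel_energy (count_set n) (count_prob n) (\<lambda>k l. count_joint n k l / count_prob n k) f
    = step_energy n (\<lambda>w. f (letter_count w))"
proof -
  have "kernel_energy (count_set n) (count_prob n) (\<lambda>k l. count_joint n k l / count_prob n k) f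
      = (\<Sum>k\<in>count_set n. \<Sum>l\<in>count_set n. count_joint n k l * (f l - f k)\<^sup>2)"
    unfolding kernel_energy_def by (intro sum.cong refl) (simp add: count_set_def)
  also have "\<dots> = step_energy n (\<lambda>w. f (letter_count w))"
    unfolding step_energy_def by (rule sum_count_joint)
  finally show ?thesis .
qed

lemma count_set_variance:
  "set_variance (count_set n) (count_prob n) f
    = word_expectation n (\<lambda>w. (f (letter_count w))\<^sup>2) - (word_expectation n (\<lambda>w. f (letter_count w)))\<^sup>2"
  unfolding set_variance_def sum_count_prob ..

end

section \<open>A slowly varying count function\<close>

context ergodic_kernel
begin

text \<open>Eigenvalues on nonconstant functions lie strictly between \<open>- 1\<close> and \<open>1\<close>, since a power of
  the kernel contracts oscillations.\<close>

lemma nonconstant_eigenvalue: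
  assumes eig: "\<And>x. (\<Sum>y\<in>UNIV. P x y * g y) = \<theta> * g x" and nc: "g a \<noteq> g b"
  shows "\<bar>\<theta>\<bar> < 1"
proof -
  obtain N \<delta> where N: "N \<ge> 1" "0 < \<delta>" "\<And>m x y. m \<ge> N \<Longrightarrow> \<delta> \<le> kernel_power P m x y"
    using kernel_power_uniformly_pos by metis
  have pow: "(\<Sum>y\<in>UNIV. kernel_power P k x y * g y) = \<theta> ^ k * g x" for k x
  proof (induction k arbitrary: x)
    case 0 show ?case using path_weight_sum_last[where k = 0 and x = x and \<phi> = g] by simp
  next
    case (Suc k)
    have "(\<Sum>y\<in>UNIV. kernel_power P (Suc k) x y * g y)
        = (\<Sum>y\<in>UNIV. \<Sum>z\<in>UNIV. P x z * (kernel_power P k z y * g y))"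
      by (simp add: sum_distrib_right mult.assoc)
    also have "\<dots> = (\<Sum>z\<in>UNIV. \<Sum>y\<in>UNIV. P x z * (kernel_power P k z y * g y))" by (rule sum.swap)
    also have "\<dots> = (\<Sum>z\<in>UNIV. P x z * (\<theta> ^ k * g z))"
      by (simp only: sum_distrib_left[symmetric] Suc)
    also have "\<dots> = \<theta> ^ k * (\<Sum>z\<in>UNIV. P x z * g z)" by (simp add: sum_distrib_left mult.left_commute)
    finally show ?case by (simp add: eig)
  qed
  define Rs where "Rs = (\<lambda>(x, y). \<bar>g x - g y\<bar>) ` (UNIV :: ('a \<times> 'a) set)"
  have Rs: "finite Rs" "Rs \<noteq> {}" by (auto simp: Rs_def)
  define R where "R = Max Rs"
  have le: "\<bar>g x - g y\<bar> \<le> R" for x y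
    unfolding R_def by (rule Max_ge[OF Rs(1)]) (auto simp: Rs_def intro: image_eqI[where x = "(x, y)"])
  obtain x0 y0 where R: "R = \<bar>g x0 - g y0\<bar>"
    using Max_in[OF Rs] unfolding R_def[symmetric] by (auto simp: Rs_def)
  have R0: "0 < R" using le[of a b] nc by linarith
  have "\<bar>\<theta> ^ N * g x0 - \<theta> ^ N * g y0\<bar> \<le> (1 - \<delta>) * R"
    using oscillation_contraction[OF N(3)[OF order_refl], where \<phi> = g and R = R and x = x0 and y = y0, OF le] unfolding pow .
  hence "\<bar>\<theta>\<bar> ^ N * R \<le> (1 - \<delta>) * R"
    by (simp add: R abs_mult power_abs flip: right_diff_distrib)
  hence "\<bar>\<theta>\<bar> ^ N \<le> 1 - \<delta>" by (rule mult_right_le_imp_le) (rule R0)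
  hence "\<bar>\<theta>\<bar> ^ N < 1" using N(2) by linarith
  thus ?thesis using one_le_power[of "\<bar>\<theta>\<bar>" N] by linarith
qed

text \<open>Of two orthonormal eigenfunctions at least one is not constant.\<close>

lemma nontrivial_eigenfunction:
  assumes "2 \<le> CARD('a)"
  obtains g \<theta> where "\<bar>\<theta>\<bar> < 1" "\<And>x. (\<Sum>y\<in>UNIV. P x y * g y) = \<theta> * g x"
    "(\<Sum>x\<in>UNIV. \<pi> x * g x) = 0" "(\<Sum>x\<in>UNIV. \<pi> x * (g x)\<^sup>2) = 1"
proof -
  obtain \<phi> where \<phi>: "eigenbasis UNIV \<pi> P \<phi>"
    using reversible_eigenbasis[of UNIV \<pi> P] detailed_balance by auto
  have c: "0 < CARD('a)" "1 < CARD('a)" using assms by auto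
  have norm: "(\<Sum>x\<in>UNIV. \<pi> x * \<phi> i x * \<phi> i x) = 1" if "i < 2" for i
    using eigenbasis_orthonormal[OF \<phi>, of i i] that assms by simp
  have ex: "\<exists>i<2. \<exists>a b. \<phi> i a \<noteq> \<phi> i b"
  proof (rule ccontr)
    assume "\<not> ?thesis"
    hence const: "\<exists>k. \<forall>x. \<phi> i x = k" if "i < 2" for i using that by metis
    obtain k0 k1 where k: "\<And>x. \<phi> 0 x = k0" "\<And>x. \<phi> (Suc 0) x = k1"
      using const[of 0] const[of "Suc 0"] by auto
    have "k0 * k1 = 0"
      using eigenbasis_orthonormal[OF \<phi> c] by (simp add: k sum_distrib_right[symmetric])
    moreover have "k0 * k0 = 1" "k1 * k1 = 1"
      using norm[of 0] norm[of 1] by (simp_all add: k sum_distrib_right[symmetric])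
    ultimately show False by auto
  qed
  then obtain i a b where i: "i < 2" "\<phi> i a \<noteq> \<phi> i b" by blast
  define \<theta> where "\<theta> = eigenvalues_desc UNIV P ! i"
  have eig: "(\<Sum>y\<in>UNIV. P x y * \<phi> i y) = \<theta> * \<phi> i x" for x
    unfolding \<theta>_def by (rule eigenbasis_eigen[OF \<phi>]) (use i assms in auto)
  have \<theta>: "\<bar>\<theta>\<bar> < 1" by (rule nonconstant_eigenvalue[OF eig i(2)])
  have "(\<Sum>x\<in>UNIV. \<pi> x * \<phi> i x) = (\<Sum>x\<in>UNIV. \<pi> x * (\<Sum>y\<in>UNIV. P x y * \<phi> i y))"
  proof -
    have "(\<Sum>x\<in>UNIV. \<pi> x * (\<Sum>y\<in>UNIV. P x y * \<phi> i y)) = (\<Sum>y\<in>UNIV. \<Sum>x\<in>UNIV. \<pi> x * P x y * \<phi> i y)"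
      by (subst sum.swap) (simp add: sum_distrib_left mult.assoc)
    thus ?thesis by (simp add: sum_distrib_right[symmetric] pi_P)
  qed
  also have "\<dots> = \<theta> * (\<Sum>x\<in>UNIV. \<pi> x * \<phi> i x)" unfolding eig by (simp add: sum_distrib_left mult.left_commute)
  finally have "(1 - \<theta>) * (\<Sum>x\<in>UNIV. \<pi> x * \<phi> i x) = 0" by (simp add: left_diff_distrib)
  hence "(\<Sum>x\<in>UNIV. \<pi> x * \<phi> i x) = 0" using \<theta> by auto
  moreover have "(\<Sum>x\<in>UNIV. \<pi> x * (\<phi> i x)\<^sup>2) = 1"
    using norm[OF i(1)] by (simp add: power2_eq_square mult.assoc)
  ultimately show ?thesis by (rule that[OF \<theta> eig])
qed

lemma sum_list_letter_count:
  fixes g :: "'a \<Rightarrow> real"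
  shows "(\<Sum>x\<in>UNIV. real (letter_count w x) * g x) = sum_list (map g w)"
proof (induction w)
  case (Cons y w)
  have "(\<Sum>x\<in>UNIV. real (letter_count (y # w) x) * g x)
      = (\<Sum>x\<in>UNIV. (if x = y then g x else 0) + real (letter_count w x) * g x)"
    by (rule sum.cong) (auto simp: algebra_simps)
  thus ?case using Cons by (simp add: sum.distrib)
qed simp

lemma word_expectation_Suc:
  assumes "1 \<le> n"
  shows "word_expectation (Suc n) \<phi> = word_expectation n (\<lambda>w. \<Sum>y\<in>UNIV. P (last w) y * \<phi> (w @ [y]))"
  unfolding word_expectation_def sum_words_Suc_right sum_distrib_left
proof (intro sum.cong refl)
  fix w :: "'a list" and y assume "w \<in> words n"
  hence "w \<noteq> []" using assms by auto
  thus "wt (w @ [y]) * \<phi> (w @ [y]) = wt w * (P (last w) y * \<phi> (w @ [y]))"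
    by (simp add: word_weight_append)
qed

lemma word_expectation_add:
  "word_expectation n (\<lambda>w. \<phi> w + \<psi> w) = word_expectation n \<phi> + word_expectation n \<psi>"
  by (simp add: word_expectation_def sum.distrib distrib_left)

text \<open>The sum of a normalised eigenfunction along the window: its second moment \<open>s\<close> and its
  correlation \<open>t\<close> with the last letter satisfy a linear recursion, from which \<open>s\<close> grows linearly.\<close>

lemma eigenfunction_sum_moments:
  assumes eig: "\<And>x. (\<Sum>y\<in>UNIV. P x y * g y) = \<theta> * g x" and \<theta>: "\<bar>\<theta>\<bar> < 1"
    and mean: "(\<Sum>x\<in>UNIV. \<pi> x * g x) = 0" and norm: "(\<Sum>x\<in>UNIV. \<pi> x * (g x)\<^sup>2) = 1"
    and n: "1 \<le> n"
  defines "F \<equiv> \<lambda>w. sum_list (map g w)"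
  shows "word_expectation n F = 0"
    and "min 1 ((1 + \<theta>) / (1 - \<theta>)) * real n \<le> word_expectation n (\<lambda>w. (F w)\<^sup>2)"
proof -
  define s where "s n = word_expectation n (\<lambda>w. (F w)\<^sup>2)" for n
  define t where "t n = word_expectation n (\<lambda>w. F w * g (last w))" for n
  define q where "q z = (\<Sum>y\<in>UNIV. P z y * (g y)\<^sup>2)" for z
  have q: "word_expectation n (\<lambda>w. q (last w)) = 1" if "1 \<le> n" for n
  proof -
    have "word_expectation n (\<lambda>w. q (last w)) = (\<Sum>x\<in>UNIV. \<pi> x * q x)"
      unfolding word_expectation_def by (rule sum_word_weight_last[OF that])
    also have "\<dots> = (\<Sum>y\<in>UNIV. \<Sum>x\<in>UNIV. \<pi> x * P x y * (g y)\<^sup>2)"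
      unfolding q_def by (subst sum.swap) (simp add: sum_distrib_left mult.assoc)
    finally show ?thesis by (simp add: sum_distrib_right[symmetric] pi_P norm)
  qed
  have Fsnoc: "F (w @ [y]) = F w + g y" for w y by (simp add: F_def)
  have row1: "(\<Sum>y\<in>UNIV. P z y * (u + g y)) = u + \<theta> * g z" for u z
    by (simp add: distrib_left sum.distrib sum_distrib_right[symmetric] eig)
  have row2: "(\<Sum>y\<in>UNIV. P z y * (u + g y)\<^sup>2) = u\<^sup>2 + 2 * \<theta> * (u * g z) + q z" for u z
  proof -
    have "(\<Sum>y\<in>UNIV. P z y * (u + g y)\<^sup>2)
        = (\<Sum>y\<in>UNIV. u\<^sup>2 * P z y + 2 * u * (P z y * g y) + P z y * (g y)\<^sup>2)"
      by (rule sum.cong) (auto simp: power2_eq_square algebra_simps)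
    also have "\<dots> = u\<^sup>2 * 1 + 2 * u * (\<theta> * g z) + q z"
      unfolding sum.distrib sum_distrib_left[symmetric] eig q_def P_sum ..
    finally show ?thesis by simp
  qed
  have row3: "(\<Sum>y\<in>UNIV. P z y * ((u + g y) * g y)) = \<theta> * (u * g z) + q z" for u z
  proof -
    have "(\<Sum>y\<in>UNIV. P z y * ((u + g y) * g y)) = (\<Sum>y\<in>UNIV. u * (P z y * g y) + P z y * (g y)\<^sup>2)"
      by (rule sum.cong) (auto simp: power2_eq_square algebra_simps)
    also have "\<dots> = u * (\<theta> * g z) + q z"
      unfolding sum.distrib sum_distrib_left[symmetric] eig q_def ..
    finally show ?thesis by simp
  qed
  have s1: "s 1 = 1" and t1: "t 1 = 1"
    using norm by (auto simp: s_def t_def F_def word_expectation_def sum_words_1 power2_eq_square)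
  have sS: "s (Suc n) = s n + 2 * \<theta> * t n + 1" if "1 \<le> n" for n
    unfolding s_def t_def word_expectation_Suc[OF that] Fsnoc row2
    by (simp only: word_expectation_add word_expectation_cmult q[OF that])
  have tS: "t (Suc n) = \<theta> * t n + 1" if "1 \<le> n" for n
    unfolding t_def word_expectation_Suc[OF that] Fsnoc last_snoc row3
    by (simp only: word_expectation_add word_expectation_cmult q[OF that])
  show "word_expectation n F = 0" using n
  proof (induction n rule: nat_induct_at_least)
    case base show ?case using mean by (simp add: word_expectation_def sum_words_1 F_def)
  next
    case (Suc n)
    have "word_expectation n (\<lambda>w. g (last w)) = 0"
      unfolding word_expectation_def sum_word_weight_last[OF Suc.hyps] by (rule mean)
    thus ?case using Suc.IH
      unfolding word_expectation_Suc[OF Suc.hyps] Fsnoc row1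
      by (simp add: word_expectation_add word_expectation_cmult)
  qed
  have "min 1 ((1 + \<theta>) / (1 - \<theta>)) * real n \<le> s n"
  proof (cases "0 \<le> \<theta>")
    case True
    have "real n \<le> s n \<and> 0 \<le> t n" using n
    proof (induction n rule: nat_induct_at_least)
      case base show ?case using s1 t1 by simp
    next
      case (Suc n)
      have "0 \<le> \<theta> * t n" using Suc True by simp
      thus ?case using Suc sS[OF Suc.hyps] tS[OF Suc.hyps] by simp
    qed
    moreover have "min 1 ((1 + \<theta>) / (1 - \<theta>)) * real n \<le> 1 * real n" by (intro mult_right_mono) auto
    ultimately show ?thesis by simp
  next
    case False
    have "(1 - \<theta>) * s n = real n * (1 + \<theta>) - 2 * \<theta> * t n \<and> 0 \<le> t n \<and> t n \<le> 1" using n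
    proof (induction n rule: nat_induct_at_least)
      case base show ?case using s1 t1 by simp
    next
      case (Suc n)
      have "- 1 \<le> \<theta> * t n" "\<theta> * t n \<le> 0"
      proof -
        have "(- \<theta>) * t n \<le> 1 * 1" using Suc False \<theta> by (intro mult_mono) auto
        thus "- 1 \<le> \<theta> * t n" by simp
        show "\<theta> * t n \<le> 0" using Suc False by (simp add: mult_nonpos_nonneg)
      qed
      moreover have "(1 - \<theta>) * s (Suc n) = real (Suc n) * (1 + \<theta>) - 2 * \<theta> * t (Suc n)"
      proof -
        have "(1 - \<theta>) * s (Suc n) = (1 - \<theta>) * s n + (1 - \<theta>) * (2 * \<theta> * t n + 1)"
          by (simp add: sS[OF Suc.hyps] algebra_simps)
        also have "\<dots> = real n * (1 + \<theta>) - 2 * \<theta> * t n + (1 - \<theta>) * (2 * \<theta> * t n + 1)" using Suc.IH by simp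
        also have "\<dots> = real (Suc n) * (1 + \<theta>) - 2 * \<theta> * t (Suc n)"
          by (simp add: tS[OF Suc.hyps] algebra_simps)
        finally show ?thesis .
      qed
      ultimately show ?case using tS[OF Suc.hyps] by simp
    qed
    moreover have "\<theta> * t n \<le> 0" using calculation False by (simp add: mult_nonpos_nonneg)
    ultimately have "real n * (1 + \<theta>) \<le> (1 - \<theta>) * s n" by simp
    hence "(1 + \<theta>) / (1 - \<theta>) * real n \<le> s n" using False by (simp add: field_simps)
    moreover have "min 1 ((1 + \<theta>) / (1 - \<theta>)) * real n \<le> (1 + \<theta>) / (1 - \<theta>) * real n"
      by (intro mult_right_mono) auto
    ultimately show ?thesis by linarith
  qed
  thus "min 1 ((1 + \<theta>) / (1 - \<theta>)) * real n \<le> word_expectation n (\<lambda>w. (F w)\<^sup>2)" by (simp add: s_def)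
qed

text \<open>A step of the window replaces the first letter by a new last letter.\<close>

lemma additive_step_energy:
  assumes norm: "(\<Sum>x\<in>UNIV. \<pi> x * (g x)\<^sup>2) = 1"
  shows "step_energy n (\<lambda>w. sum_list (map g w)) \<le> 4"
proof -
  have "step_energy n (\<lambda>w. sum_list (map g w))
      \<le> word_expectation (n + 1) (\<lambda>w. 2 * (g (last w))\<^sup>2 + 2 * (g (hd (take 1 w)))\<^sup>2)"
    unfolding step_energy_def
  proof (rule word_expectation_mono)
    fix w :: "'a list" assume w: "length w = n + 1"
    hence "w \<noteq> []" by auto
    have "g (hd w) + sum_list (map g (drop 1 w)) = sum_list (map g w)"
      using \<open>w \<noteq> []\<close> by (cases w) auto
    moreover have "take n w = butlast w" using w by (simp add: butlast_conv_take)
    hence "sum_list (map g (take n w)) + g (last w) = sum_list (map g w)"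
      using arg_cong[OF append_butlast_last_id[OF \<open>w \<noteq> []\<close>], of "\<lambda>v. sum_list (map g v)"] by simp
    moreover have "hd (take 1 w) = hd w" using \<open>w \<noteq> []\<close> by (cases w) auto
    ultimately have "sum_list (map g (drop 1 w)) - sum_list (map g (take n w)) = g (last w) - g (hd (take 1 w))"
      by simp
    thus "(sum_list (map g (drop 1 w)) - sum_list (map g (take n w)))\<^sup>2
        \<le> 2 * (g (last w))\<^sup>2 + 2 * (g (hd (take 1 w)))\<^sup>2"
      using square_diff_le[of "g (last w)" "g (hd (take 1 w))" 0] by simp
  qed
  also have "\<dots> = 2 * word_expectation (n + 1) (\<lambda>w. (g (last w))\<^sup>2)
      + 2 * word_expectation (n + 1) (\<lambda>w. (g (hd (take 1 w)))\<^sup>2)"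
    by (simp only: word_expectation_add word_expectation_cmult)
  also have "word_expectation (n + 1) (\<lambda>w. (g (last w))\<^sup>2) = 1"
    unfolding word_expectation_def using sum_word_weight_last[of "n + 1" "\<lambda>x. (g x)\<^sup>2"] norm by simp
  also have "word_expectation (n + 1) (\<lambda>w. (g (hd (take 1 w)))\<^sup>2) = 1"
    using word_expectation_take[of 1 n "\<lambda>v. (g (hd v))\<^sup>2"] norm
    by (simp add: word_expectation_def sum_words_1)
  finally show ?thesis by simp
qed

end

section \<open>The order of the gap\<close>

theorem corollary10p3:
  fixes P :: "'a::finite \<Rightarrow> 'a \<Rightarrow> real" and \<pi> :: "'a \<Rightarrow> real"
  assumes "CARD('a) \<ge> 2"
    and "markov_kernel P"
    and "irreducible_kernel P"
    and "aperiodic_kernel P"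
    and "stationary_law P \<pi>"
    and "reversible_kernel P \<pi>"
  shows "\<exists>c\<^sub>1 c\<^sub>2 :: real. 0 < c\<^sub>1 \<and> c\<^sub>1 \<le> c\<^sub>2 \<and>
    (\<forall>(M :: 'w measure) X. stationary_markov_chain M X P \<pi> \<longrightarrow>
      (\<forall>n::nat. n \<ge> 2 \<longrightarrow>
        c\<^sub>1 / real n \<le> spectral_gap (count_support M X n) (projected_count_kernel M X n) \<and>
        spectral_gap (count_support M X n) (projected_count_kernel M X n) \<le> c\<^sub>2 / real n))"
proof -
  interpret ergodic_kernel P \<pi> by unfold_locales (fact assms)+
  obtain C where C: "0 < C" and poincare: "\<forall>n F. 1 \<le> n \<longrightarrow> (\<forall>v w. mset v = mset w \<longrightarrow> F v = F w) \<longrightarrow>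
    word_expectation n (\<lambda>w. (F w)\<^sup>2) - (word_expectation n F)\<^sup>2 \<le> C * real n * step_energy n F"
    using window_poincare by blast
  obtain g \<theta> where g: "\<bar>\<theta>\<bar> < 1" "\<And>x. (\<Sum>y\<in>UNIV. P x y * g y) = \<theta> * g x"
    "(\<Sum>x\<in>UNIV. \<pi> x * g x) = 0" "(\<Sum>x\<in>UNIV. \<pi> x * (g x)\<^sup>2) = 1"
    by (rule nontrivial_eigenfunction[OF assms(1)]) (rule that)
  define c where "c = min 1 ((1 + \<theta>) / (1 - \<theta>))"
  have c: "0 < c" using g(1) by (auto simp: c_def)
  define f where "f k = (\<Sum>x\<in>UNIV. real (k x) * g x)" for k :: "'a \<Rightarrow> nat"
  have f: "f (letter_count w) = sum_list (map g w)" for w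
    unfolding f_def by (rule sum_list_letter_count)
  define c1 where "c1 = 1 / (2 * C)"
  \<comment> \<open>The maximum only ensures \<open>c1 \<le> c2\<close>.\<close>
  define c2 where "c2 = max c1 (2 / c)"
  have main: "c1 / real n \<le> spectral_gap (count_support M X n) (projected_count_kernel M X n) \<and>
      spectral_gap (count_support M X n) (projected_count_kernel M X n) \<le> c2 / real n"
    if chain: "stationary_markov_chain M X P \<pi>" and n: "2 \<le> n" for M :: "'w measure" and X n
  proof -
    define S where "S = count_set n"
    define \<mu> where "\<mu> = count_prob n"
    define Q where "Q = (\<lambda>k l. count_joint n k l / count_prob n k)"
    have n1: "1 \<le> n" using n by simp
    interpret counts: reversible_on S \<mu> Q
      unfolding S_def \<mu>_def Q_def by (rule count_kernel_reversible)
    have energy: "kernel_energy S \<mu> Q h = step_energy n (\<lambda>w. h (letter_count w))" for h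
      unfolding S_def \<mu>_def Q_def by (rule count_kernel_energy)
    have variance: "set_variance S \<mu> h
        = word_expectation n (\<lambda>w. (h (letter_count w))\<^sup>2) - (word_expectation n (\<lambda>w. h (letter_count w)))\<^sup>2" for h
      unfolding S_def \<mu>_def by (rule count_set_variance)
    note moments = eigenfunction_sum_moments[OF g(2,1,3,4) n1, folded c_def]
    have var: "c * real n \<le> set_variance S \<mu> f"
      unfolding variance f using moments by simp
    have var0: "0 < set_variance S \<mu> f" using var c n mult_pos_pos[of c "real n"] by linarith
    have card: "2 \<le> card S"
    proof (rule ccontr)
      assume "\<not> 2 \<le> card S"
      moreover have "card S \<noteq> 0" using counts.mass counts.fin by auto
      ultimately have "card S = 1" by simp
      then obtain k where k: "S = {k}" by (auto simp: card_1_singleton_iff)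
      hence "\<mu> k = 1" using counts.mass by simp
      thus False using var0 k by (simp add: set_variance_def)
    qed
    have "c1 / real n \<le> spectral_gap S Q"
    proof (rule counts.spectral_gap_lower[OF card])
      fix h
      have "set_variance S \<mu> h \<le> C * real n * kernel_energy S \<mu> Q h"
        unfolding variance energy by (rule poincare[rule_format, OF n1]) simp
      thus "2 * (c1 / real n) * set_variance S \<mu> h \<le> kernel_energy S \<mu> Q h"
        using C n by (simp add: c1_def field_simps)
    qed
    moreover have "spectral_gap S Q \<le> 2 / (c * real n)"
    proof (rule counts.spectral_gap_upper[OF card _ var0])
      have "kernel_energy S \<mu> Q f \<le> 4" unfolding energy f by (rule additive_step_energy[OF g(4)])
      also have "4 \<le> 2 * (2 / (c * real n)) * set_variance S \<mu> f"
        using var c n by (simp add: field_simps)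
      finally show "kernel_energy S \<mu> Q f \<le> 2 * (2 / (c * real n)) * set_variance S \<mu> f" .
    qed (use c in simp)
    moreover have "2 / (c * real n) \<le> c2 / real n"
    proof -
      have "2 / (c * real n) = (2 / c) / real n" by simp
      also have "\<dots> \<le> c2 / real n" by (rule divide_right_mono) (auto simp: c2_def)
      finally show ?thesis .
    qed
    ultimately show ?thesis
      unfolding count_support_words[OF chain n1] projected_count_kernel_words[OF chain n1]
      unfolding S_def[symmetric] Q_def[symmetric] by linarith
  qed
  have "0 < c1" "c1 \<le> c2" using C by (auto simp: c1_def c2_def)
  thus ?thesis using main by blast
qed

end
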